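(* Let $\boldsymbol\varepsilon,\boldsymbol\varepsilon'\in\{\pm1\}^6$, and let $P$ and $Q$ be arbitrary complex-valued functions on the discrete set $\{\xi_n^{(h)}:1\le n\le N,\ h\in\{0,1\}\}$, with associated separate states ${}_{\boldsymbol\varepsilon}\langle P|$ and $|Q\rangle_{\boldsymbol\varepsilon'}$. Then their scalar product is $${}_{\boldsymbol\varepsilon}\langle P|Q\rangle_{\boldsymbol\varepsilon'}=\frac{\det_{1\le i,j\le N}\left[P(\xi_i^{(0)})Q(\xi_i^{(0)})\,\Theta_N^{(j)}(\xi_i^{(1)})-\dfrac{\mathsf a_{\boldsymbol\varepsilon}(\frac\eta2+\xi_i)}{\mathsf a_{\boldsymbol\varepsilon'}(\frac\eta2-\xi_i)}P(\xi_i^{(1)})Q(\xi_i^{(1)})\,\Theta_N^{(j)}(\xi_i^{(0)})\right]}{\det_{1\le i,j\le N}\left[\Theta_N^{(j)}(\xi_i)\right]},$$ where $\{\Theta_N^{(j)}\}_{1\le j\le N}$ is any basis of the space $\Xi_N$ of even elliptic polynomials of order $2(N-1)$, and the ratio is independent of the choice of this basis.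
   Context: **Theta functions.** Fix $\omega$ with $\Im\omega>0$. For $\tau\in\{\omega,2\omega\}$ and $q=e^{i\pi\tau}$, with $q^{s}:=e^{i\pi\tau s}$: $\theta_1(\lambda|\tau)=2\sum_{n\ge0}(-1)^nq^{(n+1/2)^2}\sin((2n+1)\lambda)$, $\theta_2(\lambda|\tau)=2\sum_{n\ge0}q^{(n+1/2)^2}\cos((2n+1)\lambda)$, $\theta_3(\lambda|\tau)=1+2\sum_{n\ge1}q^{n^2}\cos(2n\lambda)$, $\theta_4(\lambda|\tau)=1+2\sum_{n\ge1}(-1)^nq^{n^2}\cos(2n\lambda)$. Write $\theta_j(\lambda)=\theta_j(\lambda|\omega)$, $\vartheta_j(\lambda)=\theta_j(\lambda|2\omega)$, $\theta=\theta_1$ and $\theta_{\mathrm s}(\lambda,\mu)=\theta(\lambda-\mu)\theta(\lambda+\mu)$. "Modulo $(\pi,\pi\omega)$" means modulo $\mathbb Z\pi+\mathbb Z\pi\omega$. The crossing parameter $\eta\in\mathbb C$ is generic: $n\eta\notin\mathbb Z\pi+\mathbb Z\pi\omega$ for every nonzero integer $n$. $V(\zeta_1,\dots,\zeta_n)=\prod_{1\le i<j\le n}\theta_{\mathrm s}(\zeta_j,\zeta_i)$. $\Xi_N$ is the ($N$-dimensional) space of entire functions $f$ with $f(-u)=f(u)$, $f(u+\pi)=f(u)$, $f(u+\pi\omega)=(-e^{-2iu-i\pi\omega})^{2(N-1)}f(u)$. **Model.** The R-matrix on $\mathbb C^2\otimes\mathbb C^2$ (in the ordered standard basis) is $$R(\lambda)=\begin{pmatrix}\mathrm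 a&0&0&\mathrm d\\0&\mathrm b&\mathrm c&0\\0&\mathrm c&\mathrm b&0\\\mathrm d&0&0&\mathrm a\end{pmatrix}(\lambda),$$ with $\mathrm a(\lambda)=\frac{2\vartheta_4(\eta)\vartheta_1(\lambda+\eta)\vartheta_4(\lambda)}{\theta_2(0)\vartheta_4(0)}$, $\mathrm b(\lambda)=\frac{2\vartheta_4(\eta)\vartheta_1(\lambda)\vartheta_4(\lambda+\eta)}{\theta_2(0)\vartheta_4(0)}$, $\mathrm c(\lambda)=\frac{2\vartheta_1(\eta)\vartheta_4(\lambda)\vartheta_4(\lambda+\eta)}{\theta_2(0)\vartheta_4(0)}$, $\mathrm d(\lambda)=\frac{2\vartheta_1(\eta)\vartheta_1(\lambda+\eta)\vartheta_1(\lambda)}{\theta_2(0)\vartheta_4(0)}$. The boundary matrix is $$K(\lambda;\alpha_1,\alpha_2,\alpha_3)=\frac{\theta_1(2\lambda)}{2\theta_1(\lambda)}\Big[\mathbb I+c^x\frac{\theta_1(\lambda)}{\theta_4(\lambda)}\sigma^x+ic^y\frac{\theta_1(\lambda)}{\theta_3(\lambda)}\sigma^y+c^z\frac{\theta_1(\lambda)}{\theta_2(\lambda)}\sigma^z\Big],$$ $c^x=\prod_{\ell=1}^3\frac{\theta_4(\alpha_\ell)}{\theta_1(\alpha_\ell)}$, $c^y=-\prod_{\ell=1}^3\frac{\theta_3(\alpha_\ell)}{\theta_1(\alpha_\ell)}$, $c^z=\prod_{\ell=1}^3\frac{\theta_2(\alpha_\ell)}{\theta_1(\alpha_\ell)}$.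 With six arbitrary boundary parameters $\alpha_i^\pm$ ($i=1,2,3$), $K_-(\lambda)=K(\lambda-\eta/2;\alpha_1^-,\alpha_2^-,\alpha_3^-)$ and $K_+(\lambda)=K(\lambda+\eta/2;\alpha_1^+,\alpha_2^+,\alpha_3^+)$. With inhomogeneities $\xi_1,\dots,\xi_N\in\mathbb C$, on $\mathcal H_0\otimes\mathcal H$, $\mathcal H_0=\mathbb C^2$, $\mathcal H=(\mathbb C^2)^{\otimes N}$: $T(\lambda)=R_{01}(\lambda-\xi_1-\eta/2)\cdots R_{0N}(\lambda-\xi_N-\eta/2)$, $\hat T(\lambda)=R_{0N}(\lambda+\xi_N-\eta/2)\cdots R_{01}(\lambda+\xi_1-\eta/2)$. The transfer matrix $\mathcal T(\lambda)=\mathrm{tr}_0[K_+(\lambda)T(\lambda)K_-(\lambda)\hat T(\lambda)]$ is a commuting family of operators on $\mathcal H$. **Notation.** $\xi_n^{(h)}=\xi_n+\eta/2-h\eta$ for $h\in\{0,1\}$, $1\le n\le N$; $\xi_0^{(0)}=\frac\eta2$, $\xi_{-1}^{(0)}=\frac\eta2+\frac\pi2$, $\xi_{-2}^{(0)}=\frac\eta2+\frac{\pi\omega}2$, $\xi_{-3}^{(0)}=\frac\eta2+\frac{\pi+\pi\omega}2$. $a(\lambda)=\prod_{n=1}^N\theta(\lambda-\xi_n+\eta/2)$, $d(\lambda)=a(\lambda-\eta)$. For $\boldsymbol\varepsilon=(\epsilon_1^+,\epsilon_2^+,\epsilon_3^+,\epsilon_1^-,\epsilon_2^-,\epsilon_3^-)\in\{\pm1\}^6$,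 $$\mathsf a_{\boldsymbol\varepsilon}(\lambda)=\prod_{\sigma=\pm}\prod_{i=1}^3\frac{\theta(\lambda-\frac\eta2-\epsilon_i^\sigma\alpha_i^\sigma)}{\theta(-\epsilon_i^\sigma\alpha_i^\sigma)},\qquad \mathbf A_{\boldsymbol\varepsilon}(\lambda)=(-1)^N\frac{\theta(2\lambda+\eta)}{\theta(2\lambda)}\mathsf a_{\boldsymbol\varepsilon}(\lambda)a(\lambda)d(-\lambda).$$ **Standing assumptions.** The inhomogeneities are generic; in particular the points $\epsilon\,\xi_n^{(h)}$ ($1\le n\le N$, $h\in\{0,1\}$, $\epsilon=\pm1$) and $\epsilon\,\xi_{-j}^{(0)}$ ($0\le j\le3$, $\epsilon=\pm1$) are pairwise distinct modulo $(\pi,\pi\omega)$, the $\xi_n$ are such that $V(\xi_1,\dots,\xi_N)\ne0$, and all $\theta(\alpha_i^\sigma)$, $\mathbf A_{\boldsymbol\varepsilon}(\frac\eta2-\xi_n)$, $\mathbf A_{\boldsymbol\varepsilon'}(\frac\eta2-\xi_n)$ are nonzero. $K_+(\lambda)$ and $K_-(\lambda)$ are not both proportional to the identity. **SoV bases.** Fix a covector $\langle S|\in\mathcal H^*$ such that the covectors, $\mathbf h=(h_1,\dots,h_N)\in\{0,1\}^N$, $${}_{\boldsymbol\varepsilon}\langle\mathbf h|=\langle S|\prod_{n=1}^N\Big(\frac{\mathcal T(\xi_n-\frac\eta2)}{\mathbf A_{\boldsymbol\varepsilon}(\frac\eta2-\xi_n)}\Big)^{1-h_n}$$ form a basis of $\mathcal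 H^*$ (true for almost any $\langle S|$ and inhomogeneities). Fix a constant $\mathcal N_0\ne0$ and let $|R\rangle\in\mathcal H$ be the unique vector with ${}_{\boldsymbol\varepsilon}\langle\mathbf h|R\rangle=\delta_{\mathbf h,\mathbf 0}\,\mathcal N_0/[V(\xi_1^{(0)},\dots,\xi_N^{(0)})V(\xi_1,\dots,\xi_N)]$ (for the sign vector $\boldsymbol\varepsilon$ of the left states). With this same vector $|R\rangle$, for $\boldsymbol\kappa\in\{\boldsymbol\varepsilon,\boldsymbol\varepsilon'\}$ set $$|\mathbf h\rangle_{\boldsymbol\kappa}=\prod_{n=1}^N\Big(\frac{\theta(2\xi_n-2\eta)}{\theta(2\xi_n+2\eta)}\frac{\mathcal T(\xi_n+\frac\eta2)}{\mathbf A_{\boldsymbol\kappa}(\frac\eta2-\xi_n)}\Big)^{h_n}|R\rangle .$$ Then ${}_{\boldsymbol\varepsilon}\langle\mathbf h|\mathbf k\rangle_{\boldsymbol\varepsilon}=\delta_{\mathbf h,\mathbf k}\,\mathcal N_0/[V(\xi_1^{(h_1)},\dots,\xi_N^{(h_N)})V(\xi_1,\dots,\xi_N)]$ and $|\mathbf h\rangle_{\boldsymbol\varepsilon'}=\prod_{n=1}^N\big(\mathsf a_{\boldsymbol\varepsilon}(\frac\eta2-\xi_n)/\mathsf a_{\boldsymbol\varepsilon'}(\frac\eta2-\xi_n)\big)^{h_n}|\mathbf h\rangle_{\boldsymbol\varepsilon}$. **Separate states.** $$|Q\rangle_{\boldsymbol\varepsilon'}=\sum_{\mathbf h\in\{0,1\}^N}\prod_{n=1}^NQ(\xi_n^{(h_n)})\,V(\xi_1^{(h_1)},\dots,\xi_N^{(h_N)})\,|\mathbf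 h\rangle_{\boldsymbol\varepsilon'},$$ $${}_{\boldsymbol\varepsilon}\langle P|=\frac1{\mathcal N_0}\sum_{\mathbf h\in\{0,1\}^N}\prod_{n=1}^N\Big[\Big(-\frac{\mathsf a_{\boldsymbol\varepsilon}(\frac\eta2+\xi_n)}{\mathsf a_{\boldsymbol\varepsilon}(\frac\eta2-\xi_n)}\Big)^{h_n}P(\xi_n^{(h_n)})\Big]V(\xi_1^{(1-h_1)},\dots,\xi_N^{(1-h_N)})\;{}_{\boldsymbol\varepsilon}\langle\mathbf h| .$$ *)

theory Defs
  imports "HOL-Analysis.Analysis" "HOL-Library.Function_Algebras"
begin

text \<open>
  Conventions. The sites form a nonempty finite linearly ordered type \<open>'n\<close>, so that
  \<open>N = CARD('n)\<close>. A basis vector of the chain is a configuration \<open>'n \<Rightarrow> bool\<close>, where \<open>False\<close> is the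
  first and \<open>True\<close> the second standard basis vector of the local space. Vectors and covectors are
  both coordinate tuples; an operator acts on the former by \<open>A *v x\<close> and on the latter by \<open>x v* A\<close>.
  The labels \<open>h\<^sub>n \<in> {0,1}\<close> are booleans as well, with \<open>False = 0\<close> and \<open>True = 1\<close>.
\<close>


section \<open>Theta functions\<close>

text \<open>The nome is \<open>exp (\<i> \<pi> \<tau>)\<close>. The infinite sums of \<open>theta3\<close> and \<open>theta4\<close> start at \<open>n = 1\<close>.\<close>

definition qpow :: "complex \<Rightarrow> complex \<Rightarrow> complex" where
  "qpow \<tau> s = exp (\<i> * of_real pi * \<tau> * s)"

definition theta1 :: "complex \<Rightarrow> complex \<Rightarrow> complex" where
  "theta1 \<tau> u =
     2 * (\<Sum>n. (-1) ^ n * qpow \<tau> ((of_nat n + 1/2)\<^sup>2) * sin ((2 * of_nat n + 1) * u))"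

definition theta2 :: "complex \<Rightarrow> complex \<Rightarrow> complex" where
  "theta2 \<tau> u =
     2 * (\<Sum>n. qpow \<tau> ((of_nat n + 1/2)\<^sup>2) * cos ((2 * of_nat n + 1) * u))"

definition theta3 :: "complex \<Rightarrow> complex \<Rightarrow> complex" where
  "theta3 \<tau> u =
     1 + 2 * (\<Sum>n. qpow \<tau> ((of_nat (Suc n))\<^sup>2) * cos (2 * of_nat (Suc n) * u))"

definition theta4 :: "complex \<Rightarrow> complex \<Rightarrow> complex" where
  "theta4 \<tau> u =
     1 + 2 * (\<Sum>n. (-1) ^ Suc n * qpow \<tau> ((of_nat (Suc n))\<^sup>2) * cos (2 * of_nat (Suc n) * u))"

definition theta_s :: "complex \<Rightarrow> complex \<Rightarrow> complex \<Rightarrow> complex" where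
  "theta_s \<omega> x y = theta1 \<omega> (x - y) * theta1 \<omega> (x + y)"

definition period_lattice :: "complex \<Rightarrow> complex set" where
  "period_lattice \<omega> =
     {of_int m * of_real pi + of_int n * (of_real pi * \<omega>) | m n :: int. True}"

definition eq_mod :: "complex \<Rightarrow> complex \<Rightarrow> complex \<Rightarrow> bool" where
  "eq_mod \<omega> x y \<longleftrightarrow> x - y \<in> period_lattice \<omega>"

definition ell_vand :: "complex \<Rightarrow> ('n::{finite,linorder} \<Rightarrow> complex) \<Rightarrow> complex" where
  "ell_vand \<omega> \<zeta> = (\<Prod>(i, j) \<in> {(i, j). i < j}. theta_s \<omega> (\<zeta> j) (\<zeta> i))"


section \<open>Even elliptic polynomials\<close>

definition Xi_space :: "complex \<Rightarrow> nat \<Rightarrow> (complex \<Rightarrow> complex) set" where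
  "Xi_space \<omega> N =
     {f. f holomorphic_on UNIV \<and>
         (\<forall>u. f (- u) = f u) \<and>
         (\<forall>u. f (u + of_real pi) = f u) \<and>
         (\<forall>u. f (u + of_real pi * \<omega>) =
                (- exp (- 2 * \<i> * u - \<i> * of_real pi * \<omega>)) ^ (2 * (N - 1)) * f u)}"

interpretation cfun: vector_space "\<lambda>(c::complex) (f::complex \<Rightarrow> complex) u. c * f u"
  by unfold_locales (simp_all add: fun_eq_iff algebra_simps)

definition Xi_basis :: "complex \<Rightarrow> ('n::finite \<Rightarrow> complex \<Rightarrow> complex) \<Rightarrow> bool" where
  "Xi_basis \<omega> \<Theta> \<longleftrightarrow>
     inj \<Theta> \<and> cfun.independent (range \<Theta>) \<and> cfun.span (range \<Theta>) = Xi_space \<omega> CARD('n)"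


section \<open>The open XYZ chain\<close>

definition scale_mat :: "complex \<Rightarrow> complex ^ 'k ^ 'm \<Rightarrow> complex ^ 'k ^ 'm" where
  "scale_mat c A = (\<chi> i j. c * A $ i $ j)"

definition sigma_x :: "complex ^ bool ^ bool" where
  "sigma_x = (\<chi> a b. if a \<noteq> b then 1 else 0)"

definition sigma_y :: "complex ^ bool ^ bool" where
  "sigma_y = (\<chi> a b. if a = b then 0 else if a then \<i> else - \<i>)"

definition sigma_z :: "complex ^ bool ^ bool" where
  "sigma_z = (\<chi> a b. if a \<noteq> b then 0 else if a then -1 else 1)"

definition weight_a :: "complex \<Rightarrow> complex \<Rightarrow> complex \<Rightarrow> complex" where
  "weight_a \<omega> \<eta> u =
     2 * theta4 (2*\<omega>) \<eta> * theta1 (2*\<omega>) (u + \<eta>) * theta4 (2*\<omega>) u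
       / (theta2 \<omega> 0 * theta4 (2*\<omega>) 0)"

definition weight_b :: "complex \<Rightarrow> complex \<Rightarrow> complex \<Rightarrow> complex" where
  "weight_b \<omega> \<eta> u =
     2 * theta4 (2*\<omega>) \<eta> * theta1 (2*\<omega>) u * theta4 (2*\<omega>) (u + \<eta>)
       / (theta2 \<omega> 0 * theta4 (2*\<omega>) 0)"

definition weight_c :: "complex \<Rightarrow> complex \<Rightarrow> complex \<Rightarrow> complex" where
  "weight_c \<omega> \<eta> u =
     2 * theta1 (2*\<omega>) \<eta> * theta4 (2*\<omega>) u * theta4 (2*\<omega>) (u + \<eta>)
       / (theta2 \<omega> 0 * theta4 (2*\<omega>) 0)"

definition weight_d :: "complex \<Rightarrow> complex \<Rightarrow> complex \<Rightarrow> complex" where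
  "weight_d \<omega> \<eta> u =
     2 * theta1 (2*\<omega>) \<eta> * theta1 (2*\<omega>) (u + \<eta>) * theta1 (2*\<omega>) u
       / (theta2 \<omega> 0 * theta4 (2*\<omega>) 0)"

text \<open>
  In the ordered basis \<open>(F,F), (F,T), (T,F), (T,T)\<close> this is the matrix with rows
  \<open>a 0 0 d\<close>, \<open>0 b c 0\<close>, \<open>0 c b 0\<close>, \<open>d 0 0 a\<close>.
\<close>

definition R_mat :: "complex \<Rightarrow> complex \<Rightarrow> complex \<Rightarrow> complex ^ (bool \<times> bool) ^ (bool \<times> bool)" where
  "R_mat \<omega> \<eta> u =
     (\<chi> p q.
        if p = q then (if fst p = snd p then weight_a \<omega> \<eta> u else weight_b \<omega> \<eta> u)
        else if fst p \<noteq> fst q \<and> snd p \<noteq> snd q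
          then (if fst p = snd p then weight_d \<omega> \<eta> u else weight_c \<omega> \<eta> u)
        else 0)"

definition c_x :: "complex \<Rightarrow> (3 \<Rightarrow> complex) \<Rightarrow> complex" where
  "c_x \<omega> \<beta> = (\<Prod>l\<in>UNIV. theta4 \<omega> (\<beta> l) / theta1 \<omega> (\<beta> l))"

definition c_y :: "complex \<Rightarrow> (3 \<Rightarrow> complex) \<Rightarrow> complex" where
  "c_y \<omega> \<beta> = - (\<Prod>l\<in>UNIV. theta3 \<omega> (\<beta> l) / theta1 \<omega> (\<beta> l))"

definition c_z :: "complex \<Rightarrow> (3 \<Rightarrow> complex) \<Rightarrow> complex" where
  "c_z \<omega> \<beta> = (\<Prod>l\<in>UNIV. theta2 \<omega> (\<beta> l) / theta1 \<omega> (\<beta> l))"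

text \<open>
  The singularities of this formula, at the zeros of \<open>theta1 \<omega>\<close>, \<dots>, \<open>theta4 \<omega>\<close>, i.e. at
  \<open>2 u \<in> period_lattice \<omega>\<close>, are removable, and the value given to \<open>K_mat\<close> there by \<open>x / 0 = 0\<close> is not
  that of the continuation. The states below only involve arguments \<open>u\<close> among \<open>\<xi>\<^sub>n\<close>, \<open>\<xi>\<^sub>n - \<eta>\<close> and
  \<open>\<xi>\<^sub>n + \<eta>\<close>, which \<open>generic_inhom\<close> keeps away from these points.
\<close>

definition K_mat :: "complex \<Rightarrow> (3 \<Rightarrow> complex) \<Rightarrow> complex \<Rightarrow> complex ^ bool ^ bool" where
  "K_mat \<omega> \<beta> u =
     scale_mat (theta1 \<omega> (2 * u) / (2 * theta1 \<omega> u))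
       (mat 1
        + scale_mat (c_x \<omega> \<beta> * (theta1 \<omega> u / theta4 \<omega> u)) sigma_x
        + scale_mat (\<i> * c_y \<omega> \<beta> * (theta1 \<omega> u / theta3 \<omega> u)) sigma_y
        + scale_mat (c_z \<omega> \<beta> * (theta1 \<omega> u / theta2 \<omega> u)) sigma_z)"

datatype side = PlusSide | MinusSide

definition K_minus :: "complex \<Rightarrow> complex \<Rightarrow> (side \<Rightarrow> 3 \<Rightarrow> complex) \<Rightarrow> complex \<Rightarrow> complex ^ bool ^ bool"
  where "K_minus \<omega> \<eta> \<alpha> u = K_mat \<omega> (\<alpha> MinusSide) (u - \<eta>/2)"

definition K_plus :: "complex \<Rightarrow> complex \<Rightarrow> (side \<Rightarrow> 3 \<Rightarrow> complex) \<Rightarrow> complex \<Rightarrow> complex ^ bool ^ bool"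
  where "K_plus \<omega> \<eta> \<alpha> u = K_mat \<omega> (\<alpha> PlusSide) (u + \<eta>/2)"

type_synonym 'n chain_vec = "complex ^ ('n \<Rightarrow> bool)"
type_synonym 'n chain_op = "complex ^ ('n \<Rightarrow> bool) ^ ('n \<Rightarrow> bool)"
type_synonym 'n ext_op = "complex ^ (bool \<times> ('n \<Rightarrow> bool)) ^ (bool \<times> ('n \<Rightarrow> bool))"

definition on_aux :: "complex ^ bool ^ bool \<Rightarrow> 'n::finite ext_op" where
  "on_aux A = (\<chi> p q. if snd p = snd q then A $ fst p $ fst q else 0)"

definition on_aux_site :: "'n \<Rightarrow> complex ^ (bool \<times> bool) ^ (bool \<times> bool) \<Rightarrow> 'n::finite ext_op" where
  "on_aux_site n A =
     (\<chi> p q. if \<forall>m. m \<noteq> n \<longrightarrow> snd p m = snd q m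
             then A $ (fst p, snd p n) $ (fst q, snd q n) else 0)"

definition trace_aux :: "'n::finite ext_op \<Rightarrow> 'n chain_op" where
  "trace_aux A = (\<chi> s t. \<Sum>a\<in>UNIV. A $ (a, s) $ (a, t))"

definition list_prod :: "(complex ^ 'k ^ 'k) list \<Rightarrow> complex ^ 'k ^ 'k" where
  "list_prod As = foldr (**) As (mat 1)"

definition sites :: "'n::{finite,linorder} list" where
  "sites = sorted_list_of_set UNIV"

definition monodromy ::
    "complex \<Rightarrow> complex \<Rightarrow> ('n::{finite,linorder} \<Rightarrow> complex) \<Rightarrow> complex \<Rightarrow> 'n ext_op" where
  "monodromy \<omega> \<eta> \<xi> u =
     list_prod (map (\<lambda>n. on_aux_site n (R_mat \<omega> \<eta> (u - \<xi> n - \<eta>/2))) sites)"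

definition monodromy_hat ::
    "complex \<Rightarrow> complex \<Rightarrow> ('n::{finite,linorder} \<Rightarrow> complex) \<Rightarrow> complex \<Rightarrow> 'n ext_op" where
  "monodromy_hat \<omega> \<eta> \<xi> u =
     list_prod (map (\<lambda>n. on_aux_site n (R_mat \<omega> \<eta> (u + \<xi> n - \<eta>/2))) (rev sites))"

definition transfer ::
    "complex \<Rightarrow> complex \<Rightarrow> (side \<Rightarrow> 3 \<Rightarrow> complex) \<Rightarrow> ('n::{finite,linorder} \<Rightarrow> complex)
      \<Rightarrow> complex \<Rightarrow> 'n chain_op" where
  "transfer \<omega> \<eta> \<alpha> \<xi> u =
     trace_aux (on_aux (K_plus \<omega> \<eta> \<alpha> u) ** monodromy \<omega> \<eta> \<xi> u
                ** on_aux (K_minus \<omega> \<eta> \<alpha> u) ** monodromy_hat \<omega> \<eta> \<xi> u)"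


section \<open>Shifted points and scalar functions\<close>

definition xi_shift :: "complex \<Rightarrow> ('n \<Rightarrow> complex) \<Rightarrow> 'n \<Rightarrow> bool \<Rightarrow> complex" where
  "xi_shift \<eta> \<xi> n h = \<xi> n + \<eta>/2 - of_bool h * \<eta>"

text \<open>\<open>xi_special \<omega> \<eta> j\<close> is the point with index \<open>-j\<close>, for \<open>j \<le> 3\<close>.\<close>

definition xi_special :: "complex \<Rightarrow> complex \<Rightarrow> nat \<Rightarrow> complex" where
  "xi_special \<omega> \<eta> j =
     \<eta>/2 + [0, of_real pi / 2, of_real pi * \<omega> / 2, (of_real pi + of_real pi * \<omega>) / 2] ! j"

definition fun_a :: "complex \<Rightarrow> complex \<Rightarrow> ('n::finite \<Rightarrow> complex) \<Rightarrow> complex \<Rightarrow> complex" where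
  "fun_a \<omega> \<eta> \<xi> u = (\<Prod>n\<in>UNIV. theta1 \<omega> (u - \<xi> n + \<eta>/2))"

definition fun_d :: "complex \<Rightarrow> complex \<Rightarrow> ('n::finite \<Rightarrow> complex) \<Rightarrow> complex \<Rightarrow> complex" where
  "fun_d \<omega> \<eta> \<xi> u = fun_a \<omega> \<eta> \<xi> (u - \<eta>)"

definition bdry_a ::
    "complex \<Rightarrow> complex \<Rightarrow> (side \<Rightarrow> 3 \<Rightarrow> complex) \<Rightarrow> (side \<Rightarrow> 3 \<Rightarrow> int) \<Rightarrow> complex \<Rightarrow> complex" where
  "bdry_a \<omega> \<eta> \<alpha> \<epsilon> u =
     (\<Prod>\<sigma>\<in>{PlusSide, MinusSide}. \<Prod>i\<in>UNIV.
        theta1 \<omega> (u - \<eta>/2 - of_int (\<epsilon> \<sigma> i) * \<alpha> \<sigma> i) / theta1 \<omega> (- of_int (\<epsilon> \<sigma> i) * \<alpha> \<sigma> i))"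

definition fun_A ::
    "complex \<Rightarrow> complex \<Rightarrow> (side \<Rightarrow> 3 \<Rightarrow> complex) \<Rightarrow> ('n::finite \<Rightarrow> complex) \<Rightarrow> (side \<Rightarrow> 3 \<Rightarrow> int)
      \<Rightarrow> complex \<Rightarrow> complex" where
  "fun_A \<omega> \<eta> \<alpha> \<xi> \<epsilon> u =
     (-1) ^ CARD('n) * (theta1 \<omega> (2 * u + \<eta>) / theta1 \<omega> (2 * u))
       * bdry_a \<omega> \<eta> \<alpha> \<epsilon> u * fun_a \<omega> \<eta> \<xi> u * fun_d \<omega> \<eta> \<xi> (- u)"


section \<open>Standing assumptions\<close>

definition sign_vector :: "(side \<Rightarrow> 3 \<Rightarrow> int) \<Rightarrow> bool" where
  "sign_vector \<epsilon> \<longleftrightarrow> (\<forall>\<sigma> i. \<epsilon> \<sigma> i \<in> {1, -1})"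

definition generic_crossing :: "complex \<Rightarrow> complex \<Rightarrow> bool" where
  "generic_crossing \<omega> \<eta> \<longleftrightarrow> (\<forall>n::int. n \<noteq> 0 \<longrightarrow> of_int n * \<eta> \<notin> period_lattice \<omega>)"

text \<open>\<open>Inl (n, h)\<close> labels a shifted inhomogeneity, \<open>Inr j\<close> with \<open>j \<le> 3\<close> a special point.\<close>

fun node :: "complex \<Rightarrow> complex \<Rightarrow> ('n \<Rightarrow> complex) \<Rightarrow> ('n \<times> bool) + nat \<Rightarrow> complex" where
  "node \<omega> \<eta> \<xi> (Inl (n, h)) = xi_shift \<eta> \<xi> n h"
| "node \<omega> \<eta> \<xi> (Inr j) = xi_special \<omega> \<eta> j"

definition generic_inhom :: "complex \<Rightarrow> complex \<Rightarrow> ('n \<Rightarrow> complex) \<Rightarrow> bool" where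
  "generic_inhom \<omega> \<eta> \<xi> \<longleftrightarrow>
     (\<forall>k \<in> UNIV <+> {..3}. \<forall>l \<in> UNIV <+> {..3}. \<forall>s \<in> {1, -1}. \<forall>t \<in> {1, -1}.
        (s, k) \<noteq> (t, l) \<longrightarrow> \<not> eq_mod \<omega> (s * node \<omega> \<eta> \<xi> k) (t * node \<omega> \<eta> \<xi> l))"


section \<open>SoV bases and separate states\<close>

text \<open>
  In the two families of states, the product over the sites of commuting transfer matrices is taken
  in increasing order of the sites.
\<close>

definition left_state ::
    "complex \<Rightarrow> complex \<Rightarrow> (side \<Rightarrow> 3 \<Rightarrow> complex) \<Rightarrow> ('n::{finite,linorder} \<Rightarrow> complex)
      \<Rightarrow> (side \<Rightarrow> 3 \<Rightarrow> int) \<Rightarrow> 'n chain_vec \<Rightarrow> ('n \<Rightarrow> bool) \<Rightarrow> 'n chain_vec" where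
  "left_state \<omega> \<eta> \<alpha> \<xi> \<epsilon> S h =
     S v* list_prod (map (\<lambda>n.
       if h n then mat 1
       else scale_mat (1 / fun_A \<omega> \<eta> \<alpha> \<xi> \<epsilon> (\<eta>/2 - \<xi> n)) (transfer \<omega> \<eta> \<alpha> \<xi> (\<xi> n - \<eta>/2))) sites)"

definition right_state ::
    "complex \<Rightarrow> complex \<Rightarrow> (side \<Rightarrow> 3 \<Rightarrow> complex) \<Rightarrow> ('n::{finite,linorder} \<Rightarrow> complex)
      \<Rightarrow> (side \<Rightarrow> 3 \<Rightarrow> int) \<Rightarrow> 'n chain_vec \<Rightarrow> ('n \<Rightarrow> bool) \<Rightarrow> 'n chain_vec" where
  "right_state \<omega> \<eta> \<alpha> \<xi> \<kappa> R h =
     list_prod (map (\<lambda>n.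
       if h n
       then scale_mat (theta1 \<omega> (2 * \<xi> n - 2 * \<eta>) / theta1 \<omega> (2 * \<xi> n + 2 * \<eta>)
                         / fun_A \<omega> \<eta> \<alpha> \<xi> \<kappa> (\<eta>/2 - \<xi> n)) (transfer \<omega> \<eta> \<alpha> \<xi> (\<xi> n + \<eta>/2))
       else mat 1) sites) *v R"

text \<open>The bilinear pairing of a covector with a vector (no complex conjugation).\<close>

definition pairing :: "'n::finite chain_vec \<Rightarrow> 'n chain_vec \<Rightarrow> complex" where
  "pairing x y = (\<Sum>s\<in>UNIV. x $ s * y $ s)"

definition covector_basis :: "(('n::finite \<Rightarrow> bool) \<Rightarrow> 'n chain_vec) \<Rightarrow> bool" where
  "covector_basis b \<longleftrightarrow> inj b \<and> vec.independent (range b) \<and> vec.span (range b) = UNIV"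

definition separate_ket ::
    "complex \<Rightarrow> complex \<Rightarrow> (side \<Rightarrow> 3 \<Rightarrow> complex) \<Rightarrow> ('n::{finite,linorder} \<Rightarrow> complex)
      \<Rightarrow> (side \<Rightarrow> 3 \<Rightarrow> int) \<Rightarrow> 'n chain_vec \<Rightarrow> (complex \<Rightarrow> complex) \<Rightarrow> 'n chain_vec" where
  "separate_ket \<omega> \<eta> \<alpha> \<xi> \<kappa> R Q =
     (\<Sum>h\<in>UNIV.
        ((\<Prod>n\<in>UNIV. Q (xi_shift \<eta> \<xi> n (h n))) * ell_vand \<omega> (\<lambda>n. xi_shift \<eta> \<xi> n (h n)))
          *s right_state \<omega> \<eta> \<alpha> \<xi> \<kappa> R h)"

definition separate_bra ::
    "complex \<Rightarrow> complex \<Rightarrow> (side \<Rightarrow> 3 \<Rightarrow> complex) \<Rightarrow> ('n::{finite,linorder} \<Rightarrow> complex)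
      \<Rightarrow> (side \<Rightarrow> 3 \<Rightarrow> int) \<Rightarrow> 'n chain_vec \<Rightarrow> complex \<Rightarrow> (complex \<Rightarrow> complex) \<Rightarrow> 'n chain_vec" where
  "separate_bra \<omega> \<eta> \<alpha> \<xi> \<epsilon> S N0 P =
     (1 / N0) *s (\<Sum>h\<in>UNIV.
        ((\<Prod>n\<in>UNIV.
            (- bdry_a \<omega> \<eta> \<alpha> \<epsilon> (\<eta>/2 + \<xi> n) / bdry_a \<omega> \<eta> \<alpha> \<epsilon> (\<eta>/2 - \<xi> n)) ^ (of_bool (h n))
              * P (xi_shift \<eta> \<xi> n (h n)))
          * ell_vand \<omega> (\<lambda>n. xi_shift \<eta> \<xi> n (\<not> h n)))
          *s left_state \<omega> \<eta> \<alpha> \<xi> \<epsilon> S h)"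

end

theory Submission
  imports Defs "HOL-Complex_Analysis.Complex_Analysis"
begin

text \<open>
  The left and the right states are orthogonal: the pairing of the left state with label \<open>h\<close> and the right state
  with label \<open>k\<close> vanishes unless \<open>h = k\<close>, and its diagonal values are known (\<open>orthogonality\<close>). The scalar product of two
  separate states is thus a single sum over \<open>h\<close>, of a product over the sites times the elliptic Vandermonde determinant
  of the points \<open>xi_shift \<eta> \<xi> n (\<not> h n)\<close>, divided by that of the \<open>\<xi> n\<close>. By interpolation, this ratio equals the ratio of the
  determinants formed by the values of any basis of even elliptic polynomials (\<open>Xi_basis_det\<close>), and the sum over \<open>h\<close>
  becomes the expansion of the determinant in the numerator by multilinearity in its rows (\<open>det_two_rows\<close>).

  Orthogonality (\<open>sov_orthogonality\<close>) rests on four properties of the transfer matrix: its values commute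
  (\<open>T_commute\<close>), its values at \<open>\<xi>\<^sub>n - \<eta>/2\<close> and \<open>\<xi>\<^sub>n + \<eta>/2\<close> multiply to a scalar (\<open>T_inversion\<close>), its values at four special points are
  scalars (\<open>T_special\<close>), and its entries are even elliptic polynomials of such an order that \<open>N + 4\<close> values determine them
  (\<open>T_Xi\<close>). If \<open>h n = 1\<close>, the value at \<open>\<xi>\<^sub>n + \<eta>/2\<close> that acts on the left state is interpolated from the special points and one
  point of each site, chosen according to \<open>h\<close>. The values at all other points keep the label \<open>h n = 1\<close>, and so
  only the value at \<open>\<xi>\<^sub>n - \<eta>/2\<close>, which changes the label to \<open>0\<close>, contributes. This gives the vanishing for
  \<open>h \<noteq> k\<close> and a one-term recursion for the diagonal values.

  These properties of the transfer matrix follow from the Yang--Baxter equation, unitarity and crossing symmetry of the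
  R-matrix and the reflection equation for the boundary matrices. All of them reduce to relations between the
  weights, and these are instances of Riemann's relations, which follow from the two formulas that express
  \<open>theta1 \<tau> s * theta2 \<tau> t\<close> and \<open>theta3 \<tau> s * theta4 \<tau> t\<close> by theta functions for \<open>2 \<tau>\<close>. The calculations are
  carried out in an abstract ring generated by Pauli operators, into which the chain is embedded together with its
  auxiliary site and one further site. Interpolation needs in addition that the zeros of \<open>theta1\<close> are simple and form
  the period lattice; this too is obtained from the product formulas.
\<close>

section \<open>Theta functions: periods and product formulas\<close>

(* The dollar sign denotes vector components throughout. *)
unbundle no fps_syntax

(* The laws of the function space cfun are stated with an abstraction on the left-hand side that
   matches any complex sum or product; algebra_simps would apply them to ordinary arithmetic. *)
declare cfun.scale_left_distrib [algebra_simps del] cfun.scale_right_distrib [algebra_simps del]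
  cfun.scale_left_diff_distrib [algebra_simps del] cfun.scale_right_diff_distrib [algebra_simps del]

lemma holomorphic_shift:
  assumes "f holomorphic_on UNIV" shows "(\<lambda>u. f (u + c)) holomorphic_on (UNIV :: complex set)"
  by (rule holomorphic_on_compose_gen[of "\<lambda>u. u + c" UNIV f UNIV, unfolded o_def])
     (auto intro!: holomorphic_intros assms)

lemma has_sum_product_complex:
  fixes f :: "'a \<Rightarrow> complex" and g :: "'b \<Rightarrow> complex"
  assumes f: "(f has_sum a) A" and g: "(g has_sum b) B"
  shows "((\<lambda>(x, y). f x * g y) has_sum (a * b)) (A \<times> B)"
proof (rule has_sum_SigmaI)
  show "((\<lambda>y. case (x, y) of (x, y) \<Rightarrow> f x * g y) has_sum (f x * b)) B" for x
    using has_sum_cmult_right[OF g] by simp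
  show "((\<lambda>x. f x * b) has_sum (a * b)) A" by (rule has_sum_cmult_left[OF f])
  have fa: "(\<lambda>x. norm (f x)) summable_on A" and ga: "(\<lambda>x. norm (g x)) summable_on B"
    using f g has_sum_imp_summable summable_on_iff_abs_summable_on_complex by blast+
  have "(\<lambda>p. norm (case p of (x, y) \<Rightarrow> f x * g y)) summable_on (A \<times> B)"
    unfolding Infinite_Sum.abs_summable_on_Sigma_iff
  proof (intro conjI ballI)
    show "(\<lambda>y. norm (case (x, y) of (x, y) \<Rightarrow> f x * g y)) summable_on B" for x
      using summable_on_cmult_right[OF ga] by (simp add: norm_mult)
    have "(\<lambda>x. norm (f x) * infsum (\<lambda>y. norm (g y)) B) summable_on A"
      by (rule summable_on_cmult_left[OF fa])
    then show "(\<lambda>x. norm (\<Sum>\<^sub>\<infinity>y\<in>B. norm (case (x, y) of (x, y) \<Rightarrow> f x * g y))) summable_on A"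
      by (simp add: norm_mult infsum_cmult_right' infsum_nonneg)
  qed
  then show "(\<lambda>(x, y). f x * g y) summable_on (A \<times> B)" by (rule abs_summable_summable)
qed

lemma has_sum_int_split:
  fixes f :: "int \<Rightarrow> complex"
  assumes "summable (\<lambda>n. norm (f (int n)))" "summable (\<lambda>n. norm (f (- int n - 1)))"
  shows "(f has_sum (\<Sum>n. f (int n) + f (- int n - 1))) UNIV"
proof -
  have 1: "(f has_sum (\<Sum>n. f (int n))) (range int)"
    using norm_summable_imp_has_sum[OF assms(1) summable_sums[OF summable_norm_cancel[OF assms(1)]]]
    by (subst has_sum_reindex) (auto simp: o_def)
  have 2: "(f has_sum (\<Sum>n. f (- int n - 1))) (range (\<lambda>n. - int n - 1))"
    using norm_summable_imp_has_sum[OF assms(2) summable_sums[OF summable_norm_cancel[OF assms(2)]]]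
    by (subst has_sum_reindex) (auto simp: o_def inj_on_def)
  have "i \<in> range int \<union> range (\<lambda>n. - int n - 1)" for i
    by (cases i rule: int_cases) auto
  then have u: "range int \<union> range (\<lambda>n. - int n - 1) = UNIV" by blast
  have d: "range int \<inter> range (\<lambda>n. - int n - 1) = {}" by auto
  show ?thesis
    using has_sum_Un_disjoint[OF 1 2 d] unfolding u
    using suminf_add[OF summable_norm_cancel[OF assms(1)] summable_norm_cancel[OF assms(2)]] by auto
qed

text \<open>Gaussian-type series converge for every \<open>z\<close>, because their exponents grow superlinearly.\<close>

lemma gauss_summable:
  fixes p z :: complex
  assumes p: "norm p < 1" and e: "\<And>n. e (Suc n) \<ge> e n + n"
  shows "summable (\<lambda>n. norm (p ^ e n * z ^ n))"
proof -
  obtain N where N: "norm p ^ N * norm z < 1/2"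
  proof -
    have "(\<lambda>n. norm p ^ n * norm z) \<longlonglongrightarrow> 0 * norm z"
      using p by (intro tendsto_intros LIMSEQ_power_zero) auto
    then have "eventually (\<lambda>n. norm p ^ n * norm z < 1/2) sequentially"
      by (rule order_tendstoD) auto
    then show ?thesis using that eventually_sequentially by auto
  qed
  show ?thesis
  proof (rule summable_ratio_test[of "1/2" N])
    fix n assume n: "n \<ge> N"
    have "norm p ^ e (Suc n) \<le> norm p ^ (e n + n)" using p e[of n] by (intro power_decreasing) auto
    also have "\<dots> = norm p ^ n * norm p ^ e n" by (simp add: power_add)
    also have "\<dots> \<le> norm p ^ N * norm p ^ e n" using n p by (intro mult_right_mono power_decreasing) auto
    finally have "norm p ^ e (Suc n) \<le> norm p ^ N * norm p ^ e n" .
    then have "norm (p ^ e (Suc n) * z ^ Suc n) \<le> (norm p ^ N * norm p ^ e n) * norm z ^ Suc n"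
      by (simp only: norm_mult norm_power) (intro mult_right_mono, auto)
    also have "\<dots> = (norm p ^ N * norm z) * (norm p ^ e n * norm z ^ n)" by simp
    also have "\<dots> \<le> 1/2 * (norm p ^ e n * norm z ^ n)" using N by (intro mult_right_mono) auto
    finally show "norm (norm (p ^ e (Suc n) * z ^ Suc n)) \<le> 1/2 * norm (norm (p ^ e n * z ^ n))"
      by (simp add: norm_mult norm_power)
  qed simp
qed

definition nome :: "complex \<Rightarrow> complex" where "nome \<tau> = exp (\<i> * of_real pi * \<tau>)"

lemma norm_nome: "Im \<tau> > 0 \<Longrightarrow> norm (nome \<tau>) < 1" by (simp add: nome_def)

text \<open>The general terms of the series of \<open>theta2\<close> and \<open>theta3\<close> written as sums over all integers,
  which makes shifts by quasi-periods and products of series mere reindexings.\<close>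

definition term2 :: "complex \<Rightarrow> complex \<Rightarrow> int \<Rightarrow> complex" where
  "term2 \<tau> u n = exp (\<i> * of_real pi * \<tau> * (of_int n + 1/2)\<^sup>2 + \<i> * (2 * of_int n + 1) * u)"
definition term3 :: "complex \<Rightarrow> complex \<Rightarrow> int \<Rightarrow> complex" where
  "term3 \<tau> u n = exp (\<i> * of_real pi * \<tau> * (of_int n)\<^sup>2 + 2 * \<i> * of_int n * u)"

lemma term2_nat: "term2 \<tau> u (int n) = exp (\<i> * of_real pi * \<tau> / 4 + \<i> * u) * (nome \<tau> ^ (n\<^sup>2 + n) * exp (2 * \<i> * u) ^ n)"
  "term2 \<tau> u (- int n - 1) = exp (\<i> * of_real pi * \<tau> / 4 - \<i> * u) * (nome \<tau> ^ (n\<^sup>2 + n) * exp (- 2 * \<i> * u) ^ n)"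
  unfolding term2_def nome_def exp_of_nat_mult[symmetric] exp_add[symmetric]
  by (rule arg_cong[where f = exp]; simp add: power2_eq_square algebra_simps)+

lemma term3_nat: "term3 \<tau> u (int n) = nome \<tau> ^ (n\<^sup>2) * exp (2 * \<i> * u) ^ n"
  "term3 \<tau> u (- int n - 1) = nome \<tau> ^ ((Suc n)\<^sup>2) * exp (- 2 * \<i> * u) ^ Suc n"
  unfolding term3_def nome_def exp_of_nat_mult[symmetric] exp_add[symmetric]
  by (rule arg_cong[where f = exp]; simp add: power2_eq_square algebra_simps)+

context
  fixes \<tau> :: complex assumes \<tau>: "Im \<tau> > 0"
begin

lemma summable2: "summable (\<lambda>n. norm (nome \<tau> ^ (n\<^sup>2 + n) * z ^ n))"
  and summable3: "summable (\<lambda>n. norm (nome \<tau> ^ (n\<^sup>2) * z ^ n))"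
  by (rule gauss_summable[OF norm_nome[OF \<tau>]], simp add: power2_eq_square)+

lemma theta2_has_sum: "(term2 \<tau> u has_sum theta2 \<tau> u) UNIV"
proof -
  have s: "summable (\<lambda>n. norm (term2 \<tau> u (int n)))" "summable (\<lambda>n. norm (term2 \<tau> u (- int n - 1)))"
    unfolding term2_nat norm_mult[of "exp _"] by (intro summable_mult summable2)+
  have e: "term2 \<tau> u (int n) + term2 \<tau> u (- int n - 1) = 2 * (qpow \<tau> ((of_nat n + 1/2)\<^sup>2) * cos ((2 * of_nat n + 1) * u))" for n
  proof -
    have "term2 \<tau> u (int n) = qpow \<tau> ((of_nat n + 1/2)\<^sup>2) * exp (\<i> * ((2 * of_nat n + 1) * u))"
      "term2 \<tau> u (- int n - 1) = qpow \<tau> ((of_nat n + 1/2)\<^sup>2) * exp (- (\<i> * ((2 * of_nat n + 1) * u)))"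
      unfolding term2_def qpow_def exp_add[symmetric]
      by (rule arg_cong[where f = exp]; simp add: power2_eq_square algebra_simps)+
    then show ?thesis by (simp add: cos_exp_eq distrib_left)
  qed
  have "summable (\<lambda>n. qpow \<tau> ((of_nat n + 1/2)\<^sup>2) * cos ((2 * of_nat n + 1) * u))"
    using summable_add[OF summable_norm_cancel[OF s(1)] summable_norm_cancel[OF s(2)]] unfolding e
    by (simp add: summable_cmult_iff)
  then show ?thesis
    using has_sum_int_split[OF s] unfolding e theta2_def by (simp add: suminf_mult)
qed

lemma theta3_has_sum: "(term3 \<tau> u has_sum theta3 \<tau> u) UNIV"
proof -
  have s0: "summable (\<lambda>n. norm (term3 \<tau> u (int n)))" unfolding term3_nat by (rule summable3)
  have s1: "summable (\<lambda>n. norm (term3 \<tau> u (- int n - 1)))"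
    unfolding term3_nat using summable3[of "exp (- 2 * \<i> * u)"] by (subst summable_Suc_iff)
  have s: "summable (\<lambda>n. term3 \<tau> u (int n))" "summable (\<lambda>n. term3 \<tau> u (- int n - 1))"
    "summable (\<lambda>n. term3 \<tau> u (int (Suc n)))"
    using summable_norm_cancel[OF s0] summable_norm_cancel[OF s1] by (auto simp only: summable_Suc_iff[of "\<lambda>n. term3 \<tau> u (int n)"])
  have e: "term3 \<tau> u (int (Suc n)) + term3 \<tau> u (- int n - 1) = 2 * (qpow \<tau> ((of_nat (Suc n))\<^sup>2) * cos (2 * of_nat (Suc n) * u))" for n
  proof -
    have "term3 \<tau> u (int (Suc n)) = qpow \<tau> ((of_nat (Suc n))\<^sup>2) * exp (\<i> * (2 * of_nat (Suc n) * u))"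
      "term3 \<tau> u (- int n - 1) = qpow \<tau> ((of_nat (Suc n))\<^sup>2) * exp (- (\<i> * (2 * of_nat (Suc n) * u)))"
      unfolding term3_def qpow_def exp_add[symmetric]
      by (rule arg_cong[where f = exp]; simp add: power2_eq_square algebra_simps)+
    then show ?thesis by (simp add: cos_exp_eq distrib_left)
  qed
  have sm: "summable (\<lambda>n. qpow \<tau> ((of_nat (Suc n))\<^sup>2) * cos (2 * of_nat (Suc n) * u))"
    using summable_add[OF s(3,2)] unfolding e by (simp add: summable_cmult_iff)
  have "(\<Sum>n. term3 \<tau> u (int n) + term3 \<tau> u (- int n - 1)) = (\<Sum>n. term3 \<tau> u (int n)) + (\<Sum>n. term3 \<tau> u (- int n - 1))"
    using suminf_add[OF s(1,2)] by simp
  also have "\<dots> = term3 \<tau> u 0 + ((\<Sum>n. term3 \<tau> u (int (Suc n))) + (\<Sum>n. term3 \<tau> u (- int n - 1)))"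
    using suminf_split_head[OF s(1)] by simp
  also have "\<dots> = theta3 \<tau> u"
    unfolding suminf_add[OF s(3,2)] e theta3_def using sm by (simp add: suminf_mult term3_def)
  finally show ?thesis using has_sum_int_split[OF s0 s1] by simp
qed

lemma theta2_even: "theta2 \<tau> (- u) = theta2 \<tau> u" by (simp add: theta2_def)
lemma theta3_even: "theta3 \<tau> (- u) = theta3 \<tau> u" by (simp add: theta3_def)
lemma theta4_even: "theta4 \<tau> (- u) = theta4 \<tau> u" by (simp add: theta4_def)

lemma theta2_pi: "theta2 \<tau> (u + of_real pi) = - theta2 \<tau> u"
proof -
  have "((\<lambda>n. - term2 \<tau> u n) has_sum theta2 \<tau> (u + of_real pi)) UNIV"
  proof (rule iffD1[OF has_sum_cong theta2_has_sum])
    fix n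
    have "exp (\<i> * of_int (2 * n + 1) * of_real pi) = - 1"
      using exp_integer_2pi_plus1[of "of_int (n::int)"] by (simp add: mult_ac)
    then show "term2 \<tau> (u + of_real pi) n = - term2 \<tau> u n"
      unfolding term2_def by (simp add: distrib_left exp_add)
  qed
  moreover have "((\<lambda>n. - term2 \<tau> u n) has_sum - theta2 \<tau> u) UNIV"
    using theta2_has_sum by (simp add: has_sum_uminus)
  ultimately show ?thesis by (rule has_sum_unique)
qed

lemma theta3_pi: "theta3 \<tau> (u + of_real pi) = theta3 \<tau> u"
proof -
  have "(term3 \<tau> u has_sum theta3 \<tau> (u + of_real pi)) UNIV"
  proof (rule iffD1[OF has_sum_cong theta3_has_sum])
    fix n
    have "exp (2 * \<i> * of_int n * of_real pi) = 1"
      using exp_integer_2pi[of "of_int (n::int)"] by (simp add: mult_ac)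
    then show "term3 \<tau> (u + of_real pi) n = term3 \<tau> u n"
      unfolding term3_def by (simp add: distrib_left exp_add)
  qed
  then show ?thesis by (rule has_sum_unique[OF _ theta3_has_sum])
qed

text \<open>The common multiplier of \<open>theta2\<close> and \<open>theta3\<close> under the shift by \<open>\<pi>\<tau>\<close>.\<close>

definition quasi :: "complex \<Rightarrow> complex" where "quasi u = exp (- 2 * \<i> * u - \<i> * of_real pi * \<tau>)"

lemma theta2_pi_tau: "theta2 \<tau> (u + of_real pi * \<tau>) = quasi u * theta2 \<tau> u"
proof -
  have "((\<lambda>n. quasi u * term2 \<tau> u (n + 1)) has_sum theta2 \<tau> (u + of_real pi * \<tau>)) UNIV"
  proof (rule iffD1[OF has_sum_cong theta2_has_sum])
    fix n
    show "term2 \<tau> (u + of_real pi * \<tau>) n = quasi u * term2 \<tau> u (n + 1)"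
      unfolding term2_def quasi_def exp_add[symmetric]
      by (rule arg_cong[where f = exp]) (simp add: power2_eq_square algebra_simps)
  qed
  moreover have "((\<lambda>n. quasi u * term2 \<tau> u (n + 1)) has_sum quasi u * theta2 \<tau> u) UNIV"
    using has_sum_cmult_right[OF theta2_has_sum] by (subst has_sum_reindex_bij_witness[of _ "\<lambda>n. n - 1" "\<lambda>n. n + 1" UNIV "\<lambda>n. quasi u * term2 \<tau> u n"]) auto
  ultimately show ?thesis by (rule has_sum_unique)
qed

lemma theta3_pi_tau: "theta3 \<tau> (u + of_real pi * \<tau>) = quasi u * theta3 \<tau> u"
proof -
  have "((\<lambda>n. quasi u * term3 \<tau> u (n + 1)) has_sum theta3 \<tau> (u + of_real pi * \<tau>)) UNIV"
  proof (rule iffD1[OF has_sum_cong theta3_has_sum])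
    fix n
    show "term3 \<tau> (u + of_real pi * \<tau>) n = quasi u * term3 \<tau> u (n + 1)"
      unfolding term3_def quasi_def exp_add[symmetric]
      by (rule arg_cong[where f = exp]) (simp add: power2_eq_square algebra_simps)
  qed
  moreover have "((\<lambda>n. quasi u * term3 \<tau> u (n + 1)) has_sum quasi u * theta3 \<tau> u) UNIV"
    using has_sum_cmult_right[OF theta3_has_sum] by (subst has_sum_reindex_bij_witness[of _ "\<lambda>n. n - 1" "\<lambda>n. n + 1" UNIV "\<lambda>n. quasi u * term3 \<tau> u n"]) auto
  ultimately show ?thesis by (rule has_sum_unique)
qed

lemma theta3_half: "theta3 \<tau> (u + of_real pi * \<tau> / 2) = exp (- (\<i> * of_real pi * \<tau> / 4) - \<i> * u) * theta2 \<tau> u"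
proof -
  have "((\<lambda>n. exp (- (\<i> * of_real pi * \<tau> / 4) - \<i> * u) * term2 \<tau> u n) has_sum theta3 \<tau> (u + of_real pi * \<tau> / 2)) UNIV"
  proof (rule iffD1[OF has_sum_cong theta3_has_sum])
    fix n
    show "term3 \<tau> (u + of_real pi * \<tau> / 2) n = exp (- (\<i> * of_real pi * \<tau> / 4) - \<i> * u) * term2 \<tau> u n"
      unfolding term3_def term2_def exp_add[symmetric]
      by (rule arg_cong[where f = exp]) (simp add: power2_eq_square field_simps)
  qed
  then show ?thesis by (rule has_sum_unique[OF _ has_sum_cmult_right[OF theta2_has_sum]])
qed

text \<open>The series splits into two everywhere convergent power series, in \<open>exp (2 \<i> u)\<close> and in its inverse.\<close>

lemma theta3_holomorphic: "theta3 \<tau> holomorphic_on UNIV"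
proof -
  define p where "p z = (\<Sum>n. nome \<tau> ^ (n\<^sup>2) * z ^ n)" for z
  have "summable (\<lambda>n. nome \<tau> ^ (n\<^sup>2) * z ^ n)" for z by (rule summable_norm_cancel[OF summable3])
  then have "(p has_field_derivative (\<Sum>n. diffs (\<lambda>n. nome \<tau> ^ (n\<^sup>2)) n * z ^ n)) (at z)" for z
    unfolding p_def by (rule termdiffs_strong_converges_everywhere)
  then have p: "p holomorphic_on UNIV" by (auto simp: holomorphic_on_def field_differentiable_def)
  have "theta3 \<tau> u = p (exp (2 * \<i> * u)) + p (exp (- 2 * \<i> * u)) - 1" for u
  proof -
    have s: "summable (\<lambda>n. norm (nome \<tau> ^ (n\<^sup>2) * z ^ n))" for z by (rule summable3)
    have a: "summable (\<lambda>n. norm (term3 \<tau> u (int n)))" unfolding term3_nat by (rule summable3)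
    have b: "summable (\<lambda>n. norm (term3 \<tau> u (- int n - 1)))"
      unfolding term3_nat using summable3[of "exp (- 2 * \<i> * u)"] by (subst summable_Suc_iff)
    have "theta3 \<tau> u = (\<Sum>n. term3 \<tau> u (int n) + term3 \<tau> u (- int n - 1))"
      by (rule has_sum_unique[OF theta3_has_sum has_sum_int_split[OF a b]])
    also have "\<dots> = (\<Sum>n. term3 \<tau> u (int n)) + (\<Sum>n. term3 \<tau> u (- int n - 1))"
      using suminf_add[OF summable_norm_cancel[OF a] summable_norm_cancel[OF b]] by simp
    also have "(\<Sum>n. term3 \<tau> u (- int n - 1)) = p (exp (- 2 * \<i> * u)) - 1"
      unfolding term3_nat p_def using suminf_split_head[OF summable_norm_cancel[OF summable3[of "exp (- 2 * \<i> * u)"]]] by simp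
    finally show ?thesis by (simp add: term3_nat p_def)
  qed
  then have "theta3 \<tau> = (\<lambda>u. p (exp (2 * \<i> * u)) + p (exp (- 2 * \<i> * u)) - 1)" by auto
  moreover have "(\<lambda>u. p (exp (c * u))) holomorphic_on UNIV" for c
    using holomorphic_on_compose_gen[of "\<lambda>u. exp (c * u)" UNIV p UNIV] p by (auto simp: o_def intro!: holomorphic_intros)
  ultimately show ?thesis
    by (simp only:) (intro holomorphic_on_diff holomorphic_on_add holomorphic_on_const)
qed

end

lemma theta4_eq: "theta4 \<tau> u = theta3 \<tau> (u + of_real pi / 2)"
proof -
  have "cos (2 * of_nat (Suc n) * (u + of_real pi / 2)) = (- 1) ^ Suc n * cos (2 * of_nat (Suc n) * u)" for n
  proof -
    have "2 * of_nat (Suc n) * (u + of_real pi / 2) = 2 * of_nat (Suc n) * u + of_real (real (Suc n) * pi)"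
      by (simp add: field_simps)
    then show ?thesis
      by (simp only: cos_add cos_of_real sin_of_real cos_npi sin_npi) simp
  qed
  then show ?thesis unfolding theta3_def theta4_def by (simp only: mult_ac)
qed

lemma theta1_eq: "theta1 \<tau> u = theta2 \<tau> (u - of_real pi / 2)"
proof -
  have "cos ((2 * of_nat n + 1) * (u - of_real pi / 2)) = (- 1) ^ n * sin ((2 * of_nat n + 1) * u)" for n
  proof -
    have e: "(2 * of_nat n + 1) * (u - of_real pi / 2) = (2 * of_nat n + 1) * u - (of_real (real n * pi) + of_real (pi / 2))"
      by (simp add: field_simps)
    show ?thesis unfolding e
      by (simp only: cos_diff cos_add sin_add cos_of_real sin_of_real cos_npi sin_npi cos_pi_half sin_pi_half) simp
  qed
  then show ?thesis unfolding theta1_def theta2_def by (simp only: mult_ac)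
qed

lemma term3_prod_even: "term3 \<tau> s (M + N) * term3 \<tau> t (M - N) = term3 (2 * \<tau>) (s + t) M * term3 (2 * \<tau>) (s - t) N"
  and term3_prod_odd: "term3 \<tau> s (M + N + 1) * term3 \<tau> t (M - N) = term2 (2 * \<tau>) (s + t) M * term2 (2 * \<tau>) (s - t) N"
  and term2_prod_even: "term2 \<tau> s (M + N) * term2 \<tau> t (M - N) = term2 (2 * \<tau>) (s + t) M * term3 (2 * \<tau>) (s - t) N"
  and term2_prod_odd: "term2 \<tau> s (M + N) * term2 \<tau> t (M - N - 1) = term3 (2 * \<tau>) (s + t) M * term2 (2 * \<tau>) (s - t) N"
  unfolding term2_def term3_def exp_add[symmetric]
  by (rule arg_cong[where f = exp]; simp add: power2_eq_square algebra_simps)+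

text \<open>Pairs of integers of equal parity are parametrised by half their sum and half their difference,
  and pairs of opposite parity by the same quantities after a shift by one.\<close>

lemma int_pairs_even: "(f has_sum a) {(m, n). even (m + n :: int)} \<longleftrightarrow> ((\<lambda>(M, N). f (M + N, M - N)) has_sum a) (UNIV \<times> UNIV)"
  and int_pairs_odd: "(f has_sum a) {(m, n). odd (m + n :: int)} \<longleftrightarrow> ((\<lambda>(M, N). f (M + N + 1, M - N)) has_sum a) (UNIV \<times> UNIV)"
  and int_pairs_odd': "(f has_sum a) {(m, n). odd (m + n :: int)} \<longleftrightarrow> ((\<lambda>(M, N). f (M + N, M - N - 1)) has_sum a) (UNIV \<times> UNIV)"
proof -
  have 1: "(m + n) div 2 + (m - n) div 2 = m" "(m + n) div 2 - (m - n) div 2 = n" if "even (m + n)" for m n :: int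
    using that by presburger+
  have 2: "(m + n) div 2 + (m - n) div 2 + 1 = m" "(m + n) div 2 - (m - n) div 2 = n" if "odd (m + n)" for m n :: int
    using that by presburger+
  have 3: "(m + n) div 2 + 1 + (m - n) div 2 = m" "(m + n) div 2 - (m - n) div 2 = n" if "odd (m + n)" for m n :: int
    using that by presburger+
  show "(f has_sum a) {(m, n). even (m + n :: int)} \<longleftrightarrow> ((\<lambda>(M, N). f (M + N, M - N)) has_sum a) (UNIV \<times> UNIV)"
    by (rule has_sum_reindex_bij_witness[of _ "\<lambda>(M, N). (M + N, M - N)" "\<lambda>(m, n). ((m + n) div 2, (m - n) div 2)"])
       (auto simp: 1)
  show "(f has_sum a) {(m, n). odd (m + n :: int)} \<longleftrightarrow> ((\<lambda>(M, N). f (M + N + 1, M - N)) has_sum a) (UNIV \<times> UNIV)"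
    by (rule has_sum_reindex_bij_witness[of _ "\<lambda>(M, N). (M + N + 1, M - N)" "\<lambda>(m, n). ((m + n) div 2, (m - n) div 2)"])
       (auto simp: 2)
  show "(f has_sum a) {(m, n). odd (m + n :: int)} \<longleftrightarrow> ((\<lambda>(M, N). f (M + N, M - N - 1)) has_sum a) (UNIV \<times> UNIV)"
    by (rule has_sum_reindex_bij_witness[of _ "\<lambda>(M, N). (M + N, M - N - 1)" "\<lambda>(m, n). ((m + n) div 2 + 1, (m - n) div 2)"])
       (auto simp: 3)
qed

lemma int_pairs_parity: "{(m, n). even (m + n :: int)} \<inter> {(m, n). odd (m + n)} = {}"
  "{(m, n). even (m + n :: int)} \<union> {(m, n). odd (m + n)} = UNIV \<times> UNIV" by auto

context
  fixes \<tau> :: complex assumes \<tau>: "Im \<tau> > 0"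
begin

lemma two_tau: "Im (2 * \<tau>) > 0" using \<tau> by simp

text \<open>The product formulas multiply two series for the nome \<open>q\<close> and sort the double series by the
  parity of \<open>m + n\<close>, which gives series for the nome \<open>q\<^sup>2\<close> in \<open>s + t\<close> and \<open>s - t\<close>.\<close>

lemma theta3_prod: "theta3 \<tau> s * theta3 \<tau> t
  = theta3 (2 * \<tau>) (s + t) * theta3 (2 * \<tau>) (s - t) + theta2 (2 * \<tau>) (s + t) * theta2 (2 * \<tau>) (s - t)"
proof (rule has_sum_unique[OF has_sum_product_complex[OF theta3_has_sum[OF \<tau>] theta3_has_sum[OF \<tau>]]])
  let ?f = "\<lambda>(m, n). term3 \<tau> s m * term3 \<tau> t n"
  show "(?f has_sum theta3 (2 * \<tau>) (s + t) * theta3 (2 * \<tau>) (s - t) + theta2 (2 * \<tau>) (s + t) * theta2 (2 * \<tau>) (s - t)) (UNIV \<times> UNIV)"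
    unfolding int_pairs_parity(2)[symmetric]
  proof (rule has_sum_Un_disjoint[OF _ _ int_pairs_parity(1)])
    show "(?f has_sum theta3 (2 * \<tau>) (s + t) * theta3 (2 * \<tau>) (s - t)) {(m, n). even (m + n)}"
      unfolding int_pairs_even using has_sum_product_complex[OF theta3_has_sum[OF two_tau] theta3_has_sum[OF two_tau]]
      by (simp add: term3_prod_even)
    show "(?f has_sum theta2 (2 * \<tau>) (s + t) * theta2 (2 * \<tau>) (s - t)) {(m, n). odd (m + n)}"
      unfolding int_pairs_odd using has_sum_product_complex[OF theta2_has_sum[OF two_tau] theta2_has_sum[OF two_tau]]
      by (simp add: term3_prod_odd)
  qed
qed

lemma theta2_prod: "theta2 \<tau> s * theta2 \<tau> t
  = theta2 (2 * \<tau>) (s + t) * theta3 (2 * \<tau>) (s - t) + theta3 (2 * \<tau>) (s + t) * theta2 (2 * \<tau>) (s - t)"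
proof (rule has_sum_unique[OF has_sum_product_complex[OF theta2_has_sum[OF \<tau>] theta2_has_sum[OF \<tau>]]])
  let ?f = "\<lambda>(m, n). term2 \<tau> s m * term2 \<tau> t n"
  show "(?f has_sum theta2 (2 * \<tau>) (s + t) * theta3 (2 * \<tau>) (s - t) + theta3 (2 * \<tau>) (s + t) * theta2 (2 * \<tau>) (s - t)) (UNIV \<times> UNIV)"
    unfolding int_pairs_parity(2)[symmetric]
  proof (rule has_sum_Un_disjoint[OF _ _ int_pairs_parity(1)])
    show "(?f has_sum theta2 (2 * \<tau>) (s + t) * theta3 (2 * \<tau>) (s - t)) {(m, n). even (m + n)}"
      unfolding int_pairs_even using has_sum_product_complex[OF theta2_has_sum[OF two_tau] theta3_has_sum[OF two_tau]]
      by (simp add: term2_prod_even)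
    show "(?f has_sum theta3 (2 * \<tau>) (s + t) * theta2 (2 * \<tau>) (s - t)) {(m, n). odd (m + n)}"
      unfolding int_pairs_odd' using has_sum_product_complex[OF theta3_has_sum[OF two_tau] theta2_has_sum[OF two_tau]]
      by (simp add: term2_prod_odd)
  qed
qed

lemma theta1_odd: "theta1 \<tau> (- u) = - theta1 \<tau> u"
proof -
  have e: "- u - of_real pi / 2 + of_real pi = - (u - of_real pi / 2)" by (simp add: field_simps)
  have "theta2 \<tau> (u - of_real pi / 2) = - theta2 \<tau> (- u - of_real pi / 2)"
    using theta2_pi[OF \<tau>, of "- u - of_real pi / 2"] unfolding e theta2_even[OF \<tau>] .
  then show ?thesis unfolding theta1_eq by (simp only: minus_minus)
qed

lemma theta1_eq': "theta1 \<tau> u = - theta2 \<tau> (u + of_real pi / 2)"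
proof -
  have e: "u - of_real pi / 2 + of_real pi = u + of_real pi / 2" by (simp add: field_simps)
  show ?thesis using theta2_pi[OF \<tau>, of "u - of_real pi / 2"] unfolding e theta1_eq by simp
qed

text \<open>All identities between the weights of the model are derived from these two formulas.\<close>

lemma theta12_prod: "theta1 \<tau> s * theta2 \<tau> t
  = theta1 (2 * \<tau>) (s + t) * theta4 (2 * \<tau>) (s - t) + theta4 (2 * \<tau>) (s + t) * theta1 (2 * \<tau>) (s - t)"
proof -
  have a: "s - of_real pi / 2 + t = s + t - of_real pi / 2" "s - of_real pi / 2 - t = s - t - of_real pi / 2" by simp_all
  have b: "theta3 (2 * \<tau>) (x - of_real pi / 2) = theta4 (2 * \<tau>) x" for x
    using theta3_pi[OF two_tau, of "x - of_real pi / 2"] by (simp add: theta4_eq field_simps)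
  show ?thesis unfolding theta1_eq theta2_prod a b by simp
qed

lemma theta34_prod: "theta3 \<tau> s * theta4 \<tau> t
  = theta4 (2 * \<tau>) (s + t) * theta4 (2 * \<tau>) (s - t) - theta1 (2 * \<tau>) (s + t) * theta1 (2 * \<tau>) (s - t)"
proof -
  have a: "s + (t + of_real pi / 2) = s + t + of_real pi / 2" "s - (t + of_real pi / 2) = s - t - of_real pi / 2" by simp_all
  have b: "theta3 (2 * \<tau>) (x - of_real pi / 2) = theta4 (2 * \<tau>) x" for x
    using theta3_pi[OF two_tau, of "x - of_real pi / 2"] by (simp add: theta4_eq field_simps)
  have c: "theta2 (2 * \<tau>) (x + of_real pi / 2) = - theta1 (2 * \<tau>) x" for x
    using theta2_pi[OF two_tau, of "x - of_real pi / 2"] by (simp add: theta1_eq field_simps)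
  show ?thesis unfolding theta4_eq[of \<tau>] theta3_prod a b c by (simp add: theta4_eq theta1_eq)
qed

lemma theta_pi: "theta1 \<tau> (u + of_real pi) = - theta1 \<tau> u" "theta4 \<tau> (u + of_real pi) = theta4 \<tau> u"
  using theta2_pi[OF \<tau>, of "u - of_real pi / 2"] theta3_pi[OF \<tau>, of "u + of_real pi / 2"]
  by (simp_all add: theta1_eq theta4_eq algebra_simps)

lemma quasi_half: "quasi \<tau> (u + of_real pi / 2) = - quasi \<tau> u" "quasi \<tau> (u - of_real pi / 2) = - quasi \<tau> u"
proof -
  have "- 2 * \<i> * (u + of_real pi / 2) - \<i> * of_real pi * \<tau> = (- 2 * \<i> * u - \<i> * of_real pi * \<tau>) - \<i> * of_real pi"
    "- 2 * \<i> * (u - of_real pi / 2) - \<i> * of_real pi * \<tau> = (- 2 * \<i> * u - \<i> * of_real pi * \<tau>) + \<i> * of_real pi"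
    by (simp_all add: algebra_simps)
  then show "quasi \<tau> (u + of_real pi / 2) = - quasi \<tau> u" "quasi \<tau> (u - of_real pi / 2) = - quasi \<tau> u"
    unfolding quasi_def[OF \<tau>] by (simp_all only: exp_add exp_diff exp_pi_i') simp_all
qed

lemma theta_pi_tau: "theta1 \<tau> (u + of_real pi * \<tau>) = - quasi \<tau> u * theta1 \<tau> u"
  "theta4 \<tau> (u + of_real pi * \<tau>) = - quasi \<tau> u * theta4 \<tau> u"
  using theta2_pi_tau[OF \<tau>, of "u - of_real pi / 2"] theta3_pi_tau[OF \<tau>, of "u + of_real pi / 2"] quasi_half[of u]
  by (simp_all add: theta1_eq theta4_eq algebra_simps)

lemma theta2_holomorphic: "theta2 \<tau> holomorphic_on UNIV"
proof -
  have "theta2 \<tau> = (\<lambda>u. exp (\<i> * of_real pi * \<tau> / 4 + \<i> * u) * theta3 \<tau> (u + of_real pi * \<tau> / 2))"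
    unfolding theta3_half[OF \<tau>] by (auto simp: mult.assoc[symmetric] exp_add[symmetric])
  moreover have "(\<lambda>u. exp (\<i> * of_real pi * \<tau> / 4 + \<i> * u) * theta3 \<tau> (u + of_real pi * \<tau> / 2)) holomorphic_on UNIV"
    by (intro holomorphic_intros holomorphic_shift theta3_holomorphic[OF \<tau>])
  ultimately show ?thesis by simp
qed

lemma theta1_holomorphic: "theta1 \<tau> holomorphic_on UNIV"
  using holomorphic_shift[OF theta2_holomorphic, of "- of_real pi / 2"] by (simp add: theta1_eq[abs_def])

lemma theta4_holomorphic: "theta4 \<tau> holomorphic_on UNIV"
  using holomorphic_shift[OF theta3_holomorphic[OF \<tau>], of "of_real pi / 2"] by (simp add: theta4_eq[abs_def])

end

section \<open>The zeros of the first theta function\<close>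

lemma entire_mult_eq_0:
  assumes f: "f holomorphic_on UNIV" and g: "g holomorphic_on UNIV" and 0: "\<And>u. f u * g u = (0 :: complex)"
  shows "(\<forall>u. f u = 0) \<or> (\<forall>u. g u = 0)"
proof (rule disjCI)
  assume "\<not> (\<forall>u. g u = 0)"
  then obtain u0 where u0: "g u0 \<noteq> 0" by auto
  have "continuous_on UNIV g" using g by (rule holomorphic_on_imp_continuous_on)
  then have o: "open {u. g u \<noteq> 0}" by (intro open_Collect_neq) auto
  have "f u = 0" for u
    by (rule analytic_continuation_open[of "{u. g u \<noteq> 0}" UNIV f "\<lambda>_. 0"])
       (use o u0 0 f in \<open>auto intro: holomorphic_intros\<close>)
  then show "\<forall>u. f u = 0" by simp
qed

lemma periodic_int:
  fixes f :: "complex \<Rightarrow> 'a"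
  assumes "\<And>u. f (u + p) = f u" shows "f (u + of_int m * p) = f u"
proof (induction m arbitrary: u rule: int_induct[where k = 0])
  case (step1 i) then show ?case using assms[of "u + of_int i * p"] by (simp add: algebra_simps)
next
  case (step2 i) then show ?case using assms[of "u + of_int (i - 1) * p"] by (simp add: algebra_simps)
qed simp

text \<open>Liouville: an entire function with two independent periods is bounded, hence constant.\<close>

lemma elliptic_constant:
  assumes f: "f holomorphic_on UNIV" and w: "Im w > 0"
    and p: "\<And>u. f (u + of_real pi) = f u" "\<And>u. f (u + of_real pi * w) = (f u :: complex)"
  shows "\<exists>c. \<forall>u. f u = c"
proof -
  define K where "K = (\<lambda>(a, b). of_real a * of_real pi + of_real b * (of_real pi * w)) ` ({0..1} \<times> {0..1::real})"
  have "compact K" unfolding K_def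
    by (intro compact_continuous_image compact_Times) (auto intro!: continuous_intros simp: split_beta)
  moreover have "continuous_on K f" using f holomorphic_on_imp_continuous_on continuous_on_subset by blast
  ultimately have "bounded (f ` K)" using compact_continuous_image compact_imp_bounded by blast
  moreover have "range f \<subseteq> f ` K"
  proof (clarify)
    fix u
    define b where "b = Im u / (pi * Im w)"
    define a where "a = (Re u - b * pi * Re w) / pi"
    have u: "u = of_real a * of_real pi + of_real b * (of_real pi * w)"
      using w by (auto simp: complex_eq_iff a_def b_def)
    let ?v = "of_real (frac a) * of_real pi + of_real (frac b) * (of_real pi * w)"
    have "u = ?v + of_int \<lfloor>a\<rfloor> * of_real pi + of_int \<lfloor>b\<rfloor> * (of_real pi * w)"
      unfolding u frac_def by (simp add: algebra_simps)
    then have "f u = f ?v" using periodic_int[of f "of_real pi", OF p(1)] periodic_int[of f "of_real pi * w", OF p(2)] by simp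
    moreover have "?v \<in> K" unfolding K_def
      by (intro image_eqI[of _ _ "(frac a, frac b)"]) (auto simp: frac_lt_1 less_imp_le)
    ultimately show "f u \<in> f ` K" by blast
  qed
  ultimately have "bounded (range f)" using bounded_subset by blast
  then show ?thesis using Liouville_theorem[OF f] unfolding constant_on_def by auto
qed

lemma theta3_small_nome: assumes \<tau>: "Im \<tau> > 0" and q: "norm (nome \<tau>) < 1/3" shows "theta3 \<tau> 0 \<noteq> 0"
proof
  let ?r = "norm (nome \<tau>)"
  let ?f = "\<lambda>n. qpow \<tau> ((of_nat (Suc n))\<^sup>2)"
  assume "theta3 \<tau> 0 = 0"
  then have "2 * (\<Sum>n. ?f n) = - 1" unfolding theta3_def by (simp add: add_eq_0_iff)
  then have half: "norm (\<Sum>n. ?f n) = 1/2"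
    by (metis norm_minus_cancel norm_mult norm_numeral norm_one mult.commute nonzero_eq_divide_eq zero_neq_numeral)
  have le: "norm (?f n) \<le> ?r ^ Suc n" for n
  proof -
    have "?f n = nome \<tau> ^ ((Suc n)\<^sup>2)"
      unfolding qpow_def nome_def exp_of_nat_mult[symmetric] by (simp add: mult_ac)
    moreover have "?r ^ ((Suc n)\<^sup>2) \<le> ?r ^ Suc n"
      using norm_nome[OF \<tau>] by (intro power_decreasing) (auto simp: power2_eq_square)
    ultimately show ?thesis by (simp add: norm_power)
  qed
  have s: "summable (\<lambda>n. ?r ^ Suc n)" using norm_nome[OF \<tau>] by (simp add: summable_geometric)
  have "norm (\<Sum>n. ?f n) \<le> (\<Sum>n. ?r ^ Suc n)"
    using suminf_le[OF le _ s] summable_norm[of ?f] summable_comparison_test'[OF s, of 0 "\<lambda>n. norm (?f n)"] le by force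
  also have "\<dots> = ?r * (1 / (1 - ?r))"
    using suminf_mult[of "\<lambda>n. ?r ^ n" ?r] suminf_geometric[of ?r] norm_nome[OF \<tau>] by (simp add: summable_geometric)
  also have "\<dots> < 1/2" using q by (simp add: field_simps)
  finally show False using half by simp
qed

text \<open>If \<open>theta3\<close> vanished identically for some \<open>\<tau>\<close>, it would do so for \<open>2 \<tau>\<close> as well, and hence for
  arbitrarily small nomes, where its value at \<open>0\<close> is close to \<open>1\<close>.\<close>

lemma theta23_double:
  assumes \<tau>: "Im \<tau> > 0" and 0: "\<And>u. theta3 \<tau> u = 0" shows "theta3 (2 * \<tau>) u = 0"
proof -
  have t2: "Im (2 * \<tau>) > 0" using \<tau> by simp
  have 2: "theta2 \<tau> u = 0" for u using theta3_half[OF \<tau>, of u] 0 by simp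
  have a: "theta2 (2 * \<tau>) x * theta3 (2 * \<tau>) x = 0" and b: "(theta3 (2 * \<tau>) x)\<^sup>2 + (theta2 (2 * \<tau>) x)\<^sup>2 = 0" for x
    using theta2_prod[OF \<tau>, of x 0] theta3_prod[OF \<tau>, of x 0] by (simp_all add: 0 2 power2_eq_square)
  have "(\<forall>x. theta2 (2 * \<tau>) x = 0) \<or> (\<forall>x. theta3 (2 * \<tau>) x = 0)"
    by (rule entire_mult_eq_0[OF theta2_holomorphic[OF t2] theta3_holomorphic[OF t2] a])
  then show ?thesis using b[of u] by auto
qed

lemma theta3_nontrivial: assumes \<tau>: "Im \<tau> > 0" shows "\<exists>u. theta3 \<tau> u \<noteq> 0"
proof -
  have "norm (nome (2 ^ k * \<tau>)) < 1/3 \<Longrightarrow> Im \<tau> > 0 \<Longrightarrow> \<exists>u. theta3 \<tau> u \<noteq> 0" for k \<tau>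
  proof (induction k arbitrary: \<tau>)
    case 0 then show ?case using theta3_small_nome by auto
  next
    case (Suc k)
    then have "\<exists>u. theta3 (2 * \<tau>) u \<noteq> 0" using Suc.IH[of "2 * \<tau>"] by (simp add: mult_ac)
    then show ?case using theta23_double[OF Suc.prems(2)] by blast
  qed
  moreover obtain k where "norm (nome (2 ^ k * \<tau>)) < 1/3"
  proof -
    obtain n where n: "norm (nome \<tau>) ^ n < 1/3"
      using real_arch_pow_inv[of "1/3" "norm (nome \<tau>)"] norm_nome[OF \<tau>] by auto
    have "nome (2 ^ n * \<tau>) = nome \<tau> ^ (2 ^ n)"
      unfolding nome_def exp_of_nat_mult[symmetric] by (simp add: mult_ac)
    moreover have "norm (nome \<tau>) ^ (2 ^ n) \<le> norm (nome \<tau>) ^ n"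
      using norm_nome[OF \<tau>] by (intro power_decreasing) (auto intro: less_imp_le less_exp)
    ultimately show ?thesis using n that[of n] by (simp add: norm_power)
  qed
  ultimately show ?thesis using \<tau> by blast
qed

lemma theta2_nontrivial: assumes \<tau>: "Im \<tau> > 0" shows "\<exists>u. theta2 \<tau> u \<noteq> 0"
proof -
  obtain u where "theta3 \<tau> u \<noteq> 0" using theta3_nontrivial[OF \<tau>] by auto
  then show ?thesis using theta3_half[OF \<tau>, of "u - of_real pi * \<tau> / 2"] by auto
qed

lemma theta1_nontrivial: assumes \<tau>: "Im \<tau> > 0" shows "\<exists>u. theta1 \<tau> u \<noteq> 0"
proof -
  obtain u where "theta2 \<tau> u \<noteq> 0" using theta2_nontrivial[OF \<tau>] by auto
  then have "theta1 \<tau> (u + of_real pi / 2) \<noteq> 0" by (simp add: theta1_eq)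
  then show ?thesis ..
qed

lemma theta4_nontrivial: assumes \<tau>: "Im \<tau> > 0" shows "\<exists>u. theta4 \<tau> u \<noteq> 0"
proof -
  obtain u where "theta3 \<tau> u \<noteq> 0" using theta3_nontrivial[OF \<tau>] by auto
  then have "theta4 \<tau> (u - of_real pi / 2) \<noteq> 0" by (simp add: theta4_eq)
  then show ?thesis ..
qed

context
  fixes \<tau> :: complex assumes \<tau>: "Im \<tau> > 0"
begin

lemma theta1_0 [simp]: "theta1 \<tau> 0 = 0" using theta1_odd[OF \<tau>, of 0] by simp

text \<open>The duplication formula, with the constant in the form in which it enters the weights of the model.\<close>

lemma theta1_double: "theta1 \<tau> (2 * v) * (theta2 \<tau> 0 * (theta4 (2 * \<tau>) 0)\<^sup>2)
  = 2 * (theta1 \<tau> v * theta2 \<tau> v * theta3 \<tau> v * theta4 \<tau> v)"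
proof -
  have z: "theta1 (2 * \<tau>) 0 = 0" using theta1_odd[of "2 * \<tau>" 0] \<tau> by simp
  have a: "theta1 \<tau> (2 * v) * theta2 \<tau> 0 = 2 * (theta1 (2 * \<tau>) (2 * v) * theta4 (2 * \<tau>) (2 * v))"
    using theta12_prod[OF \<tau>, of "2 * v" 0] by simp
  have b: "theta1 \<tau> v * theta2 \<tau> v = theta1 (2 * \<tau>) (2 * v) * theta4 (2 * \<tau>) 0"
    "theta3 \<tau> v * theta4 \<tau> v = theta4 (2 * \<tau>) (2 * v) * theta4 (2 * \<tau>) 0"
    using theta12_prod[OF \<tau>, of v v] theta34_prod[OF \<tau>, of v v] z by simp_all
  have "theta1 \<tau> (2 * v) * (theta2 \<tau> 0 * (theta4 (2 * \<tau>) 0)\<^sup>2) = (theta1 \<tau> (2 * v) * theta2 \<tau> 0) * (theta4 (2 * \<tau>) 0)\<^sup>2"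
    by simp
  also have "\<dots> = 2 * ((theta1 \<tau> v * theta2 \<tau> v) * (theta3 \<tau> v * theta4 \<tau> v))"
    unfolding a b by (simp add: power2_eq_square)
  finally show ?thesis by (simp add: mult.assoc)
qed

lemma theta_const_nonzero: "theta2 \<tau> 0 \<noteq> 0" "theta4 (2 * \<tau>) 0 \<noteq> 0"
proof -
  have "theta2 \<tau> 0 * (theta4 (2 * \<tau>) 0)\<^sup>2 \<noteq> 0"
  proof
    assume "theta2 \<tau> 0 * (theta4 (2 * \<tau>) 0)\<^sup>2 = 0"
    then have z: "(theta1 \<tau> v * theta2 \<tau> v) * (theta3 \<tau> v * theta4 \<tau> v) = 0" for v
      using theta1_double[of v] by auto
    note h = theta1_holomorphic[OF \<tau>] theta2_holomorphic[OF \<tau>] theta3_holomorphic[OF \<tau>] theta4_holomorphic[OF \<tau>]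
    have "(\<forall>v. theta1 \<tau> v * theta2 \<tau> v = 0) \<or> (\<forall>v. theta3 \<tau> v * theta4 \<tau> v = 0)"
      by (rule entire_mult_eq_0[OF _ _ z]) (intro holomorphic_intros h)+
    then show False
      using entire_mult_eq_0[OF h(1,2)] entire_mult_eq_0[OF h(3,4)] theta1_nontrivial[OF \<tau>] theta2_nontrivial[OF \<tau>]
        theta3_nontrivial[OF \<tau>] theta4_nontrivial[OF \<tau>] by blast
  qed
  then show "theta2 \<tau> 0 \<noteq> 0" "theta4 (2 * \<tau>) 0 \<noteq> 0" by auto
qed

text \<open>A zero-free entire function that is periodic under one shift and multiplied by a constant under the other has
  an elliptic logarithmic derivative, and so is an exponential.\<close>

lemma quasi_periodic_exp:
  assumes h: "c holomorphic_on UNIV" and nz: "\<And>u. c u \<noteq> 0" and w: "Im w > 0"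
    and p: "\<And>u. c (u + of_real pi) = c u" "\<And>u. c (u + of_real pi * w) = k * c u"
  shows "\<exists>m::int. k = exp (2 * \<i> * of_int m * of_real pi * w)"
proof -
  have dc: "deriv c holomorphic_on UNIV" by (rule holomorphic_deriv[OF h]) simp
  have cd: "(c has_field_derivative deriv c u) (at u)" for u
    using holomorphic_derivI[OF h open_UNIV] by simp
  have d1: "deriv c (u + of_real pi) = deriv c u" and d2: "deriv c (u + of_real pi * w) = k * deriv c u" for u
  proof -
    have "((\<lambda>u. c (u + a)) has_field_derivative deriv c (u + a)) (at u)" for a
      using DERIV_shift[of c "deriv c (u + a)" u a] cd[of "u + a"] by simp
    from this[of "of_real pi"] this[of "of_real pi * w"]
    show "deriv c (u + of_real pi) = deriv c u" "deriv c (u + of_real pi * w) = k * deriv c u"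
      unfolding p using cd[of u] DERIV_cmult[OF cd[of u], of k] DERIV_unique by blast+
  qed
  have k0: "k \<noteq> 0" using p(2)[of 0] nz by auto
  have "\<exists>a. \<forall>u. deriv c u / c u = a"
    by (rule elliptic_constant[OF _ w]) (use nz k0 in \<open>auto intro!: holomorphic_intros dc h simp: p d1 d2\<close>)
  then obtain a where "deriv c u / c u = a" for u by blast
  then have a: "deriv c u = a * c u" for u using nz[of u] by (metis nonzero_eq_divide_eq)
  have "((\<lambda>u. c u * exp (- a * u)) has_field_derivative 0) (at u)" for u
    by (rule derivative_eq_intros cd refl | simp add: a)+
  then obtain b where "c u * exp (- a * u) = b" for u
    using has_field_derivative_zero_constant[of UNIV "\<lambda>u. c u * exp (- a * u)"] by (metis UNIV_I convex_UNIV has_field_derivative_at_within)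
  then have e: "c u = b * exp (a * u)" for u by (metis exp_minus_inverse mult.assoc mult.commute mult.right_neutral mult_minus_left)
  then have b: "b \<noteq> 0" using nz[of 0] by auto
  have "exp (a * of_real pi) = 1" using p(1)[of 0] b by (simp add: e)
  then obtain m :: int where "a * of_real pi = of_int (2 * m) * (of_real pi * \<i>)"
    unfolding exp_eq_1 by (auto simp: complex_eq_iff)
  then have "a = 2 * \<i> * of_int m" by (simp add: field_simps)
  then have "k = exp (2 * \<i> * of_int m * of_real pi * w)"
    using p(2)[of 0] b by (simp add: e mult_ac)
  then show ?thesis ..
qed

text \<open>If \<open>t\<close> is a zero, the product formula makes the vectors of values of \<open>theta1\<close> and \<open>theta4\<close> for
  \<open>2 \<tau>\<close> at \<open>x\<close> and \<open>x + 2 t\<close> proportional for all \<open>x\<close>. The factor of proportionality \<open>c\<close> is a zero-free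
  entire function, hence an exponential, and its multipliers show that \<open>t\<close> is an integral combination of \<open>\<pi>/2\<close> and
  \<open>\<pi>\<tau>\<close>. Odd multiples of \<open>\<pi>/2\<close> are excluded because \<open>theta2\<close> does not vanish at \<open>0\<close>.\<close>

theorem theta1_zero_lattice:
  assumes t0: "theta1 \<tau> t = 0" shows "t \<in> period_lattice \<tau>"
proof -
  let ?A = "theta1 (2 * \<tau>)" and ?B = "theta4 (2 * \<tau>)"
  have t2: "Im (2 * \<tau>) > 0" using \<tau> by simp
  have hA: "?A holomorphic_on UNIV" and hB: "?B holomorphic_on UNIV"
    by (rule theta1_holomorphic[OF t2] theta4_holomorphic[OF t2])+
  have id: "theta2 \<tau> s * theta1 \<tau> r = ?A (s + r) * ?B (s - r) - ?B (s + r) * ?A (s - r)" for s r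
    using theta12_prod[OF \<tau>, of r s] theta1_odd[OF t2, of "s - r"] theta4_even[OF t2, of "s - r"] by (simp add: add.commute mult.commute)
  have ab: "?A (x + 2 * t) * ?B x = ?B (x + 2 * t) * ?A x" for x
    using id[of "x + t" t] t0 by (simp add: algebra_simps)
  have nz: "?A x \<noteq> 0 \<or> ?B x \<noteq> 0" for x
  proof (rule ccontr)
    assume "\<not> ?thesis"
    then have z: "theta2 \<tau> s * theta1 \<tau> (x + - s) = 0" for s using id[of s "x - s"] by simp
    have "(\<lambda>s. theta1 \<tau> (x + - s)) holomorphic_on UNIV"
      by (rule holomorphic_on_compose_gen[of "\<lambda>s. x + - s" UNIV "theta1 \<tau>" UNIV, unfolded o_def])
         (auto intro!: holomorphic_intros theta1_holomorphic[OF \<tau>])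
    then have "(\<forall>s. theta2 \<tau> s = 0) \<or> (\<forall>s. theta1 \<tau> (x + - s) = 0)"
      by (rule entire_mult_eq_0[OF theta2_holomorphic[OF \<tau>] _ z])
    then show False using theta1_nontrivial[OF \<tau>] theta2_nontrivial[OF \<tau>]
      by (metis add.commute diff_add_cancel minus_diff_eq uminus_add_conv_diff)
  qed
  define c where "c x = (if ?B x \<noteq> 0 then ?B (x + 2 * t) / ?B x else ?A (x + 2 * t) / ?A x)" for x
  have cA: "?A (x + 2 * t) = c x * ?A x" and cB: "?B (x + 2 * t) = c x * ?B x" for x
    using ab[of x] nz[of x] by (auto simp: c_def field_simps)
  have c0: "c x \<noteq> 0" for x using cA[of x] cB[of x] nz[of "x + 2 * t"] by auto
  have uniq: "c x = d" if "?A (x + 2 * t) = d * ?A x" "?B (x + 2 * t) = d * ?B x" for x d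
    using that cA[of x] cB[of x] nz[of x] by auto
  have ch: "c holomorphic_on UNIV"
  proof -
    have 1: "c holomorphic_on {x. ?B x \<noteq> 0}"
      by (rule holomorphic_transform[of "\<lambda>x. ?B (x + 2 * t) / ?B x"])
         (auto simp: c_def intro!: holomorphic_intros holomorphic_on_subset[OF hB] holomorphic_on_subset[OF holomorphic_shift[OF hB]])
    have 2: "c holomorphic_on {x. ?A x \<noteq> 0}"
    proof (rule holomorphic_transform[of "\<lambda>x. ?A (x + 2 * t) / ?A x"])
      show "(\<lambda>x. ?A (x + 2 * t) / ?A x) holomorphic_on {x. ?A x \<noteq> 0}"
        by (auto intro!: holomorphic_intros holomorphic_on_subset[OF hA] holomorphic_on_subset[OF holomorphic_shift[OF hA]])
    qed (simp add: cA)
    have o: "open {x. ?B x \<noteq> 0}" "open {x. ?A x \<noteq> 0}"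
      using hA hB by (auto intro!: open_Collect_neq holomorphic_on_imp_continuous_on)
    have "{x. ?B x \<noteq> 0} \<union> {x. ?A x \<noteq> 0} = UNIV" using nz by auto
    then show ?thesis using holomorphic_on_Un[OF 1 2 o] by simp
  qed
  have sh: "x + of_real pi + 2 * t = (x + 2 * t) + of_real pi" "x + of_real pi * (2 * \<tau>) + 2 * t = (x + 2 * t) + of_real pi * (2 * \<tau>)" for x by simp_all
  have q: "quasi (2 * \<tau>) (x + 2 * t) = exp (- 4 * \<i> * t) * quasi (2 * \<tau>) x" "quasi (2 * \<tau>) x \<noteq> 0" for x
    unfolding quasi_def[OF t2] exp_add[symmetric] by (auto intro: arg_cong[where f = exp] simp: algebra_simps)
  have "\<exists>m::int. exp (- 4 * \<i> * t) = exp (2 * \<i> * of_int m * of_real pi * (2 * \<tau>))"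
  proof (rule quasi_periodic_exp[OF ch c0 t2])
    show "c (u + of_real pi) = c u" for u
      by (rule uniq) (simp_all only: sh theta_pi[OF t2] cA cB, simp_all)
    show "c (u + of_real pi * (2 * \<tau>)) = exp (- 4 * \<i> * t) * c u" for u
      by (rule uniq) (simp_all only: sh theta_pi_tau[OF t2] cA cB q, simp_all)
  qed
  then obtain m :: int where "exp (- 4 * \<i> * t) = exp (2 * \<i> * of_int m * of_real pi * (2 * \<tau>))" ..
  then obtain n :: int where "- 4 * \<i> * t = 2 * \<i> * of_int m * of_real pi * (2 * \<tau>) + of_real (of_int (2 * n) * pi) * \<i>"
    using iffD1[OF exp_eq] by blast
  then have n: "- 4 * \<i> * t = 2 * \<i> * of_int m * of_real pi * (2 * \<tau>) + of_int (2 * n) * of_real pi * \<i>"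
    by (simp only: of_real_mult of_real_of_int_eq)
  have "(- 4 * \<i>) * t = (- 4 * \<i>) * (of_int (- m) * (of_real pi * \<tau>) - of_int n * of_real pi / 2)"
    unfolding n by (simp add: algebra_simps)
  then have t: "t = of_int (- m) * (of_real pi * \<tau>) - of_int n * of_real pi / 2"
    unfolding mult_cancel_left by simp
  have 3: "theta1 \<tau> (u + of_int i * (of_real pi * \<tau>)) = 0 \<longleftrightarrow> theta1 \<tau> u = 0" for u i
    using periodic_int[of "\<lambda>u. theta1 \<tau> u = 0" "of_real pi * \<tau>"] theta_pi_tau(1)[OF \<tau>] by (simp add: quasi_def[OF \<tau>])
  have 4: "theta1 \<tau> (u + of_int i * of_real pi) = 0 \<longleftrightarrow> theta1 \<tau> u = 0" for u i
    using periodic_int[of "\<lambda>u. theta1 \<tau> u = 0" "of_real pi"] theta_pi(1)[OF \<tau>] by simp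
  have "even n"
  proof (rule ccontr)
    assume "odd n"
    then obtain l where l: "n = 2 * l + 1" by (auto elim: oddE)
    have e: "t = (- of_real pi / 2 + of_int (- l) * of_real pi) + of_int (- m) * (of_real pi * \<tau>)" unfolding t l by (simp add: field_simps)
    have "theta1 \<tau> (- of_real pi / 2) = 0" using t0 unfolding e 3 4 .
    then show False using theta_const_nonzero(1) theta1_eq'[OF \<tau>, of "- of_real pi / 2"] by simp
  qed
  then obtain l where "n = 2 * l" by (auto elim: evenE)
  then have "t = of_int (- l) * of_real pi + of_int (- m) * (of_real pi * \<tau>)" unfolding t by simp
  then show ?thesis unfolding period_lattice_def by blast
qed

text \<open>If the derivative vanished at \<open>0\<close>, the product formula would make the Wronskian of \<open>theta1\<close> and
  \<open>theta4\<close> for \<open>2 \<tau>\<close> vanish, so that these functions would be proportional.\<close>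

lemma theta1_deriv_0: "deriv (theta1 \<tau>) 0 \<noteq> 0"
proof
  assume d0: "deriv (theta1 \<tau>) 0 = 0"
  let ?A = "theta1 (2 * \<tau>)" and ?B = "theta4 (2 * \<tau>)"
  have t2: "Im (2 * \<tau>) > 0" using \<tau> by simp
  have hA: "?A holomorphic_on UNIV" and hB: "?B holomorphic_on UNIV"
    by (rule theta1_holomorphic[OF t2] theta4_holomorphic[OF t2])+
  have dA: "(?A has_field_derivative deriv ?A u) (at u)" and dB: "(?B has_field_derivative deriv ?B u) (at u)" for u
    using holomorphic_derivI[OF hA open_UNIV] holomorphic_derivI[OF hB open_UNIV] by auto
  have d1: "(theta1 \<tau> has_field_derivative 0) (at 0)"
    using holomorphic_derivI[OF theta1_holomorphic[OF \<tau>] open_UNIV, of 0] d0 by simp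
  have W: "deriv ?A s * ?B s = deriv ?B s * ?A s" for s
  proof -
    have id: "theta2 \<tau> s * theta1 \<tau> r = ?A (s + r) * ?B (s - r) - ?B (s + r) * ?A (s - r)" for r
      using theta12_prod[OF \<tau>, of r s] theta1_odd[OF t2, of "s - r"] theta4_even[OF t2, of "s - r"] by (simp add: add.commute mult.commute)
    have "((\<lambda>r. ?A (s + r) * ?B (s - r) - ?B (s + r) * ?A (s - r)) has_field_derivative
        (deriv ?A s * ?B s - ?A s * deriv ?B s) - (deriv ?B s * ?A s - ?B s * deriv ?A s)) (at 0)"
      by (rule derivative_eq_intros DERIV_chain'[OF _ dA[THEN DERIV_cong]] DERIV_chain'[OF _ dB[THEN DERIV_cong]] refl | simp)+
    moreover have "((\<lambda>r. theta2 \<tau> s * theta1 \<tau> r) has_field_derivative theta2 \<tau> s * 0) (at 0)"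
      by (rule DERIV_cmult[OF d1])
    ultimately have "theta2 \<tau> s * 0 = (deriv ?A s * ?B s - ?A s * deriv ?B s) - (deriv ?B s * ?A s - ?B s * deriv ?A s)"
      unfolding id using DERIV_unique by blast
    then show ?thesis by (simp add: algebra_simps)
  qed
  obtain r where r: "r > 0" "\<And>x. x \<in> ball 0 r \<Longrightarrow> ?B x \<noteq> 0"
  proof -
    have "continuous_on UNIV ?B" by (rule holomorphic_on_imp_continuous_on[OF hB])
    then have "open {x. ?B x \<noteq> 0}" by (intro open_Collect_neq) auto
    then show ?thesis using theta_const_nonzero(2) that unfolding open_contains_ball by blast
  qed
  have "((\<lambda>x. ?A x / ?B x) has_field_derivative 0) (at x within ball 0 r)" if "x \<in> ball 0 r" for x
  proof -
    have "((\<lambda>x. ?A x / ?B x) has_field_derivative (deriv ?A x * ?B x - ?A x * deriv ?B x) / (?B x * ?B x)) (at x)"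
      by (rule DERIV_divide[OF dA dB r(2)[OF that]])
    then show ?thesis using W[of x] by (simp add: mult.commute has_field_derivative_at_within)
  qed
  then obtain k where "\<And>x. x \<in> ball 0 r \<Longrightarrow> ?A x / ?B x = k"
    using has_field_derivative_zero_constant[of "ball 0 r" "\<lambda>x. ?A x / ?B x"] by auto
  moreover have "?A 0 / ?B 0 = 0" using theta1_odd[OF t2, of 0] by simp
  ultimately have "?A x = 0" if "x \<in> ball 0 r" for x using that r by (metis centre_in_ball divide_eq_0_iff)
  then have "?A x = 0" for x
    using analytic_continuation_open[of "ball 0 r" UNIV ?A "\<lambda>_. 0" x] r(1) hA by auto
  then show False using theta1_nontrivial[OF t2] by blast
qed

lemma theta1_simple_zero: assumes "theta1 \<tau> t = 0" shows "deriv (theta1 \<tau>) t \<noteq> 0"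
proof -
  let ?P = "\<lambda>u. theta1 \<tau> u = 0 \<and> deriv (theta1 \<tau>) u \<noteq> 0"
  have d: "(theta1 \<tau> has_field_derivative deriv (theta1 \<tau>) u) (at u)" for u
    using holomorphic_derivI[OF theta1_holomorphic[OF \<tau>] open_UNIV] by auto
  have sh: "((\<lambda>u. theta1 \<tau> (u + a)) has_field_derivative deriv (theta1 \<tau>) (u + a)) (at u)" for a u
    using DERIV_shift[of "theta1 \<tau>" "deriv (theta1 \<tau>) (u + a)" u a] d[of "u + a"] by simp
  have 1: "deriv (theta1 \<tau>) (u + of_real pi) = - deriv (theta1 \<tau>) u" for u
    using sh[where a = "of_real pi" and u = u] DERIV_minus[OF d[of u]] unfolding theta_pi[OF \<tau>] by (rule DERIV_unique)
  have 2: "deriv (theta1 \<tau>) (u + of_real pi * \<tau>) = - quasi \<tau> u * deriv (theta1 \<tau>) u" if "theta1 \<tau> u = 0" for u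
  proof -
    have "((\<lambda>u. - quasi \<tau> u * theta1 \<tau> u) has_field_derivative - quasi \<tau> u * deriv (theta1 \<tau>) u) (at u)"
      unfolding quasi_def[OF \<tau>] by (rule derivative_eq_intros d refl | simp add: that)+
    with sh[where a = "of_real pi * \<tau>" and u = u] show ?thesis unfolding theta_pi_tau[OF \<tau>] by (rule DERIV_unique)
  qed
  have q: "quasi \<tau> u \<noteq> 0" for u by (simp add: quasi_def[OF \<tau>])
  have a: "?P (0 + of_int m * of_real pi) = ?P 0" for m by (rule periodic_int) (simp add: theta_pi[OF \<tau>] 1)
  have b: "?P (u + of_int m * (of_real pi * \<tau>)) = ?P u" for m u
    by (rule periodic_int) (use q 2 in \<open>auto simp: theta_pi_tau[OF \<tau>]\<close>)
  obtain m n :: int where t: "t = 0 + of_int m * of_real pi + of_int n * (of_real pi * \<tau>)"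
    using theta1_zero_lattice[OF assms] unfolding period_lattice_def by auto
  have "?P t" unfolding t b a using theta1_deriv_0 theta1_odd[OF \<tau>, of 0] by simp
  then show ?thesis by simp
qed

end

section \<open>Riemann relations between the weights\<close>

text \<open>Four functions \<open>t1\<close>, \<dots>, \<open>t4\<close> tied to two functions \<open>A\<close> and \<open>B\<close> by the product formulas. They stand for
  the theta functions for \<open>\<omega>\<close>, with \<open>A = theta1\<close> and \<open>B = theta4\<close> for \<open>2 \<omega>\<close>.\<close>

locale theta_products =
  fixes t1 t2 t3 t4 A B :: "complex \<Rightarrow> complex"
  assumes p12: "\<And>s t. t1 s * t2 t = A (s + t) * B (s - t) + B (s + t) * A (s - t)"
    and p34: "\<And>s t. t3 s * t4 t = B (s + t) * B (s - t) - A (s + t) * A (s - t)"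
    and t1_odd: "\<And>u. t1 (- u) = - t1 u"
    and t2_even: "\<And>u. t2 (- u) = t2 u"
    and t3_even: "\<And>u. t3 (- u) = t3 u"
    and t4_even: "\<And>u. t4 (- u) = t4 u"
    and A_odd: "\<And>u. A (- u) = - A u"
    and B_even: "\<And>u. B (- u) = B u"
begin

lemma q12: "p = s + t \<Longrightarrow> q = s - t \<Longrightarrow> t1 s * t2 t = A p * B q + B p * A q"
  and q21: "p = s + t \<Longrightarrow> q = s - t \<Longrightarrow> t2 s * t1 t = A p * B q - B p * A q"
  and q34: "p = s + t \<Longrightarrow> q = s - t \<Longrightarrow> t3 s * t4 t = B p * B q - A p * A q"
  and q43: "p = s + t \<Longrightarrow> q = s - t \<Longrightarrow> t4 s * t3 t = B p * B q + A p * A q"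
proof -
  have e: "A (t - s) = - A (s - t)" "B (t - s) = B (s - t)"
    using A_odd[of "s - t"] B_even[of "s - t"] by auto
  show "p = s + t \<Longrightarrow> q = s - t \<Longrightarrow> t1 s * t2 t = A p * B q + B p * A q" by (simp add: p12)
  show "p = s + t \<Longrightarrow> q = s - t \<Longrightarrow> t2 s * t1 t = A p * B q - B p * A q"
    using p12[of t s] by (simp add: e add.commute[of t s] mult.commute)
  show "p = s + t \<Longrightarrow> q = s - t \<Longrightarrow> t3 s * t4 t = B p * B q - A p * A q" by (simp add: p34)
  show "p = s + t \<Longrightarrow> q = s - t \<Longrightarrow> t4 s * t3 t = B p * B q + A p * A q"
    using p34[of t s] by (simp add: e add.commute[of t s] mult.commute)
qed

lemma A0[simp]: "A 0 = 0" using A_odd[of 0] by simp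

lemma t1_0[simp]: "t1 0 = 0" using t1_odd[of 0] by simp

declare t1_odd [simp] t2_even [simp] t3_even [simp] t4_even [simp] A_odd [simp] B_even [simp]

text \<open>Riemann's theta relations: a signed sum of four products of four theta values is twice one such
  product at transformed arguments. Pairing the factors into \<open>t1 t2\<close> and \<open>t3 t4\<close> and applying the product formulas
  reduces both sides to the same polynomial in the values of \<open>A\<close> and \<open>B\<close>.\<close>

definition riem :: "complex \<Rightarrow> complex \<Rightarrow> complex \<Rightarrow> complex \<Rightarrow> complex \<Rightarrow> complex \<Rightarrow> complex \<Rightarrow> complex" where
  "riem a b c x1 x2 x3 x4 = t1 x1 * t2 x2 * t4 x3 * t3 x4 + a * (t4 x1 * t3 x2 * t1 x3 * t2 x4)
     + b * (t3 x1 * t4 x2 * t2 x3 * t1 x4) + c * (t2 x1 * t1 x2 * t3 x3 * t4 x4)"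

lemma
  assumes "x1 + x2 = X1 + X2" "x3 + x4 = X1 - X2" "x1 - x2 = X3 + X4" "x3 - x4 = X3 - X4"
  shows riem_ppp: "riem 1 1 1 x1 x2 x3 x4 = 2 * (t1 X1 * t2 X2 * t4 X3 * t3 X4)"
    and riem_pmm: "riem 1 (- 1) (- 1) x1 x2 x3 x4 = 2 * (t4 X1 * t3 X2 * t1 X3 * t2 X4)"
    and riem_mpm: "riem (- 1) 1 (- 1) x1 x2 x3 x4 = 2 * (t3 X1 * t4 X2 * t2 X3 * t1 X4)"
    and riem_mmp: "riem (- 1) (- 1) 1 x1 x2 x3 x4 = 2 * (t2 X1 * t1 X2 * t3 X3 * t4 X4)"
proof -
  let ?p = "x1 + x2" and ?q = "x1 - x2" and ?r = "x3 + x4" and ?s = "x3 - x4"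
  note q = q12[OF refl refl] q21[OF refl refl] q34[OF refl refl] q43[OF refl refl]
  have g: "riem a b c x1 x2 x3 x4 = (t1 x1 * t2 x2) * (t4 x3 * t3 x4) + a * ((t4 x1 * t3 x2) * (t1 x3 * t2 x4))
     + b * ((t3 x1 * t4 x2) * (t2 x3 * t1 x4)) + c * ((t2 x1 * t1 x2) * (t3 x3 * t4 x4))" for a b c
    by (simp add: riem_def mult_ac)
  have h: "a * b * c * d = (a * b) * (c * d)" for a b c d :: complex by (simp add: mult_ac)
  show "riem 1 1 1 x1 x2 x3 x4 = 2 * (t1 X1 * t2 X2 * t4 X3 * t3 X4)"
    "riem 1 (- 1) (- 1) x1 x2 x3 x4 = 2 * (t4 X1 * t3 X2 * t1 X3 * t2 X4)"
    "riem (- 1) 1 (- 1) x1 x2 x3 x4 = 2 * (t3 X1 * t4 X2 * t2 X3 * t1 X4)"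
    "riem (- 1) (- 1) 1 x1 x2 x3 x4 = 2 * (t2 X1 * t1 X2 * t3 X3 * t4 X4)"
    unfolding g h unfolding q assms(1)[symmetric] assms(2)[symmetric] assms(3)[symmetric] assms(4)[symmetric]
    by (simp_all add: algebra_simps)
qed

end

text \<open>
  The coefficients \<open>wo\<close>, \<open>wx\<close>, \<open>wy\<close>, \<open>wz\<close> of the R-matrix in the basis formed by \<open>1\<close> and the products of
  Pauli operators of two sites, and the coefficients \<open>ko\<close>, \<open>kx\<close>, \<open>ky\<close>, \<open>kz\<close> of the boundary matrix
  without the boundary constants. Here \<open>y\<close> is half the crossing parameter and \<open>ic\<close> a normalisation.
  The sign in \<open>wy\<close> is due to the convention that the operator called \<open>Y\<close> below has square \<open>- 1\<close>.
\<close>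

locale xyz_weights = theta_products +
  fixes y ic :: complex
begin

definition wo :: "complex \<Rightarrow> complex" where "wo u = ic * (t1 (u + y) * (t2 y * t3 y * t4 y))"
definition wx :: "complex \<Rightarrow> complex" where "wx u = ic * (t4 (u + y) * (t1 y * t2 y * t3 y))"
definition wy :: "complex \<Rightarrow> complex" where "wy u = - (ic * (t3 (u + y) * (t1 y * t2 y * t4 y)))"
definition wz :: "complex \<Rightarrow> complex" where "wz u = ic * (t2 (u + y) * (t1 y * t3 y * t4 y))"
lemmas w_defs = wo_def wx_def wy_def wz_def

definition ko :: "complex \<Rightarrow> complex" where "ko u = ic * (t2 u * t3 u * t4 u)"
definition kx :: "complex \<Rightarrow> complex" where "kx u = ic * (t1 u * t2 u * t3 u)"
definition ky :: "complex \<Rightarrow> complex" where "ky u = ic * (t1 u * t2 u * t4 u)"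
definition kz :: "complex \<Rightarrow> complex" where "kz u = ic * (t1 u * t3 u * t4 u)"
lemmas k_defs = ko_def kx_def ky_def kz_def

text \<open>The factors that the weights have in common in their bilinear and trilinear combinations.\<close>

definition c2 :: complex where "c2 = ic\<^sup>2 * (t1 y * t2 y * t3 y * t4 y)"
definition c3 :: complex where "c3 = ic ^ 3 * (t1 y * t2 y * t3 y * t4 y)\<^sup>2"

lemmas riem_simps = riem_def w_defs c2_def c3_def algebra_simps power2_eq_square power3_eq_cube

lemma eq_by_riem: "riem a b c x1 x2 x3 x4 = r \<Longrightarrow> l = k * riem a b c x1 x2 x3 x4 \<Longrightarrow> k * r = s \<Longrightarrow> l = s"
  by simp

text \<open>
  The bilinear relations between the weights at \<open>u - v\<close> and \<open>u + v\<close>. Their right-hand sides factorise in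
  \<open>u\<close> and \<open>v\<close>, which is what the reflection equation and the evenness of the transfer matrix need.
\<close>

lemma riem_x:
  "wo (u - v) * wx (u + v) + wx (u - v) * wo (u + v) + wy (u - v) * wz (u + v) + wz (u - v) * wy (u + v)
    = c2 * (2 * (t1 u * t4 (u + 2 * y) * t2 v * t3 v))"
  "wo (u - v) * wx (u + v) + wx (u - v) * wo (u + v) - wy (u - v) * wz (u + v) - wz (u - v) * wy (u + v)
    = c2 * (2 * (t4 u * t1 (u + 2 * y) * t2 v * t3 v))"
  "wo (u - v) * wx (u + v) - wx (u - v) * wo (u + v) + wy (u - v) * wz (u + v) - wz (u - v) * wy (u + v)
    = - c2 * (2 * (t3 u * t2 (u + 2 * y) * t1 v * t4 v))"
  "wo (u - v) * wx (u + v) - wx (u - v) * wo (u + v) - wy (u - v) * wz (u + v) + wz (u - v) * wy (u + v)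
    = - c2 * (2 * (t2 u * t3 (u + 2 * y) * t1 v * t4 v))"
  subgoal by (rule eq_by_riem[where k = "c2", OF riem_pmm[of "u - v + y" y "u + 2 * y" "- v" "u + v + y" y u "- v"]]) (simp_all add: riem_simps)
  subgoal by (rule eq_by_riem[where k = "c2", OF riem_ppp[of "u - v + y" y "u + 2 * y" "- v" "u + v + y" y u "- v"]]) (simp_all add: riem_simps)
  subgoal by (rule eq_by_riem[where k = "c2", OF riem_mmp[of "u - v + y" y "u + 2 * y" "- v" "u + v + y" y u "- v"]]) (simp_all add: riem_simps)
  subgoal by (rule eq_by_riem[where k = "c2", OF riem_mpm[of "u - v + y" y "u + 2 * y" "- v" "u + v + y" y u "- v"]]) (simp_all add: riem_simps)
  done

lemma riem_y:
  "wo (u - v) * wy (u + v) + wy (u - v) * wo (u + v) + wz (u - v) * wx (u + v) + wx (u - v) * wz (u + v)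
    = - c2 * (2 * (t1 u * t3 (u + 2 * y) * t2 v * t4 v))"
  "wo (u - v) * wy (u + v) + wy (u - v) * wo (u + v) - wz (u - v) * wx (u + v) - wx (u - v) * wz (u + v)
    = - c2 * (2 * (t3 u * t1 (u + 2 * y) * t2 v * t4 v))"
  "wo (u - v) * wy (u + v) - wy (u - v) * wo (u + v) + wz (u - v) * wx (u + v) - wx (u - v) * wz (u + v)
    = c2 * (2 * (t2 u * t4 (u + 2 * y) * t1 v * t3 v))"
  "wo (u - v) * wy (u + v) - wy (u - v) * wo (u + v) - wz (u - v) * wx (u + v) + wx (u - v) * wz (u + v)
    = c2 * (2 * (t4 u * t2 (u + 2 * y) * t1 v * t3 v))"
  subgoal by (rule eq_by_riem[where k = "- c2", OF riem_mpm[of "u - v + y" y "u + 2 * y" "- v" y "u + v + y" "- v" u]]) (simp_all add: riem_simps)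
  subgoal by (rule eq_by_riem[where k = "- c2", OF riem_ppp[of "u - v + y" y "u + 2 * y" "- v" y "u + v + y" "- v" u]]) (simp_all add: riem_simps)
  subgoal by (rule eq_by_riem[where k = "- c2", OF riem_pmm[of "u - v + y" y "u + 2 * y" "- v" y "u + v + y" "- v" u]]) (simp_all add: riem_simps)
  subgoal by (rule eq_by_riem[where k = "- c2", OF riem_mmp[of "u - v + y" y "u + 2 * y" "- v" y "u + v + y" "- v" u]]) (simp_all add: riem_simps)
  done

lemma riem_z:
  "wo (u - v) * wz (u + v) + wz (u - v) * wo (u + v) + wx (u - v) * wy (u + v) + wy (u - v) * wx (u + v)
    = c2 * (2 * (t1 u * t2 (u + 2 * y) * t3 v * t4 v))"
  "wo (u - v) * wz (u + v) + wz (u - v) * wo (u + v) - wx (u - v) * wy (u + v) - wy (u - v) * wx (u + v)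
    = c2 * (2 * (t2 u * t1 (u + 2 * y) * t3 v * t4 v))"
  "wo (u - v) * wz (u + v) - wz (u - v) * wo (u + v) + wx (u - v) * wy (u + v) - wy (u - v) * wx (u + v)
    = - c2 * (2 * (t4 u * t3 (u + 2 * y) * t1 v * t2 v))"
  "wo (u - v) * wz (u + v) - wz (u - v) * wo (u + v) - wx (u - v) * wy (u + v) + wy (u - v) * wx (u + v)
    = - c2 * (2 * (t3 u * t4 (u + 2 * y) * t1 v * t2 v))"
  subgoal by (rule eq_by_riem[where k = "c2", OF riem_mmp[of "u - v + y" "u + v + y" "u + 2 * y" u y y "- v" "- v"]]) (simp_all add: riem_simps)
  subgoal by (rule eq_by_riem[where k = "c2", OF riem_ppp[of "u - v + y" "u + v + y" "u + 2 * y" u y y "- v" "- v"]]) (simp_all add: riem_simps)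
  subgoal by (rule eq_by_riem[where k = "c2", OF riem_mpm[of "u - v + y" "u + v + y" "u + 2 * y" u y y "- v" "- v"]]) (simp_all add: riem_simps)
  subgoal by (rule eq_by_riem[where k = "c2", OF riem_pmm[of "u - v + y" "u + v + y" "u + 2 * y" u y y "- v" "- v"]]) (simp_all add: riem_simps)
  done

text \<open>The six relations that imply the Yang--Baxter equation: each is a Riemann relation whose right-hand
  side contains the factor \<open>t1 0 = 0\<close>.\<close>

lemma ybe:
  "wo (u - v) * wx u * wy v + wx (u - v) * wo u * wz v + wy (u - v) * wz u * wo v - wz (u - v) * wy u * wx v = 0"
  "wo (u - v) * wx u * wz v + wx (u - v) * wo u * wy v + wy (u - v) * wz u * wx v - wz (u - v) * wy u * wo v = 0"
  "wo (u - v) * wy u * wx v - wx (u - v) * wz u * wo v - wy (u - v) * wo u * wz v - wz (u - v) * wx u * wy v = 0"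
  "wo (u - v) * wy u * wz v - wx (u - v) * wz u * wy v - wy (u - v) * wo u * wx v - wz (u - v) * wx u * wo v = 0"
  "wo (u - v) * wz u * wx v - wx (u - v) * wy u * wo v + wy (u - v) * wx u * wz v + wz (u - v) * wo u * wy v = 0"
  "wo (u - v) * wz u * wy v - wx (u - v) * wy u * wz v + wy (u - v) * wx u * wo v + wz (u - v) * wo u * wx v = 0"
  subgoal by (rule eq_by_riem[where k = "- c3", OF riem_mpm[of "u - v + y" y "u + 2 * y" "- v" "u + y" "v + y" "u - v" 0]]) (simp_all add: riem_simps)
  subgoal by (rule eq_by_riem[where k = "c3", OF riem_mmp[of "u - v + y" "v + y" "u + 2 * y" 0 "u + y" y "u - v" "- v"]]) (simp_all add: riem_simps)
  subgoal by (rule eq_by_riem[where k = "- c3", OF riem_pmm[of "u - v + y" y "u + 2 * y" "- v" "v + y" "u + y" 0 "u - v"]]) (simp_all add: riem_simps)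
  subgoal by (rule eq_by_riem[where k = "- c3", OF riem_mmp[of "u - v + y" "v + y" "u + 2 * y" 0 y "u + y" "- v" "u - v"]]) (simp_all add: riem_simps)
  subgoal by (rule eq_by_riem[where k = "c3", OF riem_pmm[of "u - v + y" "u + y" "u + 2 * y" "u - v" "v + y" y 0 "- v"]]) (simp_all add: riem_simps)
  subgoal by (rule eq_by_riem[where k = "- c3", OF riem_mpm[of "u - v + y" "u + y" "u + 2 * y" "u - v" y "v + y" "- v" 0]]) (simp_all add: riem_simps)
  done

lemma weights_at_double:
  "wo (2 * u) + wx (2 * u) - wy (2 * u) + wz (2 * u) = 2 * t1 (u + 2 * y) * ko u"
  "wo (2 * u) + wx (2 * u) + wy (2 * u) - wz (2 * u) = 2 * t4 (u + 2 * y) * kx u"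
  "wo (2 * u) - wx (2 * u) - wy (2 * u) - wz (2 * u) = 2 * t3 (u + 2 * y) * ky u"
  "wo (2 * u) - wx (2 * u) + wy (2 * u) + wz (2 * u) = 2 * t2 (u + 2 * y) * kz u"
  subgoal by (rule eq_by_riem[where k = "ic", OF riem_ppp[of "2 * u + y" y "u + 2 * y" u y y u u]]) (simp_all add: riem_simps k_defs)
  subgoal by (rule eq_by_riem[where k = "ic", OF riem_pmm[of "2 * u + y" y "u + 2 * y" u y y u u]]) (simp_all add: riem_simps k_defs)
  subgoal by (rule eq_by_riem[where k = "ic", OF riem_mpm[of "2 * u + y" y "u + 2 * y" u y y u u]]) (simp_all add: riem_simps k_defs)
  subgoal by (rule eq_by_riem[where k = "ic", OF riem_mmp[of "2 * u + y" y "u + 2 * y" u y y u u]]) (simp_all add: riem_simps k_defs)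
  done

end

section \<open>Pauli operators, partial traces and crossing\<close>

text \<open>
  A ring with central scalars \<open>sc c\<close> and, for every site, two anticommuting involutions \<open>X i\<close> and \<open>Z i\<close>
  that commute with those of the other sites. It abstracts from the operators on a spin chain with
  site set \<open>'i\<close>. Working in such a ring lets one and the same calculation apply to any set of sites.
\<close>

locale pauli =
  fixes sc :: "complex \<Rightarrow> 'a::ring_1" and X Z :: "'i \<Rightarrow> 'a"
  assumes sc_add: "sc (c + d) = sc c + sc d"
    and sc_mult: "sc (c * d) = sc c * sc d"
    and sc_1 [simp]: "sc 1 = 1"
    and sc_central: "a * sc c = sc c * a"
    and xx [simp]: "X i * X i = 1"
    and zz [simp]: "Z i * Z i = 1"
    and xz: "X i * Z i = - (Z i * X i)"
    and comm_x: "i \<noteq> j \<Longrightarrow> X i * X j = X j * X i"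
    and comm_z: "i \<noteq> j \<Longrightarrow> Z i * Z j = Z j * Z i"
    and comm_xz: "i \<noteq> j \<Longrightarrow> X i * Z j = Z j * X i"
begin

text \<open>This is \<open>\<i>\<close> times the usual Pauli matrix, which avoids the imaginary unit: \<open>Y i * Y i = - 1\<close>.\<close>

definition Y :: "'i \<Rightarrow> 'a" where "Y i = Z i * X i"

lemma sc_0 [simp]: "sc 0 = 0" using sc_add[of 0 0] by simp
lemma sc_minus: "sc (- c) = - sc c" using sc_add[of c "- c"] by (simp add: eq_neg_iff_add_eq_0 add.commute)
lemma sc_diff: "sc (c - d) = sc c - sc d" using sc_add[of c "- d"] by (simp add: sc_minus)

lemma xx' [simp]: "X i * (X i * a) = a" by (simp add: mult.assoc[symmetric])
lemma zz' [simp]: "Z i * (Z i * a) = a" by (simp add: mult.assoc[symmetric])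
lemma xz': "X i * (Z i * a) = - (Z i * (X i * a))" using xz[of i] by (metis mult.assoc mult_minus_left)

lemma prods: "Z i * X i = Y i" "X i * Z i = - Y i" "Y i * Y i = - 1" "X i * Y i = - Z i" "Y i * X i = Z i"
  "Z i * Y i = X i" "Y i * Z i = - X i"
  by (simp_all add: Y_def xz mult.assoc xz')

lemma prods': "Z i * (X i * a) = Y i * a" "X i * (Z i * a) = - (Y i * a)" "Y i * (Y i * a) = - a"
  "X i * (Y i * a) = - (Z i * a)" "Y i * (X i * a) = Z i * a"
  "Z i * (Y i * a) = X i * a" "Y i * (Z i * a) = - (X i * a)"
  by (simp_all add: mult.assoc[symmetric] prods)

lemma comm_y: assumes "i \<noteq> j" shows "X i * Y j = Y j * X i" "Z i * Y j = Y j * Z i" "Y i * Y j = Y j * Y i"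
proof -
  have c: "a * (b * d) = (b * d) * a" if "a * b = b * a" "a * d = d * a" for a b d :: 'a
    by (metis that mult.assoc)
  show 1: "X i * Y j = Y j * X i" unfolding Y_def
    by (rule c) (rule comm_x[OF assms] comm_xz[OF assms])+
  show 2: "Z i * Y j = Y j * Z i" unfolding Y_def
    by (rule c) (rule comm_z[OF assms] comm_xz[OF assms[symmetric], symmetric])+
  show "Y i * Y j = Y j * Y i" unfolding Y_def[of i]
    by (rule c[symmetric]) (rule 1[symmetric] 2[symmetric])+
qed

lemma swap: assumes "i \<noteq> j"
  shows "X j * X i = X i * X j" "X j * Y i = Y i * X j" "X j * Z i = Z i * X j"
    "Y j * X i = X i * Y j" "Y j * Y i = Y i * Y j" "Y j * Z i = Z i * Y j"
    "Z j * X i = X i * Z j" "Z j * Y i = Y i * Z j" "Z j * Z i = Z i * Z j"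
    "X j * (X i * a) = X i * (X j * a)" "X j * (Y i * a) = Y i * (X j * a)" "X j * (Z i * a) = Z i * (X j * a)"
    "Y j * (X i * a) = X i * (Y j * a)" "Y j * (Y i * a) = Y i * (Y j * a)" "Y j * (Z i * a) = Z i * (Y j * a)"
    "Z j * (X i * a) = X i * (Z j * a)" "Z j * (Y i * a) = Y i * (Z j * a)" "Z j * (Z i * a) = Z i * (Z j * a)"
proof -
  note n = assms[symmetric]
  show *: "X j * X i = X i * X j" "X j * Y i = Y i * X j" "X j * Z i = Z i * X j"
    "Y j * X i = X i * Y j" "Y j * Y i = Y i * Y j" "Y j * Z i = Z i * Y j"
    "Z j * X i = X i * Z j" "Z j * Y i = Y i * Z j" "Z j * Z i = Z i * Z j"
    by (rule comm_x[OF n] comm_z[OF n] comm_xz[OF n] comm_xz[OF assms, symmetric] comm_y[OF n] comm_y[OF assms, symmetric])+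
  show "X j * (X i * a) = X i * (X j * a)" "X j * (Y i * a) = Y i * (X j * a)" "X j * (Z i * a) = Z i * (X j * a)"
    "Y j * (X i * a) = X i * (Y j * a)" "Y j * (Y i * a) = Y i * (Y j * a)" "Y j * (Z i * a) = Z i * (Y j * a)"
    "Z j * (X i * a) = X i * (Z j * a)" "Z j * (Y i * a) = Y i * (Z j * a)" "Z j * (Z i * a) = Z i * (Z j * a)"
    by (simp_all only: mult.assoc[symmetric] *)
qed

lemma sc_left: "X i * sc c = sc c * X i" "Y i * sc c = sc c * Y i" "Z i * sc c = sc c * Z i"
   "X i * (sc c * a) = sc c * (X i * a)" "Y i * (sc c * a) = sc c * (Y i * a)" "Z i * (sc c * a) = sc c * (Z i * a)"
  "sc c * sc d = sc (c * d)" "sc c * (sc d * a) = sc (c * d) * a"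
  by (simp_all add: sc_central[of "X i"] sc_central[of "Y i"] sc_central[of "Z i"] sc_mult mult.assoc[symmetric])

lemmas pauli_simps = prods prods' sc_left distrib_left distrib_right left_diff_distrib right_diff_distrib mult.assoc

text \<open>Operators on two sites and on one site, in the form of the R-matrix and of the boundary matrix.\<close>

definition pair :: "complex \<Rightarrow> complex \<Rightarrow> complex \<Rightarrow> complex \<Rightarrow> 'i \<Rightarrow> 'i \<Rightarrow> 'a" where
  "pair a b c d i j = sc a + sc b * (X i * X j) + sc c * (Y i * Y j) + sc d * (Z i * Z j)"

definition single :: "complex \<Rightarrow> complex \<Rightarrow> complex \<Rightarrow> complex \<Rightarrow> 'i \<Rightarrow> 'a" where
  "single a b c d i = sc a + sc b * X i + sc c * Y i + sc d * Z i"

lemma pair_mult: assumes ij: "i \<noteq> j" shows "pair uo ux uy uz i j * pair vo vx vy vz i j = 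
  pair (uo * vo + ux * vx + uy * vy + uz * vz) (uo * vx + ux * vo + uy * vz + uz * vy) (uo * vy + ux * vz + uy * vo + uz * vx) (uo * vz + ux * vy + uy * vx + uz * vo) i j"
  unfolding pair_def
  by (simp add: pauli_simps swap[OF ij] sc_add ac_simps)

lemma YBE_general:
  assumes ne: "i \<noteq> j" "i \<noteq> k" "j \<noteq> k"
    and e: "uo * vx * wy + ux * vo * wz + uy * vz * wo - uz * vy * wx = 0"
      "uo * vx * wz + ux * vo * wy + uy * vz * wx - uz * vy * wo = 0"
      "uo * vy * wx - ux * vz * wo - uy * vo * wz - uz * vx * wy = 0"
      "uo * vy * wz - ux * vz * wy - uy * vo * wx - uz * vx * wo = 0"
      "uo * vz * wx - ux * vy * wo + uy * vx * wz + uz * vo * wy = 0"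
      "uo * vz * wy - ux * vy * wz + uy * vx * wo + uz * vo * wx = 0"
  shows "pair uo ux uy uz i j * pair vo vx vy vz i k * pair wo wx wy wz j k
     = pair wo wx wy wz j k * pair vo vx vy vz i k * pair uo ux uy uz i j"
proof -
  have "pair uo ux uy uz i j * pair vo vx vy vz i k * pair wo wx wy wz j k
     - pair wo wx wy wz j k * pair vo vx vy vz i k * pair uo ux uy uz i j
    = - sc (uo * vx * wy + ux * vo * wz + uy * vz * wo - uz * vy * wx) * (X i * (Y j * Z k) + X i * (Y j * Z k))
      - sc (uo * vx * wz + ux * vo * wy + uy * vz * wx - uz * vy * wo) * (X i * (Z j * Y k) + X i * (Z j * Y k))
      + sc (uo * vy * wx - ux * vz * wo - uy * vo * wz - uz * vx * wy) * (Y i * (X j * Z k) + Y i * (X j * Z k))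
      - sc (uo * vy * wz - ux * vz * wy - uy * vo * wx - uz * vx * wo) * (Y i * (Z j * X k) + Y i * (Z j * X k))
      + sc (uo * vz * wx - ux * vy * wo + uy * vx * wz + uz * vo * wy) * (Z i * (X j * Y k) + Z i * (X j * Y k))
      + sc (uo * vz * wy - ux * vy * wz + uy * vx * wo + uz * vo * wx) * (Z i * (Y j * X k) + Z i * (Y j * X k))"
    unfolding pair_def
    by (simp add: pauli_simps swap[OF ne(1)] swap[OF ne(2)] swap[OF ne(3)] sc_diff sc_add sc_minus algebra_simps)
  then show ?thesis unfolding e by simp
qed

text \<open>The reflection equation, reduced to relations between the coefficients.\<close>

lemma reflection_general:
  assumes ne: "i \<noteq> j"
    and e:
      "ky * lz * (uo * vy + uy * vo - uz * vx - ux * vz) + kz * ly * (uo * vz + uz * vo - ux * vy - uy * vx) = 0"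
      "- kx * lz * (uo * vx + ux * vo - uy * vz - uz * vy) + kz * lx * (uo * vz + uz * vo - ux * vy - uy * vx) = 0"
      "- kx * ly * (uo * vx + ux * vo - uy * vz - uz * vy) - ky * lx * (uo * vy + uy * vo - uz * vx - ux * vz) = 0"
      "- ky * lz * (uo * vz - uz * vo - ux * vy + uy * vx) - kz * ly * (uo * vy - uy * vo + uz * vx - ux * vz) = 0"
      "- ko * lz * (uo * vx + ux * vo + uy * vz + uz * vy) + kz * lo * (uo * vy - uy * vo + uz * vx - ux * vz) = 0"
      "- ko * ly * (uo * vx + ux * vo + uy * vz + uz * vy) - ky * lo * (uo * vz - uz * vo - ux * vy + uy * vx) = 0"
      "- kx * lz * (uo * vz - uz * vo + ux * vy - uy * vx) + kz * lx * (uo * vx - ux * vo - uy * vz + uz * vy) = 0"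
      "- ko * lz * (uo * vy + uy * vo + uz * vx + ux * vz) + kz * lo * (uo * vx - ux * vo - uy * vz + uz * vy) = 0"
      "ko * lx * (uo * vy + uy * vo + uz * vx + ux * vz) - kx * lo * (uo * vz - uz * vo + ux * vy - uy * vx) = 0"
      "kx * ly * (uo * vy - uy * vo - uz * vx + ux * vz) + ky * lx * (uo * vx - ux * vo + uy * vz - uz * vy) = 0"
      "ko * ly * (uo * vz + uz * vo + ux * vy + uy * vx) + ky * lo * (uo * vx - ux * vo + uy * vz - uz * vy) = 0"
      "ko * lx * (uo * vz + uz * vo + ux * vy + uy * vx) - kx * lo * (uo * vy - uy * vo - uz * vx + ux * vz) = 0"
  shows "pair uo ux uy uz i j * single ko kx ky kz i * pair vo vx vy vz i j * single lo lx ly lz j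
     = single lo lx ly lz j * pair vo vx vy vz i j * single ko kx ky kz i * pair uo ux uy uz i j"
proof -
  have "pair uo ux uy uz i j * single ko kx ky kz i * pair vo vx vy vz i j * single lo lx ly lz j
     - single lo lx ly lz j * pair vo vx vy vz i j * single ko kx ky kz i * pair uo ux uy uz i j
    = 0
      + sc (ky * lz * (uo * vy + uy * vo - uz * vx - ux * vz) + kz * ly * (uo * vz + uz * vo - ux * vy - uy * vx)) * (X j + X j)
      + sc (- kx * lz * (uo * vx + ux * vo - uy * vz - uz * vy) + kz * lx * (uo * vz + uz * vo - ux * vy - uy * vx)) * (Y j + Y j)
      + sc (- kx * ly * (uo * vx + ux * vo - uy * vz - uz * vy) - ky * lx * (uo * vy + uy * vo - uz * vx - ux * vz)) * (Z j + Z j)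
      + sc (- ky * lz * (uo * vz - uz * vo - ux * vy + uy * vx) - kz * ly * (uo * vy - uy * vo + uz * vx - ux * vz)) * (X i + X i)
      + sc (- ko * lz * (uo * vx + ux * vo + uy * vz + uz * vy) + kz * lo * (uo * vy - uy * vo + uz * vx - ux * vz)) * (X i * Y j + X i * Y j)
      + sc (- ko * ly * (uo * vx + ux * vo + uy * vz + uz * vy) - ky * lo * (uo * vz - uz * vo - ux * vy + uy * vx)) * (X i * Z j + X i * Z j)
      + sc (- kx * lz * (uo * vz - uz * vo + ux * vy - uy * vx) + kz * lx * (uo * vx - ux * vo - uy * vz + uz * vy)) * (Y i + Y i)
      + sc (- ko * lz * (uo * vy + uy * vo + uz * vx + ux * vz) + kz * lo * (uo * vx - ux * vo - uy * vz + uz * vy)) * (Y i * X j + Y i * X j)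
      + sc (ko * lx * (uo * vy + uy * vo + uz * vx + ux * vz) - kx * lo * (uo * vz - uz * vo + ux * vy - uy * vx)) * (Y i * Z j + Y i * Z j)
      + sc (kx * ly * (uo * vy - uy * vo - uz * vx + ux * vz) + ky * lx * (uo * vx - ux * vo + uy * vz - uz * vy)) * (Z i + Z i)
      + sc (ko * ly * (uo * vz + uz * vo + ux * vy + uy * vx) + ky * lo * (uo * vx - ux * vo + uy * vz - uz * vy)) * (Z i * X j + Z i * X j)
      + sc (ko * lx * (uo * vz + uz * vo + ux * vy + uy * vx) - kx * lo * (uo * vy - uy * vo - uz * vx + ux * vz)) * (Z i * Y j + Z i * Y j)"
    unfolding pair_def single_def
    by (simp add: pauli_simps swap[OF ne] sc_diff sc_add sc_minus algebra_simps)
  then show ?thesis unfolding e by simp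
qed

text \<open>\<open>free i a\<close> says that \<open>a\<close> acts trivially on site \<open>i\<close>.\<close>

definition free :: "'i \<Rightarrow> 'a \<Rightarrow> bool" where
  "free i a \<longleftrightarrow> X i * a = a * X i \<and> Z i * a = a * Z i"

lemma free_commute: "free i a \<Longrightarrow> X i * a = a * X i" "free i a \<Longrightarrow> Z i * a = a * Z i"
  "free i a \<Longrightarrow> Y i * a = a * Y i"
  unfolding free_def Y_def by (simp_all add: mult.assoc) (simp add: mult.assoc[symmetric])

lemma free_intros [intro, simp]:
  "free i 1" "free i 0" "free i (sc c)"
  "free i a \<Longrightarrow> free i b \<Longrightarrow> free i (a + b)"
  "free i a \<Longrightarrow> free i b \<Longrightarrow> free i (a - b)"
  "free i a \<Longrightarrow> free i (- a)"
  "free i a \<Longrightarrow> free i b \<Longrightarrow> free i (a * b)"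
  "i \<noteq> j \<Longrightarrow> free i (X j)" "i \<noteq> j \<Longrightarrow> free i (Y j)" "i \<noteq> j \<Longrightarrow> free i (Z j)"
proof -
  show "free i a \<Longrightarrow> free i b \<Longrightarrow> free i (a * b)"
    unfolding free_def by (metis mult.assoc)
  show "i \<noteq> j \<Longrightarrow> free i (X j)" "i \<noteq> j \<Longrightarrow> free i (Y j)" "i \<noteq> j \<Longrightarrow> free i (Z j)"
    unfolding free_def by (simp_all add: swap[of j i])
qed (auto simp: free_def sc_left distrib_left distrib_right left_diff_distrib right_diff_distrib)

lemma free_pair: "i \<noteq> j \<Longrightarrow> i \<noteq> k \<Longrightarrow> free i (pair a b c d j k)" by (simp add: pair_def)
lemma free_single: "i \<noteq> j \<Longrightarrow> free i (single a b c d j)" by (simp add: single_def)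

lemma sc_pair: "sc c * pair a b d e i j = pair (c * a) (c * b) (c * d) (c * e) i j"
  and sc_single: "sc c * single a b d e i = single (c * a) (c * b) (c * d) (c * e) i"
  by (simp_all add: pair_def single_def pauli_simps)

lemma pair_sym: "pair a b c d i j = pair a b c d j i"
proof (cases "i = j")
  case False then show ?thesis by (simp add: pair_def swap[of i j])
qed simp

lemma free_commute': "free i a \<Longrightarrow> X i * (a * b) = a * (X i * b)" "free i a \<Longrightarrow> Z i * (a * b) = a * (Z i * b)"
  "free i a \<Longrightarrow> Y i * (a * b) = a * (Y i * b)"
  by (simp_all only: mult.assoc[symmetric] free_commute)

lemma sc_left': "a * (sc c * b) = sc c * (a * b)" by (simp only: mult.assoc[symmetric] sc_central[of a])

lemma pair_commute_free: assumes "free i a" "free j a" shows "pair u b c d i j * a = a * pair u b c d i j"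
  by (simp add: pair_def distrib_left distrib_right mult.assoc free_commute[OF assms(1)] free_commute[OF assms(2)]
      free_commute'[OF assms(1)] sc_central[of a] sc_left'[of a])

lemma single_commute_free: assumes "free i a" shows "single u b c d i * a = a * single u b c d i"
  by (simp add: single_def distrib_left distrib_right mult.assoc free_commute[OF assms] sc_central[of a] sc_left'[of a])

text \<open>
  The partial trace over site \<open>i\<close> is twice the average over the conjugations with \<open>1\<close> and the three Pauli operators.
  Subtracting the identity from it yields the crossing map, which fixes what is free of \<open>i\<close> and
  reverses the sign of the three Pauli components; it plays the role of the partial transpose.
\<close>

definition ptr :: "'i \<Rightarrow> 'a \<Rightarrow> 'a" where
  "ptr i a = sc (1/2) * (a + X i * a * X i - Y i * a * Y i + Z i * a * Z i)"

definition cross :: "'i \<Rightarrow> 'a \<Rightarrow> 'a" where "cross i a = ptr i a - a"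

lemma ptr_add: "ptr i (a + b) = ptr i a + ptr i b"
  and ptr_diff: "ptr i (a - b) = ptr i a - ptr i b"
  and ptr_minus: "ptr i (- a) = - ptr i a"
  by (simp_all add: ptr_def algebra_simps)

lemma free_ptr: "free i (ptr i a)"
  unfolding free_def ptr_def by (simp add: pauli_simps algebra_simps)

lemma ptr_mult_left: assumes "free i a" shows "ptr i (a * b) = a * ptr i b"
proof -
  have "s * (a * b) * s = a * (s * b * s)" if "s * a = a * s" for s by (metis that mult.assoc)
  then show ?thesis unfolding ptr_def
    by (simp add: free_commute[OF assms] distrib_left right_diff_distrib sc_central[of a] mult.assoc[symmetric, of a "sc _"])
       (simp add: mult.assoc)
qed

lemma ptr_mult_right: assumes "free i a" shows "ptr i (b * a) = ptr i b * a"
proof -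
  have "s * (b * a) * s = (s * b * s) * a" if "s * a = a * s" for s by (metis that mult.assoc)
  then show ?thesis unfolding ptr_def
    by (simp add: free_commute[OF assms] distrib_left distrib_right left_diff_distrib mult.assoc)
qed

lemma ptr_sc: "ptr i (sc c * a) = sc c * ptr i a" by (simp add: ptr_mult_left)

lemma ptr_1: "ptr i 1 = sc 2" by (simp add: ptr_def pauli_simps sc_add[symmetric] flip: sc_1)

lemma ptr_free: "free i a \<Longrightarrow> ptr i a = sc 2 * a"
  using ptr_mult_right[of i a 1] by (simp add: ptr_1)

lemma ptr_cyclic: "ptr i (X i * a) = ptr i (a * X i)" "ptr i (Y i * a) = ptr i (a * Y i)" "ptr i (Z i * a) = ptr i (a * Z i)"
  unfolding ptr_def by (simp_all add: pauli_simps algebra_simps)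

lemma ptr_traceless: "ptr i (X i) = 0" "ptr i (Y i) = 0" "ptr i (Z i) = 0"
  unfolding ptr_def by (simp_all add: pauli_simps)

lemma free_ptr_other: assumes "i \<noteq> j" "free i a" shows "free i (ptr j a)"
  unfolding ptr_def using assms by simp

lemma cross_ptr: "ptr i (cross i a) = ptr i a"
  by (simp add: cross_def ptr_diff ptr_free[OF free_ptr] sc_add[of 1 1, simplified] mult_2)

lemma cross_cross: "cross i (cross i a) = a"
  unfolding cross_def[of i "cross i a"] cross_ptr by (simp add: cross_def)

lemma cross_add: "cross i (a + b) = cross i a + cross i b"
  by (simp add: cross_def ptr_add)

lemma cross_mult_left: "free i a \<Longrightarrow> cross i (a * b) = a * cross i b"
  and cross_mult_right: "free i a \<Longrightarrow> cross i (b * a) = cross i b * a"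
  by (simp_all add: cross_def ptr_mult_left ptr_mult_right left_diff_distrib right_diff_distrib)

lemma ptr_cross_cross: "ptr i (cross i a * cross i b) = ptr i (a * b)"
  by (simp add: cross_def left_diff_distrib right_diff_distrib ptr_diff ptr_mult_left[OF free_ptr]
      ptr_mult_right[OF free_ptr] ptr_free[OF free_ptr] sc_add[of 1 1, simplified] mult_2 distrib_right)

lemma half: "sc (1/2) * a + sc (1/2) * a = a" "sc (1/2) * a + (sc (1/2) * a + b) = a + b"
  by (simp_all add: add.assoc[symmetric] flip: distrib_right sc_add)

lemma cross_anti: "cross i (a * X i) = - (X i * cross i a)" "cross i (a * Y i) = - (Y i * cross i a)"
   "cross i (a * Z i) = - (Z i * cross i a)"
  unfolding cross_def ptr_def
  by (simp_all add: pauli_simps algebra_simps half)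

lemma cross_pair:
  assumes ij: "i \<noteq> j" and a: "free j a"
  shows "cross i (a * pair p q r s i j) = pair p (- q) (- r) (- s) i j * cross i a"
proof -
  have c: "free j (cross i a)" using a ij unfolding cross_def by (simp add: free_ptr_other)
  have 1: "cross i (a * sc k) = sc k * cross i a" for k
    by (simp add: sc_central[of a] cross_mult_left[OF free_intros(3)])
  have 2: "cross i (a * (sc k * (s * t))) = sc (- k) * (s * t) * cross i a"
    if "free i t" "t * cross i a = cross i a * t" "cross i (a * s) = - (s * cross i a)" for k s t
  proof -
    have "cross i (a * (sc k * (s * t))) = cross i (sc k * ((a * s) * t))"
      by (simp only: sc_central[of a] mult.assoc[symmetric])
    also have "\<dots> = sc k * (cross i (a * s) * t)" using that by (simp add: cross_mult_left[OF free_intros(3)] cross_mult_right)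
    also have "\<dots> = sc (- k) * (s * t) * cross i a"
      using that(2) by (simp add: that(3) sc_minus mult.assoc)
    finally show ?thesis .
  qed
  show ?thesis
    unfolding pair_def distrib_left cross_add distrib_right 1
    by (simp add: 2 cross_anti free_commute[OF c] ij)
qed

text \<open>The exchange of two sites.\<close>

definition perm :: "'i \<Rightarrow> 'i \<Rightarrow> 'a" where "perm i j = pair (1/2) (1/2) (-1/2) (1/2) i j"

lemma perm_sq: "i \<noteq> j \<Longrightarrow> perm i j * perm i j = 1"
  unfolding perm_def by (simp add: pair_mult) (simp add: pair_def)

lemma perm_swap: assumes ij: "i \<noteq> j"
  shows "perm i j * X i = X j * perm i j" "perm i j * Y i = Y j * perm i j" "perm i j * Z i = Z j * perm i j"
    "perm i j * X j = X i * perm i j" "perm i j * Y j = Y i * perm i j" "perm i j * Z j = Z i * perm i j"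
  unfolding perm_def pair_def by (simp_all add: pauli_simps swap[OF ij] sc_minus algebra_simps)

end

context pauli
begin

lemma cross_pair_left:
  assumes ij: "i \<noteq> j" and a: "free j a"
  shows "cross i (pair p q r s i j * a) = cross i a * pair p (- q) (- r) (- s) i j"
proof -
  have b: "free j (cross i a)" using a ij unfolding cross_def by (simp add: free_ptr_other)
  have "cross i (cross i a * pair p (- q) (- r) (- s) i j) = pair p q r s i j * cross i (cross i a)"
    using cross_pair[OF ij b, of p "- q" "- r" "- s"] by simp
  then show ?thesis by (metis cross_cross)
qed

lemma ptr_ptr: assumes "i \<noteq> j" shows "ptr i (ptr j a) = ptr j (ptr i a)"
  unfolding ptr_def by (simp add: pauli_simps algebra_simps swap[OF assms])

lemma ptr_pair_cyclic: assumes "i \<noteq> j"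
  shows "ptr j (ptr i (pair p q r s i j * a)) = ptr j (ptr i (a * pair p q r s i j))"
proof -
  have 1: "ptr j (ptr i ((S * T) * a)) = ptr j (ptr i (a * (S * T)))"
    if "S * T = T * S" "free i T" "\<And>b. ptr i (S * b) = ptr i (b * S)" "\<And>b. ptr j (T * b) = ptr j (b * T)" for S T
  proof -
    have "ptr j (ptr i ((S * T) * a)) = ptr j (ptr i (S * (T * a)))" by (simp add: mult.assoc)
    also have "\<dots> = ptr j (T * ptr i (a * S))" using that by (simp add: mult.assoc ptr_mult_left)
    also have "\<dots> = ptr j (ptr i (a * (S * T)))" using that by (simp add: ptr_mult_right[symmetric] mult.assoc)
    finally show ?thesis .
  qed
  have 3: "a * (sc c * S) = sc c * (a * S)" for c S by (rule sc_left')
  show ?thesis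
    unfolding pair_def distrib_left distrib_right ptr_add sc_central[of a] 3 mult.assoc[of "sc _"] ptr_sc
    using assms by (simp add: 1 swap[of i j] ptr_cyclic)
qed

text \<open>The linear map that multiplies the four Pauli components of site \<open>i\<close> by four given numbers. It is self-adjoint
  for the trace form (\<open>ptr_scaling\<close>).\<close>

definition scaling :: "complex \<Rightarrow> complex \<Rightarrow> complex \<Rightarrow> complex \<Rightarrow> 'i \<Rightarrow> 'a \<Rightarrow> 'a" where
  "scaling m0 mx my mz i a = sc ((m0 + mx + my + mz) / 4) * a + sc ((m0 + mx - my - mz) / 4) * (X i * a * X i)
     + sc ((mx - m0 - my + mz) / 4) * (Y i * a * Y i) + sc ((m0 - mx - my + mz) / 4) * (Z i * a * Z i)"

lemma scaling_add: "scaling m0 mx my mz i (a + b) = scaling m0 mx my mz i a + scaling m0 mx my mz i b"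
  and scaling_sc: "scaling m0 mx my mz i (sc c * a) = sc c * scaling m0 mx my mz i a"
  by (simp_all add: scaling_def distrib_left distrib_right mult.assoc sc_left add_ac mult.commute)

lemma scaling_pauli: assumes "free i f"
  shows "scaling m0 mx my mz i f = sc m0 * f" "scaling m0 mx my mz i (X i * f) = sc mx * (X i * f)"
    "scaling m0 mx my mz i (Y i * f) = sc my * (Y i * f)" "scaling m0 mx my mz i (Z i * f) = sc mz * (Z i * f)"
proof -
  have e: "m0 = (m0 + mx + my + mz) / 4 + (m0 + mx - my - mz) / 4 - (mx - m0 - my + mz) / 4 + (m0 - mx - my + mz) / 4"
    "mx = (m0 + mx + my + mz) / 4 + (m0 + mx - my - mz) / 4 + (mx - m0 - my + mz) / 4 - (m0 - mx - my + mz) / 4"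
    "my = (m0 + mx + my + mz) / 4 - (m0 + mx - my - mz) / 4 - (mx - m0 - my + mz) / 4 - (m0 - mx - my + mz) / 4"
    "mz = (m0 + mx + my + mz) / 4 - (m0 + mx - my - mz) / 4 + (mx - m0 - my + mz) / 4 + (m0 - mx - my + mz) / 4"
    by (simp_all add: field_simps)
  note f = free_commute[OF assms, symmetric] mult.assoc prods prods'
  have d: "sc (a + b) * c = sc a * c + sc b * c" "sc (a - b) * c = sc a * c - sc b * c" for a b c
    by (simp_all add: sc_add sc_diff distrib_right left_diff_distrib)
  show "scaling m0 mx my mz i f = sc m0 * f"
    unfolding scaling_def by (subst (5) e(1)) (simp only: d, simp add: f)
  show "scaling m0 mx my mz i (X i * f) = sc mx * (X i * f)"
    unfolding scaling_def by (subst (5) e(2)) (simp only: d, simp add: f)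
  show "scaling m0 mx my mz i (Y i * f) = sc my * (Y i * f)"
    unfolding scaling_def by (subst (5) e(3)) (simp only: d, simp add: f)
  show "scaling m0 mx my mz i (Z i * f) = sc mz * (Z i * f)"
    unfolding scaling_def by (subst (5) e(4)) (simp only: d, simp add: f)
qed

lemma ptr_scaling: "ptr i (b * scaling m0 mx my mz i a) = ptr i (scaling m0 mx my mz i b * a)"
proof -
  have 1: "ptr i (b * (S * a * S)) = ptr i (S * b * S * a)" if "\<And>b. ptr i (S * b) = ptr i (b * S)" for S
    using that[of "b * S * a"] by (simp add: mult.assoc)
  show ?thesis
    unfolding scaling_def distrib_left distrib_right ptr_add sc_left'[of b] mult.assoc[of "sc _"] ptr_sc
    by (simp only: 1 ptr_cyclic)
qed

text \<open>Every operator is a combination of \<open>1\<close>, \<open>X i\<close>, \<open>Y i\<close>, \<open>Z i\<close> with coefficients free of \<open>i\<close>.\<close>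

lemma decompose: "\<exists>a0 ax ay az. a = a0 + X i * ax + Y i * ay + Z i * az \<and>
    free i a0 \<and> free i ax \<and> free i ay \<and> free i az \<and>
    (\<forall>k. k \<noteq> i \<longrightarrow> free k a \<longrightarrow> free k a0 \<and> free k ax \<and> free k ay \<and> free k az)"
proof (intro exI conjI allI impI)
  have q: "sc (1/4) * a + sc (1/4) * a = sc (1/2) * a" "sc (1/4) * a + (sc (1/4) * a + b) = sc (1/2) * a + b" for a b
    by (simp_all add: add.assoc[symmetric] flip: distrib_right sc_add)
  show "a = sc (1/2) * ptr i a + X i * (sc (1/2) * ptr i (X i * a))
     + Y i * (- sc (1/2) * ptr i (Y i * a)) + Z i * (sc (1/2) * ptr i (Z i * a))"
    unfolding ptr_def by (simp add: pauli_simps algebra_simps q half)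
qed (auto intro!: free_intros free_ptr free_ptr_other)

end

text \<open>
  The induction step that dresses a solution of the reflection equation with one more site, reduced to its
  non-commutative algebra: \<open>p\<close>, \<open>q\<close> are the two copies of the solution, \<open>a\<close>, \<open>b\<close> the R-matrices between them, and
  \<open>r1\<close>, \<open>s1\<close>, \<open>r2\<close>, \<open>s2\<close> the R-matrices to the new site.
\<close>

lemma (in ring_1) dressing_algebra:
  assumes "a * r1 * r2 = r2 * r1 * a" "s1 * b * r2 = r2 * b * s1" "a * s1 * s2 = s2 * s1 * a" "r1 * b * s2 = s2 * b * r1"
    and "p * r2 = r2 * p" "p * s2 = s2 * p" "q * r1 = r1 * q" "q * s1 = s1 * q"
    and "a * p * b * q = q * b * p * a"
  shows "a * (r1 * p * s1) * b * (r2 * q * s2) = (r2 * q * s2) * b * (r1 * p * s1) * a"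
proof -
  note m = mult.assoc
  have t3: "x1 * x2 * x3 = z1 * z2 * z3 \<Longrightarrow> x1 * (x2 * (x3 * w)) = z1 * (z2 * (z3 * w))"
    and t2: "x1 * x2 = z1 * z2 \<Longrightarrow> x1 * (x2 * w) = z1 * (z2 * w)"
    and t4: "x1 * x2 * x3 * x4 = z1 * z2 * z3 * z4 \<Longrightarrow> x1 * (x2 * (x3 * (x4 * w))) = z1 * (z2 * (z3 * (z4 * w)))"
    for x1 x2 x3 x4 z1 z2 z3 z4 w :: 'a by (metis m)+
  have "a * (r1 * p * s1) * b * (r2 * q * s2) = a * (r1 * (p * (s1 * (b * (r2 * (q * s2))))))" by (simp only: m)
  also have "\<dots> = a * (r1 * (p * (r2 * (b * (s1 * (q * s2))))))" by (simp only: t3[OF assms(2)])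
  also have "\<dots> = a * (r1 * (r2 * (p * (b * (q * (s1 * s2))))))" by (simp only: t2[OF assms(5)] t2[OF assms(8), symmetric])
  also have "\<dots> = r2 * (r1 * (a * (p * (b * (q * (s1 * s2))))))" by (simp only: t3[OF assms(1)])
  also have "\<dots> = r2 * (r1 * (q * (b * (p * (a * (s1 * s2))))))" by (simp only: t4[OF assms(9)])
  also have "\<dots> = r2 * (r1 * (q * (b * (p * (s2 * (s1 * a))))))" using assms(3) by (simp only: m)
  also have "\<dots> = r2 * (q * (r1 * (b * (s2 * (p * (s1 * a))))))" by (simp only: t2[OF assms(6)] t2[OF assms(7)])
  also have "\<dots> = r2 * (q * (s2 * (b * (r1 * (p * (s1 * a))))))" by (simp only: t3[OF assms(4)])
  also have "\<dots> = (r2 * q * s2) * b * (r1 * p * s1) * a" by (simp only: m)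
  finally show ?thesis .
qed

text \<open>R-matrices and boundary matrices of an XYZ chain with inhomogeneities \<open>\<xi>\<close>.\<close>

locale xyz_chain = pauli sc X Z + xyz_weights t1 t2 t3 t4 A B y ic
  for sc :: "complex \<Rightarrow> 'a::ring_1" and X Z :: "'i \<Rightarrow> 'a" and t1 t2 t3 t4 A B :: "complex \<Rightarrow> complex" and y ic :: complex +
  fixes \<xi> :: "'i \<Rightarrow> complex"
begin

lemmas riem_lemmas = riem_x riem_y riem_z

definition R :: "complex \<Rightarrow> 'i \<Rightarrow> 'i \<Rightarrow> 'a" where
  "R u i j = pair (wo u) (wx u) (wy u) (wz u) i j"

definition K :: "complex \<Rightarrow> complex \<Rightarrow> complex \<Rightarrow> complex \<Rightarrow> 'i \<Rightarrow> 'a" where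
  "K p q r u i = single (ko u) (p * kx u) (q * ky u) (r * kz u) i"

lemma R_sym: "R u i j = R u j i" unfolding R_def by (rule pair_sym)

lemma free_R: "k \<noteq> i \<Longrightarrow> k \<noteq> j \<Longrightarrow> free k (R u i j)" unfolding R_def by (rule free_pair)
lemma free_K: "k \<noteq> i \<Longrightarrow> free k (K p q r u i)" unfolding K_def by (rule free_single)

lemma R_YBE:
  assumes "i \<noteq> j" "i \<noteq> k" "j \<noteq> k"
  shows "R (u - v) i j * R u i k * R v j k = R v j k * R u i k * R (u - v) i j"
  unfolding R_def by (rule YBE_general[OF assms ybe])

text \<open>\<open>rho\<close> is the scalar of the unitarity relation.\<close>

definition sg :: "complex \<Rightarrow> complex" where "sg u = wo u - wx u + wy u - wz u"
definition rho :: "complex \<Rightarrow> complex" where "rho u = sg u * sg (- u)"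

lemma rho_minus: "rho (- u) = rho u" by (simp add: rho_def)

lemma R_unitary: assumes ij: "i \<noteq> j" shows "R u i j * R (- u) i j = sc (rho u)"
proof -
  have e: "wo u * wx (- u) + wx u * wo (- u) + wy u * wz (- u) + wz u * wy (- u) = 0"
    "wo u * wy (- u) + wy u * wo (- u) + wz u * wx (- u) + wx u * wz (- u) = 0"
    "wo u * wz (- u) + wz u * wo (- u) + wx u * wy (- u) + wy u * wx (- u) = 0"
    using riem_x(1)[of 0 "- u"] riem_y(1)[of 0 "- u"] riem_z(1)[of 0 "- u"] by simp_all
  have "rho u = wo u * wo (- u) + wx u * wx (- u) + wy u * wy (- u) + wz u * wz (- u)
     - (wo u * wx (- u) + wx u * wo (- u) + wy u * wz (- u) + wz u * wy (- u))
     + (wo u * wy (- u) + wy u * wo (- u) + wz u * wx (- u) + wx u * wz (- u))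
     - (wo u * wz (- u) + wz u * wo (- u) + wx u * wy (- u) + wy u * wx (- u))"
    by (simp add: rho_def sg_def algebra_simps)
  then have r: "rho u = wo u * wo (- u) + wx u * wx (- u) + wy u * wy (- u) + wz u * wz (- u)"
    unfolding e by simp
  show ?thesis unfolding R_def pair_mult[OF ij] r using e
    by (simp add: pair_def add_ac)
qed

lemma weights_cross: "wo (- u - 2 * y) = - wo u" "wx (- u - 2 * y) = wx u" "wy (- u - 2 * y) = wy u" "wz (- u - 2 * y) = wz u"
proof -
  have e: "- u - 2 * y + y = - (u + y)" by simp
  then show "wo (- u - 2 * y) = - wo u" "wx (- u - 2 * y) = wx u" "wy (- u - 2 * y) = wy u" "wz (- u - 2 * y) = wz u"
    unfolding w_defs e t1_odd t2_even t3_even t4_even by simp_all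
qed

lemma pair_minus: "- pair a b c d i j = pair (- a) (- b) (- c) (- d) i j" by (simp add: pair_def sc_minus)

lemma cross_R: "i \<noteq> j \<Longrightarrow> free j a \<Longrightarrow> cross i (a * R u i j) = - R (- u - 2 * y) i j * cross i a"
  unfolding R_def weights_cross pair_minus by (simp add: cross_pair)

lemma cross_R_left: "i \<noteq> j \<Longrightarrow> free j a \<Longrightarrow> cross i (R u i j * a) = cross i a * - R (- u - 2 * y) i j"
  unfolding R_def weights_cross pair_minus by (simp add: cross_pair_left)

lemma K_reflection: assumes ij: "i \<noteq> j"
  shows "R (u - v) i j * K p q r u i * R (u + v) i j * K p q r v j
    = K p q r v j * R (u + v) i j * K p q r u i * R (u - v) i j"
  unfolding R_def K_def
  by (rule reflection_general[OF ij]; unfold riem_lemmas k_defs; simp add: algebra_simps)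

end

section \<open>Dressed boundary operators\<close>

lemma (in semigroup_mult) intertwine_mult: "p * s = s' * p \<Longrightarrow> p * t = t' * p \<Longrightarrow> p * (s * t) = (s' * t') * p"
proof -
  assume a: "p * s = s' * p" and b: "p * t = t' * p"
  have "p * (s * t) = (p * s) * t" by (simp only: mult.assoc)
  also have "\<dots> = s' * (p * t)" by (simp only: a mult.assoc)
  also have "\<dots> = (s' * t') * p" by (simp only: b mult.assoc)
  finally show ?thesis .
qed

context xyz_chain
begin

text \<open>The boundary operator \<open>a\<close> on site \<open>i\<close>, multiplied on both sides by the R-matrices to the sites of the list \<open>L\<close>.\<close>

definition dress :: "'i list \<Rightarrow> complex \<Rightarrow> 'i \<Rightarrow> 'a \<Rightarrow> 'a" where
  "dress L v i a = foldr (\<lambda>n b. R (v - \<xi> n) i n * b * R (v + \<xi> n) i n) L a"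

lemma dress_simps [simp]: "dress [] v i a = a"
  "dress (n # L) v i a = R (v - \<xi> n) i n * dress L v i a * R (v + \<xi> n) i n"
  by (simp_all add: dress_def)

lemma dress_append: "dress (L @ L') v i a = dress L v i (dress L' v i a)"
  by (simp add: dress_def)

lemma free_dress: "k \<noteq> i \<Longrightarrow> k \<notin> set L \<Longrightarrow> free k a \<Longrightarrow> free k (dress L v i a)"
  by (induction L) (auto simp: free_R)

lemma R_commute_free: "free i a \<Longrightarrow> free j a \<Longrightarrow> R u i j * a = a * R u i j"
  unfolding R_def by (rule pair_commute_free)

lemma R_YBE': assumes "i \<noteq> j" "i \<noteq> k" "j \<noteq> k"
  shows "R u i k * R (u + v) i j * R v j k = R v j k * R (u + v) i j * R u i k"
  using R_YBE[of i k j "u + v" v] assms R_sym[of v k j] by simp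

lemma dress_reflection:
  assumes ij: "i \<noteq> j"
    and a: "R (u - v) i j * a * R (u + v) i j * b = b * R (u + v) i j * a * R (u - v) i j"
    and fa: "\<And>k. k \<noteq> i \<Longrightarrow> free k a" and fb: "\<And>k. k \<noteq> j \<Longrightarrow> free k b"
    and L: "distinct L" "i \<notin> set L" "j \<notin> set L"
  shows "R (u - v) i j * dress L u i a * R (u + v) i j * dress L v j b
    = dress L v j b * R (u + v) i j * dress L u i a * R (u - v) i j"
  using L
proof (induction L)
  case Nil then show ?case using a by simp
next
  case (Cons n L)
  then have n: "i \<noteq> n" "j \<noteq> n" "n \<notin> set L" "i \<notin> set L" "j \<notin> set L" "distinct L" by auto
  have fi: "free j (dress L u i a)" "free n (dress L u i a)" "free i (dress L v j b)" "free n (dress L v j b)"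
    using n ij fa fb by (auto intro!: free_dress)
  show ?case
    unfolding dress_simps
  proof (rule dressing_algebra)
    show "R (u - v) i j * R (u - \<xi> n) i n * R (v - \<xi> n) j n = R (v - \<xi> n) j n * R (u - \<xi> n) i n * R (u - v) i j"
      using R_YBE[of i j n "u - \<xi> n" "v - \<xi> n"] ij n by simp
    show "R (u - v) i j * R (u + \<xi> n) i n * R (v + \<xi> n) j n = R (v + \<xi> n) j n * R (u + \<xi> n) i n * R (u - v) i j"
      using R_YBE[of i j n "u + \<xi> n" "v + \<xi> n"] ij n by simp
    show "R (u + \<xi> n) i n * R (u + v) i j * R (v - \<xi> n) j n = R (v - \<xi> n) j n * R (u + v) i j * R (u + \<xi> n) i n"
      using R_YBE'[of i j n "u + \<xi> n" "v - \<xi> n"] ij n by simp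
    show "R (u - \<xi> n) i n * R (u + v) i j * R (v + \<xi> n) j n = R (v + \<xi> n) j n * R (u + v) i j * R (u - \<xi> n) i n"
      using R_YBE'[of i j n "u - \<xi> n" "v + \<xi> n"] ij n by simp
  qed (use fi n Cons.IH in \<open>simp_all add: R_commute_free\<close>)
qed

lemma dress_perm:
  assumes "i \<noteq> j" "i \<notin> set L" "j \<notin> set L" "perm i j * a = b * perm i j"
  shows "perm i j * dress L v i a = dress L v j b * perm i j"
  using assms(2-)
proof (induction L)
  case (Cons n L)
  have R: "perm i j * R u i n = R u j n * perm i j" for u
  proof -
    have c: "perm i j * X n = X n * perm i j" "perm i j * Y n = Y n * perm i j" "perm i j * Z n = Z n * perm i j"
      unfolding perm_def using Cons.prems assms(1) by (auto intro!: pair_commute_free)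
    note t = intertwine_mult[OF perm_swap(1)[OF assms(1)] c(1)] intertwine_mult[OF perm_swap(2)[OF assms(1)] c(2)]
      intertwine_mult[OF perm_swap(3)[OF assms(1)] c(3)]
    show ?thesis unfolding R_def pair_def
      by (simp only: distrib_left distrib_right sc_left' t sc_central[of "perm i j"] mult.assoc[of "sc _"])
  qed
  show ?case using Cons unfolding dress_simps by (intro intertwine_mult R) auto
qed simp

lemma perm_K: assumes "i \<noteq> j" shows "perm i j * K p q r u i = K p q r u j * perm i j"
  unfolding K_def single_def
  by (simp only: distrib_left distrib_right sc_left' perm_swap[OF assms] sc_central[of "perm i j"] mult.assoc[of "sc _"])

lemma dress_trace_indep:
  assumes ij: "i \<noteq> j" and L: "i \<notin> set L" "j \<notin> set L"
  shows "ptr i (K p q r u i * dress L v i (K p' q' r' w i)) = ptr j (K p q r u j * dress L v j (K p' q' r' w j))"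
proof -
  let ?a = "K p q r u i * dress L v i (K p' q' r' w i)" and ?b = "K p q r u j * dress L v j (K p' q' r' w j)"
  have ab: "perm i j * ?a = ?b * perm i j"
    by (intro intertwine_mult perm_K[OF ij] dress_perm[OF ij L])
  have tr: "perm i j * ptr i ?a = ptr j ?b * perm i j"
  proof -
    have t: "perm i j * (S * ?a * S) = (T * ?b * T) * perm i j" if "perm i j * S = T * perm i j" for S T
      by (intro intertwine_mult that ab)
    show ?thesis unfolding ptr_def
      by (simp only: sc_left' distrib_left right_diff_distrib left_diff_distrib distrib_right ab mult.assoc[of "sc _"] t[OF perm_swap(1)[OF ij]] t[OF perm_swap(2)[OF ij]] t[OF perm_swap(3)[OF ij]])
  qed
  have "free j ?a" using ij L by (auto intro!: free_intros(7) free_dress free_K)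
  then have "perm i j * ptr i ?a = ptr i ?a * perm i j"
    unfolding perm_def using free_ptr free_ptr_other[OF ij[symmetric]] by (auto intro!: pair_commute_free)
  with tr have "ptr i ?a * perm i j * perm i j = ptr j ?b * perm i j * perm i j" by simp
  then show ?thesis using perm_sq[OF ij] by (simp add: mult.assoc)
qed

end

section \<open>Commuting transfer matrices\<close>

text \<open>An open chain with the boundary constants \<open>cp\<close> and \<open>cm\<close> of its two ends.\<close>

locale open_chain = xyz_chain sc X Z t1 t2 t3 t4 A B y ic \<xi>
  for sc :: "complex \<Rightarrow> 'a::ring_1" and X Z :: "'i \<Rightarrow> 'a" and t1 t2 t3 t4 A B :: "complex \<Rightarrow> complex"
    and y ic :: complex and \<xi> :: "'i \<Rightarrow> complex" +
  fixes cp cm :: "complex \<times> complex \<times> complex"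
begin

text \<open>
  \<open>tm L v i\<close> is the transfer matrix of the chain with sites \<open>L\<close>, built with the auxiliary site \<open>i\<close>. Its argument is
  the spectral parameter shifted by \<open>- y\<close>.
\<close>

definition Kp :: "complex \<Rightarrow> 'i \<Rightarrow> 'a" where "Kp u i = K (fst cp) (fst (snd cp)) (snd (snd cp)) u i"
definition Km :: "complex \<Rightarrow> 'i \<Rightarrow> 'a" where "Km u i = K (fst cm) (fst (snd cm)) (snd (snd cm)) u i"
definition U :: "'i list \<Rightarrow> complex \<Rightarrow> 'i \<Rightarrow> 'a" where "U L v i = dress L v i (Km v i)"
definition tm :: "'i list \<Rightarrow> complex \<Rightarrow> 'i \<Rightarrow> 'a" where "tm L v i = ptr i (Kp (v + 2 * y) i * U L v i)"

lemma free_Kp: "k \<noteq> i \<Longrightarrow> free k (Kp u i)" and free_Km: "k \<noteq> i \<Longrightarrow> free k (Km u i)"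
  unfolding Kp_def Km_def by (simp_all add: free_K)

lemma free_U: "k \<noteq> i \<Longrightarrow> k \<notin> set L \<Longrightarrow> free k (U L v i)"
  unfolding U_def by (intro free_dress free_Km)

lemma tm_indep: "i \<noteq> j \<Longrightarrow> i \<notin> set L \<Longrightarrow> j \<notin> set L \<Longrightarrow> tm L v i = tm L v j"
  unfolding tm_def U_def Kp_def Km_def by (rule dress_trace_indep)

lemma U_reflection:
  assumes "i \<noteq> j" "distinct L" "i \<notin> set L" "j \<notin> set L"
  shows "R (u - v) i j * U L u i * R (u + v) i j * U L v j = U L v j * R (u + v) i j * U L u i * R (u - v) i j"
  unfolding U_def
  by (rule dress_reflection) (use assms in \<open>auto simp: Km_def K_reflection free_K\<close>)

lemma K_minus: "K p q r (- u) i = K (- p) (- q) (- r) u i"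
  by (simp add: K_def k_defs)

lemma Kp_dual_reflection: assumes "i \<noteq> j"
  shows "R (v - u) i j * Kp (u + 2 * y) i * R (- u - v - 4 * y) i j * Kp (v + 2 * y) j
    = Kp (v + 2 * y) j * R (- u - v - 4 * y) i j * Kp (u + 2 * y) i * R (v - u) i j"
proof -
  have a: "- u - 2 * y - (- v - 2 * y) = v - u" "- u - 2 * y + (- v - 2 * y) = - u - v - 4 * y"
    "u + 2 * y = - (- u - 2 * y)" "v + 2 * y = - (- v - 2 * y)" by simp_all
  show ?thesis
    unfolding Kp_def a(3,4) K_minus
    using K_reflection[OF assms, of "- u - 2 * y" "- v - 2 * y", unfolded a(1,2)] .
qed

text \<open>Crossing turns the product of two transfer matrices into a joint trace in which the R-matrices of the
  reflection equation and of its dual appear.\<close>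

lemma tm_product:
  assumes ij: "i \<noteq> j" and L: "i \<notin> set L" "j \<notin> set L"
  shows "sc (rho (u + v + 2 * y)) * (tm L u i * tm L v j)
    = ptr j (ptr i (Kp (v + 2 * y) j * R (- u - v - 4 * y) i j * Kp (u + 2 * y) i
        * (U L u i * R (u + v) i j * U L v j)))"
proof -
  let ?a = "Kp (u + 2 * y) i" and ?b = "Kp (v + 2 * y) j" and ?g = "R (u + v + 2 * y) i j"
    and ?g' = "R (- u - v - 2 * y) i j" and ?h = "R (- u - v - 4 * y) i j"
  let ?p = "U L u i" and ?q = "U L v j"
  have f: "free i ?b" "free j ?a" "free j ?p" "free i ?q" using ij L by (auto intro: free_Kp free_U)
  have pb: "?p * ?b = ?b * ?p" unfolding Kp_def K_def using f by (intro single_commute_free[symmetric]) auto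
  have "tm L u i * tm L v j = ptr i (?a * ?p * ptr j (?b * ?q))"
    unfolding tm_def using ij f by (simp add: ptr_mult_right free_ptr_other)
  also have "\<dots> = ptr j (ptr i (?a * ?p * (?b * ?q)))"
    using f by (simp add: ptr_mult_left[symmetric] ptr_ptr[OF ij])
  also have "?a * ?p * (?b * ?q) = (?a * ?b) * (?p * ?q)"
    by (simp only: mult.assoc) (simp only: pb mult.assoc[symmetric])
  also have "ptr i \<dots> = ptr i (cross i ?a * ?b * (cross i ?p * ?q))"
    using f by (simp add: ptr_cross_cross[of i "?a * ?b", symmetric] cross_mult_right)
  finally have 1: "tm L u i * tm L v j = ptr j (ptr i (cross i ?a * ?b * (cross i ?p * ?q)))" .
  have rg: "?g * ?g' = sc (rho (u + v + 2 * y))"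
    using R_unitary[OF ij, of "u + v + 2 * y"] by (simp add: algebra_simps)
  have 2: "?g' * cross i ?p = - cross i (?p * R (u + v) i j)"
    using cross_R[OF ij f(3), of "u + v"] by simp
  have cb: "cross i ?a * ?b = ?b * cross i ?a"
    unfolding Kp_def[of _ j] K_def using f
    by (intro single_commute_free[symmetric]) (auto simp: cross_def free_ptr_other ij[symmetric])
  have 3: "cross i ?a * ?g = - cross i (?h * ?a)"
    using cross_R_left[OF ij f(2), of "- u - v - 4 * y"] by (simp add: algebra_simps)
  have "sc (rho (u + v + 2 * y)) * (cross i ?a * ?b * (cross i ?p * ?q))
      = cross i ?a * ?b * (?g * ?g') * (cross i ?p * ?q)"
    unfolding rg by (simp only: mult.assoc sc_left')
  also have "\<dots> = ?b * (cross i ?a * ?g) * (?g' * cross i ?p) * ?q" by (simp only: cb mult.assoc)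
  also have "\<dots> = cross i (?b * ?h * ?a) * cross i (?p * R (u + v) i j * ?q)"
  proof -
    have "cross i (?b * ?h * ?a) = ?b * cross i (?h * ?a)"
      unfolding mult.assoc[of ?b] by (rule cross_mult_left[OF f(1)])
    moreover have "cross i (?p * R (u + v) i j * ?q) = cross i (?p * R (u + v) i j) * ?q"
      by (rule cross_mult_right[OF f(4)])
    ultimately show ?thesis unfolding 2 3 by (simp only: mult.assoc minus_mult_minus mult_minus_left mult_minus_right minus_minus)
  qed
  finally have 4: "sc (rho (u + v + 2 * y)) * (cross i ?a * ?b * (cross i ?p * ?q)) = \<dots>" .
  have "sc (rho (u + v + 2 * y)) * (tm L u i * tm L v j)
      = ptr j (ptr i (sc (rho (u + v + 2 * y)) * (cross i ?a * ?b * (cross i ?p * ?q))))"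
    unfolding 1 by (simp add: ptr_sc)
  then show ?thesis unfolding 4 by (simp add: ptr_cross_cross)
qed

text \<open>Sklyanin's argument. The scalar factor is removed later, by analyticity in \<open>u\<close>.\<close>

theorem tm_commute:
  assumes ij: "i \<noteq> j" and L: "distinct L" "i \<notin> set L" "j \<notin> set L"
  shows "sc (rho (u - v) * rho (u + v + 2 * y)) * (tm L u i * tm L v i - tm L v i * tm L u i) = 0"
proof -
  let ?a = "Kp (u + 2 * y) i" and ?b = "Kp (v + 2 * y) j" and ?h = "R (- u - v - 4 * y) i j"
    and ?m = "R (u - v) i j" and ?m' = "R (v - u) i j" and ?r = "R (u + v) i j"
  let ?p = "U L u i" and ?q = "U L v j"
  have r: "?m' * ?m = sc (rho (u - v))" "?m * ?m' = sc (rho (u - v))"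
    using R_unitary[OF ij, of "v - u"] R_unitary[OF ij, of "u - v"] rho_minus[of "u - v"] by simp_all
  have cyc: "ptr j (ptr i (?m * M)) = ptr j (ptr i (M * ?m))" for M
    unfolding R_def by (rule ptr_pair_cyclic[OF ij])
  have "sc (rho (u - v)) * ptr j (ptr i (?b * ?h * ?a * (?p * ?r * ?q)))
      = ptr j (ptr i ((?b * ?h * ?a * ?m') * (?m * ?p * ?r * ?q)))"
  proof -
    have "(?b * ?h * ?a * ?m') * (?m * ?p * ?r * ?q) = ?b * ?h * ?a * (?m' * ?m) * (?p * ?r * ?q)"
      by (simp only: mult.assoc)
    also have "\<dots> = sc (rho (u - v)) * (?b * ?h * ?a * (?p * ?r * ?q))"
      unfolding r by (simp only: mult.assoc sc_left')
    finally show ?thesis by (simp add: ptr_sc)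
  qed
  also have "(?b * ?h * ?a * ?m') * (?m * ?p * ?r * ?q) = (?m' * ?a * ?h * ?b * ?q * ?r * ?p) * ?m"
    unfolding U_reflection[OF ij L] Kp_dual_reflection[OF ij, symmetric] by (simp only: mult.assoc)
  also have "ptr j (ptr i \<dots>) = ptr j (ptr i (?m * (?m' * ?a * ?h * ?b * ?q * ?r * ?p)))" by (simp only: cyc)
  also have "?m * (?m' * ?a * ?h * ?b * ?q * ?r * ?p) = (?m * ?m') * (?a * ?h * ?b * (?q * ?r * ?p))"
    by (simp only: mult.assoc)
  also have "ptr j (ptr i \<dots>) = sc (rho (u - v)) * ptr i (ptr j (?a * ?h * ?b * (?q * ?r * ?p)))"
    unfolding r by (simp add: ptr_sc ptr_ptr[OF ij])
  finally have 1: "sc (rho (u - v)) * ptr j (ptr i (?b * ?h * ?a * (?p * ?r * ?q)))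
      = sc (rho (u - v)) * ptr i (ptr j (?a * ?h * ?b * (?q * ?r * ?p)))" .
  have 2: "sc (rho (u + v + 2 * y)) * (tm L v j * tm L u i) = ptr i (ptr j (?a * ?h * ?b * (?q * ?r * ?p)))"
  proof -
    have e: "v + u + 2 * y = u + v + 2 * y" "- v - u - 4 * y = - u - v - 4 * y" "v + u = u + v" by simp_all
    show ?thesis using tm_product[OF ij[symmetric] L(3,2), of v u] unfolding e R_sym[of _ j i] .
  qed
  have "sc (rho (u - v)) * (sc (rho (u + v + 2 * y)) * (tm L u i * tm L v j))
      = sc (rho (u - v)) * (sc (rho (u + v + 2 * y)) * (tm L v j * tm L u i))"
    unfolding 2 tm_product[OF ij L(2,3)] by (rule 1)
  then show ?thesis
    unfolding tm_indep[OF ij[symmetric] L(3,2)] by (simp add: sc_mult right_diff_distrib mult.assoc)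
qed

end

section \<open>Evenness of the transfer matrix\<close>

context pauli
begin

lemma scaling_minus: "scaling m0 mx my mz i (- a) = - scaling m0 mx my mz i a"
  using scaling_sc[of m0 mx my mz i "- 1" a] by (simp add: sc_minus)

lemma scaling_diff: "scaling m0 mx my mz i (a - b) = scaling m0 mx my mz i a - scaling m0 mx my mz i b"
  using scaling_add[of m0 mx my mz i a "- b"] by (simp add: scaling_minus)

text \<open>
  Conjugation by two R-matrices, followed by a scaling, equals the scaling followed by conjugation with the crossed
  R-matrices in exchanged order, provided six bilinear relations hold. It suffices to check this on the four
  Pauli components.
\<close>

lemma scaling_dress_general:
  assumes n: "i \<noteq> n" and fa: "free n a"
    and e: "m0 * (uo * vx + ux * vo - uy * vz - uz * vy) + mx * (uo * vx + ux * vo + uy * vz + uz * vy) = 0"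
      "m0 * (uo * vy + uy * vo - uz * vx - ux * vz) + my * (uo * vy + uy * vo + uz * vx + ux * vz) = 0"
      "m0 * (uo * vz + uz * vo - ux * vy - uy * vx) + mz * (uo * vz + uz * vo + ux * vy + uy * vx) = 0"
      "my * (uo * vx - ux * vo - uy * vz + uz * vy) - mz * (uo * vx - ux * vo + uy * vz - uz * vy) = 0"
      "mx * (uo * vy - uy * vo + uz * vx - ux * vz) - mz * (uo * vy - uy * vo - uz * vx + ux * vz) = 0"
      "mx * (uo * vz - uz * vo - ux * vy + uy * vx) - my * (uo * vz - uz * vo + ux * vy - uy * vx) = 0"
  shows "scaling m0 mx my mz i (pair uo ux uy uz i n * a * pair vo vx vy vz i n)
     = pair vo (- vx) (- vy) (- vz) i n * scaling m0 mx my mz i a * pair uo (- ux) (- uy) (- uz) i n"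
proof -
  let ?L = "\<lambda>a. pair vo (- vx) (- vy) (- vz) i n * scaling m0 mx my mz i a * pair uo (- ux) (- uy) (- uz) i n"
    and ?R = "\<lambda>a. scaling m0 mx my mz i (pair uo ux uy uz i n * a * pair vo vx vy vz i n)"
  have *: "?L f = ?R f" "?L (X i * f) = ?R (X i * f)" "?L (Y i * f) = ?R (Y i * f)" "?L (Z i * f) = ?R (Z i * f)"
    if f: "free i f" "free n f" for f
  proof -
    note c = free_commute[OF f(1), symmetric] free_commute[OF f(2), symmetric] free_commute'[OF f(1), symmetric]
      free_commute'[OF f(2), symmetric] sc_central[of f] sc_left'[of f]
    note simps = pauli_simps c n f scaling_add scaling_diff scaling_minus scaling_sc scaling_pauli swap[OF n] sc_diff sc_add sc_minus algebra_simps
    have "?L f - ?R f = 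
       - sc (m0 * (uo * vx + ux * vo - uy * vz - uz * vy) + mx * (uo * vx + ux * vo + uy * vz + uz * vy)) * (X i * (X n * f))
       - sc (m0 * (uo * vy + uy * vo - uz * vx - ux * vz) + my * (uo * vy + uy * vo + uz * vx + ux * vz)) * (Y i * (Y n * f))
       - sc (m0 * (uo * vz + uz * vo - ux * vy - uy * vx) + mz * (uo * vz + uz * vo + ux * vy + uy * vx)) * (Z i * (Z n * f))"
      unfolding pair_def by (simp add: simps)
    then show "?L f = ?R f" unfolding e by simp
    have "?L (X i * f) - ?R (X i * f) = 
       - sc (m0 * (uo * vx + ux * vo - uy * vz - uz * vy) + mx * (uo * vx + ux * vo + uy * vz + uz * vy)) * (X n * f)
       - sc (mx * (uo * vz - uz * vo - ux * vy + uy * vx) - my * (uo * vz - uz * vo + ux * vy - uy * vx)) * (Y i * (Z n * f))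
       - sc (mx * (uo * vy - uy * vo + uz * vx - ux * vz) - mz * (uo * vy - uy * vo - uz * vx + ux * vz)) * (Z i * (Y n * f))"
      unfolding pair_def by (simp add: simps)
    then show "?L (X i * f) = ?R (X i * f)" unfolding e by simp
    have "?L (Y i * f) - ?R (Y i * f) = 
         sc (m0 * (uo * vy + uy * vo - uz * vx - ux * vz) + my * (uo * vy + uy * vo + uz * vx + ux * vz)) * (Y n * f)
       + sc (mx * (uo * vz - uz * vo - ux * vy + uy * vx) - my * (uo * vz - uz * vo + ux * vy - uy * vx)) * (X i * (Z n * f))
       + sc (my * (uo * vx - ux * vo - uy * vz + uz * vy) - mz * (uo * vx - ux * vo + uy * vz - uz * vy)) * (Z i * (X n * f))"
      unfolding pair_def by (simp add: simps)
    then show "?L (Y i * f) = ?R (Y i * f)" unfolding e by simp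
    have "?L (Z i * f) - ?R (Z i * f) = 
       - sc (m0 * (uo * vz + uz * vo - ux * vy - uy * vx) + mz * (uo * vz + uz * vo + ux * vy + uy * vx)) * (Z n * f)
       - sc (mx * (uo * vy - uy * vo + uz * vx - ux * vz) - mz * (uo * vy - uy * vo - uz * vx + ux * vz)) * (X i * (Y n * f))
       - sc (my * (uo * vx - ux * vo - uy * vz + uz * vy) - mz * (uo * vx - ux * vo + uy * vz - uz * vy)) * (Y i * (X n * f))"
      unfolding pair_def by (simp add: simps)
    then show "?L (Z i * f) = ?R (Z i * f)" unfolding e by simp
  qed
  obtain a0 ax ay az where a: "a = a0 + X i * ax + Y i * ay + Z i * az"
    and fr: "free i a0" "free i ax" "free i ay" "free i az" "free n a0" "free n ax" "free n ay" "free n az"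
    using decompose[of a i] fa n by metis
  show ?thesis
    unfolding a scaling_add distrib_left distrib_right using *[OF fr(1,5)] *[OF fr(2,6)] *[OF fr(3,7)] *[OF fr(4,8)] by simp
qed

end

context xyz_chain
begin

text \<open>The scaling that maps the dressed boundary matrix at \<open>v\<close> to the one at the crossed point \<open>- v - 2 * y\<close>, up to the
  factor \<open>bnorm v\<close>.\<close>

definition bscale :: "complex \<Rightarrow> 'i \<Rightarrow> 'a \<Rightarrow> 'a" where
  "bscale v = scaling (- t1 v * ko (v + 2 * y)) (t4 v * kx (v + 2 * y)) (t3 v * ky (v + 2 * y)) (t2 v * kz (v + 2 * y))"

definition bnorm :: "complex \<Rightarrow> complex" where "bnorm v = - ic * (t1 v * t2 v * t3 v * t4 v)"

lemma R_crossed: "R (- u - 2 * y) i j = - pair (wo u) (- wx u) (- wy u) (- wz u) i j"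
  unfolding R_def weights_cross pair_minus by simp

lemma bscale_dress1: assumes n: "i \<noteq> n" "free n a"
  shows "bscale v i (R (v - s) i n * a * R (v + s) i n) = R (- v - 2 * y - s) i n * bscale v i a * R (- v - 2 * y + s) i n"
proof -
  have 1: "- v - 2 * y - s = - (v + s) - 2 * y" "- v - 2 * y + s = - (v - s) - 2 * y" by simp_all
  show ?thesis
    unfolding 1 R_crossed unfolding R_def bscale_def
    by (subst scaling_dress_general[OF n]; (unfold riem_lemmas k_defs)?; simp add: algebra_simps)
qed

lemma bscale_dress:
  assumes "bscale v i a = sc c * b" "i \<notin> set L" "distinct L" "\<And>k. k \<noteq> i \<Longrightarrow> free k a"
  shows "bscale v i (dress L v i a) = sc c * dress L (- v - 2 * y) i b"
  using assms(2,3)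
proof (induction L)
  case Nil then show ?case using assms by simp
next
  case (Cons n L)
  then have "free n (dress L v i a)" using assms(4) by (auto intro: free_dress)
  then show ?case using Cons unfolding dress_simps
    by (subst bscale_dress1) (auto simp: mult.assoc sc_left')
qed

lemma K_reflect: "ko (- v) = ko v" "kx (- v) = - kx v" "ky (- v) = - ky v" "kz (- v) = - kz v"
  by (simp_all add: k_defs)

lemma scaling_single: "scaling m0 mx my mz i (single a b c d i) = single (m0 * a) (mx * b) (my * c) (mz * d) i"
  using scaling_pauli[of i 1 m0 mx my mz] scaling_pauli(1)[of i "sc a" m0 mx my mz]
  by (simp add: single_def scaling_add scaling_sc sc_left mult.commute)

lemma single_cong: "a = a' \<Longrightarrow> b = b' \<Longrightarrow> c = c' \<Longrightarrow> d = d' \<Longrightarrow> single a b c d i = single a' b' c' d' i"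
  by simp

lemma bscale_K: "bscale v i (K p q r v i) = sc (bnorm v) * K p q r (- v - 2 * y) i"
proof -
  have e: "- v - 2 * y = - (v + 2 * y)" by simp
  show ?thesis unfolding bscale_def K_def scaling_single sc_single e K_reflect
    by (rule single_cong) (simp_all add: k_defs bnorm_def mult_ac)
qed

end

section \<open>Special values of the transfer matrix\<close>

context xyz_chain
begin

lemma bscale_K': "bscale v i (K p q r (- v) i) = sc (bnorm v) * K p q r (v + 2 * y) i"
  unfolding bscale_def K_def scaling_single sc_single K_reflect
  by (rule single_cong) (simp_all add: k_defs bnorm_def mult_ac)

lemma ptr_single: "ptr i (single a b c d i) = sc (2 * a)" "ptr i (single a b c d i * X i) = sc (2 * b)"
    "ptr i (single a b c d i * Y i) = sc (- 2 * c)" "ptr i (single a b c d i * Z i) = sc (2 * d)"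
  by (simp_all add: single_def ptr_add ptr_diff ptr_minus ptr_sc ptr_traceless ptr_free distrib_right left_diff_distrib
      sc_left prods mult.assoc mult.commute sc_minus)

lemmas sc_R = sc_left'[of "R u i j" for u i j] sc_central[of "R u i j" for u i j] sc_left(7,8)

text \<open>If \<open>S\<close> carries \<open>R (u + 2 * v)\<close> to a multiple of \<open>R u\<close>, the R-matrices on its two sides cancel by unitarity.\<close>

lemma dress_central:
  assumes L: "i \<notin> set L"
    and S: "\<And>u n. n \<in> set L \<Longrightarrow> S * R (u + 2 * v) i n = sc (c u) * (R u i n * S)"
  shows "\<exists>s. dress L v i S = sc s * S"
  using assms
proof (induction L)
  case Nil then show ?case by (auto intro: exI[of _ 1])
next
  case (Cons n L)
  then obtain s where s: "dress L v i S = sc s * S" by auto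
  have 1: "S * R (v + \<xi> n) i n = sc (c (\<xi> n - v)) * (R (\<xi> n - v) i n * S)"
    using Cons.prems(2)[of n "\<xi> n - v"] by simp
  have 2: "R (v - \<xi> n) i n * R (\<xi> n - v) i n = sc (rho (v - \<xi> n))"
    using R_unitary[of i n "v - \<xi> n"] Cons.prems by simp
  have "dress (n # L) v i S = sc s * (R (v - \<xi> n) i n * (S * R (v + \<xi> n) i n))"
    by (simp add: s mult.assoc sc_R)
  also have "\<dots> = sc s * (sc (c (\<xi> n - v)) * (R (v - \<xi> n) i n * R (\<xi> n - v) i n * S))"
    unfolding 1 by (simp add: mult.assoc sc_R)
  also have "\<dots> = sc (s * c (\<xi> n - v) * rho (v - \<xi> n)) * S"
    unfolding 2 by (simp add: sc_R mult.assoc)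
  finally show ?case by blast
qed

lemma dress_inverse:
  assumes "a * b = sc s" "i \<notin> set L"
  shows "\<exists>s. dress L (- v) i a * dress L v i b = sc s"
  using assms(2)
proof (induction L)
  case Nil then show ?case using assms by auto
next
  case (Cons n L)
  then obtain s where s: "dress L (- v) i a * dress L v i b = sc s" by auto
  have r: "R (- v + \<xi> n) i n * R (v - \<xi> n) i n = sc (rho (v - \<xi> n))" "R (- v - \<xi> n) i n * R (v + \<xi> n) i n = sc (rho (v + \<xi> n))"
    using R_unitary[of i n "- v + \<xi> n"] R_unitary[of i n "- v - \<xi> n"] rho_minus[of "v - \<xi> n"] rho_minus[of "v + \<xi> n"] Cons.prems
    by (simp_all add: add.commute)
  have "dress (n # L) (- v) i a * dress (n # L) v i b
    = R (- v - \<xi> n) i n * (dress L (- v) i a * ((R (- v + \<xi> n) i n * R (v - \<xi> n) i n) * dress L v i b)) * R (v + \<xi> n) i n"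
    by (simp add: mult.assoc)
  also have "\<dots> = sc (rho (v - \<xi> n)) * (R (- v - \<xi> n) i n * (dress L (- v) i a * dress L v i b) * R (v + \<xi> n) i n)"
    unfolding r by (simp add: mult.assoc sc_R sc_left'[of "dress _ _ _ _"])
  also have "\<dots> = sc (rho (v - \<xi> n) * s * rho (v + \<xi> n))"
    unfolding s by (simp add: mult.assoc sc_R r)
  finally show ?case by blast
qed

lemma K_inverse: "\<exists>s. K p q r (- v) i * K p q r v i = sc s"
proof -
  have "single a (- b) (- c) (- d) i * single a b c d i = sc (a * a - b * b + c * c - d * d)" for a b c d
    unfolding single_def by (simp add: pauli_simps sc_add sc_diff sc_minus algebra_simps)
  then show ?thesis unfolding K_def K_reflect mult_minus_right by blast
qed

lemma R_0: "R 0 i j = sc (2 * wo 0) * perm i j"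
proof -
  have "wx 0 = wo 0" "wy 0 = - wo 0" "wz 0 = wo 0" by (simp_all add: w_defs mult_ac)
  then show ?thesis unfolding R_def perm_def pair_def
    by (simp add: distrib_left right_diff_distrib mult.assoc[symmetric] sc_minus flip: sc_mult)
qed

lemma pair_cong: "a = a' \<Longrightarrow> b = b' \<Longrightarrow> c = c' \<Longrightarrow> d = d' \<Longrightarrow> pair a b c d i j = pair a' b' c' d' i j"
  by simp

lemma perm_R: assumes "i \<noteq> n"
  shows "perm i n * R (2 * u) i n = pair (t1 (u + 2 * y) * ko u) (t4 (u + 2 * y) * kx u) (- (t3 (u + 2 * y) * ky u)) (t2 (u + 2 * y) * kz u) i n"
    and "R (2 * u) i n * perm i n = perm i n * R (2 * u) i n"
proof -
  show "R (2 * u) i n * perm i n = perm i n * R (2 * u) i n"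
    unfolding R_def perm_def pair_mult[OF assms] by (rule pair_cong) (simp_all add: field_simps)
  have b: "t1 (u + 2 * y) * ko u = (wo (2 * u) + wx (2 * u) - wy (2 * u) + wz (2 * u)) / 2"
    "t4 (u + 2 * y) * kx u = (wo (2 * u) + wx (2 * u) + wy (2 * u) - wz (2 * u)) / 2"
    "t3 (u + 2 * y) * ky u = (wo (2 * u) - wx (2 * u) - wy (2 * u) - wz (2 * u)) / 2"
    "t2 (u + 2 * y) * kz u = (wo (2 * u) - wx (2 * u) + wy (2 * u) + wz (2 * u)) / 2"
    by (simp_all add: weights_at_double)
  show "perm i n * R (2 * u) i n = pair (t1 (u + 2 * y) * ko u) (t4 (u + 2 * y) * kx u) (- (t3 (u + 2 * y) * ky u)) (t2 (u + 2 * y) * kz u) i n"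
    unfolding R_def perm_def pair_mult[OF assms] b by (rule pair_cong) (simp_all add: field_simps)
qed

lemma ptr_single_pair: assumes "i \<noteq> n"
  shows "ptr i (single a b c d i * pair a' b' c' d' i n) = sc 2 * single (a * a') (b * b') (- (c * c')) (d * d') n"
proof -
  have "single a b c d i * pair a' b' c' d' i n =
      (single a b c d i * sc a') + (single a b c d i * X i) * (sc b' * X n) + (single a b c d i * Y i) * (sc c' * Y n)
      + (single a b c d i * Z i) * (sc d' * Z n)"
    unfolding pair_def by (simp add: distrib_left mult.assoc sc_left)
  moreover have "free i (sc a')" "free i (sc b' * X n)" "free i (sc c' * Y n)" "free i (sc d' * Z n)"
    using assms by simp_all
  ultimately have "ptr i (single a b c d i * pair a' b' c' d' i n)
      = sc (2 * a) * sc a' + sc (2 * b) * (sc b' * X n) + sc (- 2 * c) * (sc c' * Y n) + sc (2 * d) * (sc d' * Z n)"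
    by (simp only: ptr_add ptr_mult_right ptr_single)
  also have "\<dots> = sc 2 * single (a * a') (b * b') (- (c * c')) (d * d') n"
    unfolding single_def unfolding distrib_left unfolding sc_left(7) unfolding sc_left(8) unfolding mult.assoc by simp
  finally show ?thesis .
qed

lemma K_perm_R: assumes "i \<noteq> n"
  shows "ptr i (K p q r (u + 2 * y) i * (perm i n * R (2 * u) i n))
    = sc (2 * ic * (t1 (u + 2 * y) * t2 (u + 2 * y) * t3 (u + 2 * y) * t4 (u + 2 * y))) * K p q r u n"
  unfolding perm_R(1)[OF assms] unfolding K_def ptr_single_pair[OF assms] sc_single
  by (rule single_cong) (simp_all add: k_defs mult_ac)

end

context open_chain
begin

text \<open>The trace of the two boundary factors is unchanged when the scaling is moved from one to the other; it takes both
  of them to the crossed point.\<close>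

lemma tm_even:
  assumes L: "distinct L" "i \<notin> set L"
  shows "sc (bnorm v) * (tm L (- v - 2 * y) i - tm L v i) = 0"
proof -
  have 1: "bscale v i (U L v i) = sc (bnorm v) * U L (- v - 2 * y) i"
    unfolding U_def Km_def by (rule bscale_dress[OF bscale_K]) (use L in \<open>auto simp: free_K\<close>)
  have "sc (bnorm v) * tm L (- v - 2 * y) i = ptr i (Kp (- v) i * bscale v i (U L v i))"
    unfolding tm_def 1 by (simp add: sc_left' ptr_sc)
  also have "\<dots> = ptr i (bscale v i (Kp (- v) i) * U L v i)"
    unfolding bscale_def by (rule ptr_scaling)
  also have "\<dots> = sc (bnorm v) * tm L v i"
    unfolding tm_def Kp_def bscale_K' by (simp add: mult.assoc ptr_sc)
  finally show ?thesis by (simp add: right_diff_distrib)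
qed

text \<open>Where the boundary matrix reduces to the identity or a single Pauli operator, the transfer matrix is a scalar.\<close>

lemma tm_central:
  assumes "i \<notin> set L" "Km v i = sc k * S" "S \<in> {1, X i, Y i, Z i}"
    and "\<And>u n. n \<in> set L \<Longrightarrow> S * R (u + 2 * v) i n = sc (c u) * (R u i n * S)"
  shows "\<exists>s. tm L v i = sc s"
proof -
  obtain s where s: "dress L v i S = sc s * S" using dress_central[OF assms(1,4)] by auto
  have d: "dress L v i (sc k * S) = sc k * dress L v i S" for S
    by (induction L) (simp_all add: mult.assoc sc_R)
  have "tm L v i = ptr i (Kp (v + 2 * y) i * (sc k * (sc s * S)))" by (simp only: tm_def U_def assms(2) d s)
  also have "\<dots> = sc k * (sc s * ptr i (Kp (v + 2 * y) i * S))" by (simp only: sc_left'[of "Kp _ _"] ptr_sc)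
  finally have 1: "tm L v i = sc k * (sc s * ptr i (Kp (v + 2 * y) i * S))" .
  obtain s' where "ptr i (Kp (v + 2 * y) i * S) = sc s'"
    using assms(3) unfolding Kp_def K_def by (auto simp: ptr_single)
  then have "tm L v i = sc (k * (s * s'))" unfolding 1 by (simp only: sc_mult)
  then show ?thesis ..
qed

lemma U_perm: assumes "i \<noteq> n" "i \<notin> set L" "n \<notin> set L"
  shows "perm i n * U L v i = U L v n * perm i n" "U L v i * perm i n = perm i n * U L v n"
proof -
  have s: "perm n i = perm i n" unfolding perm_def by (rule pair_sym)
  show "perm i n * U L v i = U L v n * perm i n"
    unfolding U_def Km_def by (rule dress_perm[OF assms perm_K[OF assms(1)]])
  show "U L v i * perm i n = perm i n * U L v n"
    unfolding U_def Km_def s[symmetric]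
    by (rule dress_perm[OF assms(1)[symmetric] assms(3,2) perm_K[OF assms(1)[symmetric]], symmetric])
qed

text \<open>At the inhomogeneity of the first site, the R-matrix to that site is an exchange operator, and the trace over the auxiliary
  site can be carried out.\<close>

lemma tm_at_front:
  assumes "i \<noteq> n" "i \<notin> set L" "n \<notin> set L"
  shows "\<exists>s. tm (n # L) (\<xi> n) i = sc s * (U L (\<xi> n) n * Kp (\<xi> n) n)"
    and "\<exists>s. tm (n # L) (- \<xi> n) i = sc s * (Kp (- \<xi> n) n * U L (- \<xi> n) n)"
proof -
  have f: "free i (U L v n)" for v using assms by (auto intro: free_U)
  have c: "Kp u i * U L v n = U L v n * Kp u i" for u v
    unfolding Kp_def K_def by (rule single_commute_free[OF f])
  let ?k = "Kp (\<xi> n + 2 * y) i" and ?k' = "Kp (- \<xi> n + 2 * y) i" and ?p = "perm i n"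
    and ?r = "R (2 * \<xi> n) i n" and ?r' = "R (2 * - \<xi> n) i n" and ?c = "sc (2 * wo 0)"
  have e: "\<xi> n - \<xi> n = 0" "\<xi> n + \<xi> n = 2 * \<xi> n" "- \<xi> n - \<xi> n = 2 * - \<xi> n" "- \<xi> n + \<xi> n = 0" by simp_all
  have "tm (n # L) (\<xi> n) i = ptr i (?k * (?c * ?p * U L (\<xi> n) i * ?r))"
    unfolding tm_def U_def dress_simps e R_0 ..
  also have "?k * (?c * ?p * U L (\<xi> n) i * ?r) = ?c * (?k * ((?p * U L (\<xi> n) i) * ?r))"
    by (simp only: mult.assoc sc_left'[of ?k])
  also have "\<dots> = ?c * ((?k * U L (\<xi> n) n) * (?p * ?r))"
    unfolding U_perm(1)[OF assms] by (simp only: mult.assoc)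
  also have "\<dots> = ?c * (U L (\<xi> n) n * (?k * (?p * ?r)))" unfolding c by (simp only: mult.assoc)
  also have "ptr i \<dots> = ?c * (U L (\<xi> n) n * ptr i (?k * (?p * ?r)))"
    unfolding ptr_sc ptr_mult_left[OF f] ..
  also obtain s where "ptr i (?k * (?p * ?r)) = sc s * Kp (\<xi> n) n"
    unfolding Kp_def K_perm_R[OF assms(1)] by blast
  then have "?c * (U L (\<xi> n) n * ptr i (?k * (?p * ?r))) = sc (2 * wo 0 * s) * (U L (\<xi> n) n * Kp (\<xi> n) n)"
    by (simp only: sc_left'[of "U _ _ _"] sc_mult mult.assoc)
  finally show "\<exists>s. tm (n # L) (\<xi> n) i = sc s * (U L (\<xi> n) n * Kp (\<xi> n) n)" by blast
  have "tm (n # L) (- \<xi> n) i = ptr i (?k' * (?r' * U L (- \<xi> n) i * (?c * ?p)))"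
    unfolding tm_def U_def dress_simps e R_0 ..
  also have "?k' * (?r' * U L (- \<xi> n) i * (?c * ?p)) = ?c * (?k' * (?r' * (U L (- \<xi> n) i * ?p)))"
    by (simp only: mult.assoc sc_left'[of ?k'] sc_left'[of ?r'] sc_left'[of "U _ _ _"])
  also have "\<dots> = ?c * ((?k' * (?r' * ?p)) * U L (- \<xi> n) n)"
    unfolding U_perm(2)[OF assms] by (simp only: mult.assoc)
  also have "\<dots> = ?c * ((?k' * (?p * ?r')) * U L (- \<xi> n) n)" unfolding perm_R(2)[OF assms(1)] ..
  also have "ptr i \<dots> = ?c * (ptr i (?k' * (?p * ?r')) * U L (- \<xi> n) n)"
    unfolding ptr_sc ptr_mult_right[OF f] ..
  also obtain s' where "ptr i (?k' * (?p * ?r')) = sc s' * Kp (- \<xi> n) n"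
    unfolding Kp_def K_perm_R[OF assms(1)] by blast
  then have "?c * (ptr i (?k' * (?p * ?r')) * U L (- \<xi> n) n) = sc (2 * wo 0 * s') * (Kp (- \<xi> n) n * U L (- \<xi> n) n)"
    by (simp only: sc_mult mult.assoc)
  finally show "\<exists>s. tm (n # L) (- \<xi> n) i = sc s * (Kp (- \<xi> n) n * U L (- \<xi> n) n)" by blast
qed

lemma tm_inversion_front:
  assumes "i \<noteq> n" "i \<notin> set L" "n \<notin> set L"
  shows "\<exists>s. tm (n # L) (- \<xi> n) i * tm (n # L) (\<xi> n) i = sc s"
proof -
  obtain s1 s2 where s: "tm (n # L) (\<xi> n) i = sc s1 * (U L (\<xi> n) n * Kp (\<xi> n) n)"
    "tm (n # L) (- \<xi> n) i = sc s2 * (Kp (- \<xi> n) n * U L (- \<xi> n) n)" using tm_at_front[OF assms] by auto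
  obtain s3 where s3: "U L (- \<xi> n) n * U L (\<xi> n) n = sc s3"
    using dress_inverse K_inverse assms(3) unfolding U_def Km_def by metis
  obtain s4 where s4: "Kp (- \<xi> n) n * Kp (\<xi> n) n = sc s4" using K_inverse unfolding Kp_def by metis
  have "tm (n # L) (- \<xi> n) i * tm (n # L) (\<xi> n) i
     = sc s2 * (Kp (- \<xi> n) n * U L (- \<xi> n) n) * (sc s1 * (U L (\<xi> n) n * Kp (\<xi> n) n))" unfolding s ..
  also have "\<dots> = sc s2 * (sc s1 * (Kp (- \<xi> n) n * (U L (- \<xi> n) n * U L (\<xi> n) n) * Kp (\<xi> n) n))"
    by (simp only: mult.assoc sc_left'[of "Kp _ _"] sc_left'[of "U _ _ _"])
  also have "\<dots> = sc s2 * (sc s1 * (sc s3 * (Kp (- \<xi> n) n * Kp (\<xi> n) n)))"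
    unfolding s3 by (simp only: mult.assoc sc_central[of "Kp _ _"])
  also have "\<dots> = sc (s2 * (s1 * (s3 * s4)))" unfolding s4 by (simp only: sc_mult)
  finally show ?thesis by blast
qed

text \<open>Exchanging two neighbouring sites amounts to a conjugation; hence the inversion relation for the first site implies
  the one for every site.\<close>

lemma tm_swap:
  assumes "distinct (L1 @ m # n # L2)" "i \<notin> set (L1 @ m # n # L2)"
  shows "R (\<xi> n - \<xi> m) m n * tm (L1 @ m # n # L2) v i = tm (L1 @ n # m # L2) v i * R (\<xi> n - \<xi> m) m n"
proof -
  let ?X = "R (\<xi> n - \<xi> m) m n"
  have ne: "m \<noteq> n" "i \<noteq> m" "i \<noteq> n" "m \<noteq> i" "n \<noteq> i" using assms by auto
  have fX: "free k ?X" if "k \<noteq> m" "k \<noteq> n" for k using that by (rule free_R)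
  have y1: "?X * (R (v - \<xi> m) i m * R (v - \<xi> n) i n) = (R (v - \<xi> n) i n * R (v - \<xi> m) i m) * ?X"
    using R_YBE[of m n i "v - \<xi> m" "v - \<xi> n"] ne R_sym[of _ i m] R_sym[of _ i n] by (simp add: mult.assoc)
  have y2: "?X * (R (v + \<xi> n) i n * R (v + \<xi> m) i m) = (R (v + \<xi> m) i m * R (v + \<xi> n) i n) * ?X"
    using R_YBE[of n m i "v + \<xi> n" "v + \<xi> m"] ne R_sym[of _ i m] R_sym[of _ i n] R_sym[of _ n m] by (simp add: mult.assoc)
  have c: "?X * a = a * ?X" if "free m a" "free n a" for a using that by (rule R_commute_free)
  have D: "free m (dress L2 v i (Km v i))" "free n (dress L2 v i (Km v i))"
    using assms ne by (auto intro: free_dress free_Km)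
  have 1: "?X * dress (m # n # L2) v i (Km v i) = dress (n # m # L2) v i (Km v i) * ?X"
  proof -
    have "?X * ((R (v - \<xi> m) i m * R (v - \<xi> n) i n) * (dress L2 v i (Km v i) * (R (v + \<xi> n) i n * R (v + \<xi> m) i m)))
       = ((R (v - \<xi> n) i n * R (v - \<xi> m) i m) * (dress L2 v i (Km v i) * (R (v + \<xi> m) i m * R (v + \<xi> n) i n))) * ?X"
      by (intro intertwine_mult y1 y2 c D)
    then show ?thesis by (simp add: mult.assoc)
  qed
  have 2: "?X * dress L v i a = dress L v i b * ?X" if "?X * a = b * ?X" "m \<notin> set L" "n \<notin> set L" for L a b
    using that(2,3)
  proof (induction L)
    case Nil then show ?case using that by simp
  next
    case (Cons l L)
    then show ?case unfolding dress_simps using ne by (intro intertwine_mult c free_R) auto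
  qed
  have "?X * (Kp (v + 2 * y) i * U (L1 @ m # n # L2) v i) = (Kp (v + 2 * y) i * U (L1 @ n # m # L2) v i) * ?X"
    unfolding U_def dress_append using assms ne by (intro intertwine_mult c free_Kp 2 1) auto
  then show ?thesis unfolding tm_def using ne
    by (simp add: ptr_mult_left[OF fX, symmetric] ptr_mult_right[OF fX, symmetric])
qed

lemma tm_inversion:
  assumes "distinct (L1 @ n # L2)" "i \<notin> set (L1 @ n # L2)" "\<And>m. m \<in> set L1 \<Longrightarrow> rho (\<xi> n - \<xi> m) \<noteq> 0"
  shows "\<exists>s. tm (L1 @ n # L2) (- \<xi> n) i * tm (L1 @ n # L2) (\<xi> n) i = sc s"
  using assms
proof (induction L1 arbitrary: L2 rule: rev_induct)
  case Nil then show ?case by (simp add: tm_inversion_front)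
next
  case (snoc m L1)
  let ?L = "L1 @ m # n # L2" and ?L' = "L1 @ n # m # L2" and ?X = "R (\<xi> n - \<xi> m) m n" and ?Y = "R (\<xi> m - \<xi> n) m n"
  obtain s where s: "tm ?L' (- \<xi> n) i * tm ?L' (\<xi> n) i = sc s"
    using snoc.IH[of "m # L2"] snoc.prems by auto
  have sw: "?X * tm ?L v i = tm ?L' v i * ?X" for v using snoc.prems by (intro tm_swap) auto
  have "?X * (tm ?L (- \<xi> n) i * tm ?L (\<xi> n) i) = (tm ?L' (- \<xi> n) i * tm ?L' (\<xi> n) i) * ?X"
    by (intro intertwine_mult sw)
  also have "\<dots> = sc s * ?X" unfolding s ..
  finally have "?Y * (?X * (tm ?L (- \<xi> n) i * tm ?L (\<xi> n) i)) = sc s * (?Y * ?X)" by (simp add: sc_left'[of ?Y])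
  moreover have "?Y * ?X = sc (rho (\<xi> n - \<xi> m))"
    using R_unitary[of m n "\<xi> m - \<xi> n"] snoc.prems rho_minus[of "\<xi> m - \<xi> n"] by auto
  ultimately have "sc (rho (\<xi> n - \<xi> m)) * (tm ?L (- \<xi> n) i * tm ?L (\<xi> n) i) = sc (s * rho (\<xi> n - \<xi> m))"
    by (simp add: mult.assoc[symmetric] sc_mult)
  then have "sc (1 / rho (\<xi> n - \<xi> m)) * (sc (rho (\<xi> n - \<xi> m)) * (tm ?L (- \<xi> n) i * tm ?L (\<xi> n) i))
     = sc (1 / rho (\<xi> n - \<xi> m)) * sc (s * rho (\<xi> n - \<xi> m))" by simp
  then have "tm ?L (- \<xi> n) i * tm ?L (\<xi> n) i = sc s"
    using snoc.prems(3)[of m] by (simp add: sc_left)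
  then show ?case by auto
qed

text \<open>Quasi-periodicity of the transfer matrix from that of the R-matrices and boundary matrices.\<close>

lemma tm_shift:
  assumes S: "S * S = 1" "\<And>a. ptr i (S * a * S) = ptr i a"
    and R: "\<And>u n. n \<in> set L \<Longrightarrow> R (u + w) i n = sc (c u) * (S * R u i n * S)"
    and K: "\<And>p q r u. K p q r (u + w) i = sc (d u) * (S * K p q r u i * S)"
  shows "tm L (v + w) i = sc (d v * d (v + 2 * y) * (\<Prod>n\<leftarrow>L. c (v - \<xi> n) * c (v + \<xi> n))) * tm L v i"
proof -
  have SS: "S * (S * a) = a" for a using S(1) by (simp add: mult.assoc[symmetric])
  have cj: "(S * a * S) * (S * b * S) = S * (a * b) * S" for a b by (simp add: mult.assoc SS)
  have sm: "(sc e * a) * (sc f * b) = sc (e * f) * (a * b)" for e f a b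
    by (simp only: mult.assoc sc_left'[of a]) (simp only: sc_mult mult.assoc)
  have "dress L (v + w) i (Km (v + w) i) = sc (d v * (\<Prod>n\<leftarrow>L. c (v - \<xi> n) * c (v + \<xi> n))) * (S * dress L v i (Km v i) * S)"
    using R
  proof (induction L)
    case Nil then show ?case by (simp add: Km_def K)
  next
    case (Cons n L)
    have "R (v + w - \<xi> n) i n = sc (c (v - \<xi> n)) * (S * R (v - \<xi> n) i n * S)"
      "R (v + w + \<xi> n) i n = sc (c (v + \<xi> n)) * (S * R (v + \<xi> n) i n * S)"
      using Cons.prems[of n "v - \<xi> n"] Cons.prems[of n "v + \<xi> n"] by (simp_all add: algebra_simps)
    then show ?case using Cons by (simp add: sm cj del: mult.assoc) (simp add: mult_ac)
  qed
  then have "tm L (v + w) i = ptr i ((sc (d (v + 2 * y)) * (S * Kp (v + 2 * y) i * S)) *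
     (sc (d v * (\<Prod>n\<leftarrow>L. c (v - \<xi> n) * c (v + \<xi> n))) * (S * dress L v i (Km v i) * S)))"
    using K[of _ _ _ "v + 2 * y"] by (simp add: tm_def U_def Kp_def algebra_simps)
  also have "\<dots> = sc (d v * d (v + 2 * y) * (\<Prod>n\<leftarrow>L. c (v - \<xi> n) * c (v + \<xi> n))) * tm L v i"
    unfolding sm cj ptr_sc S(2) by (simp add: tm_def U_def mult_ac)
  finally show ?thesis .
qed

end

section \<open>Interpolation by even elliptic polynomials\<close>

text \<open>At the (simple) zeros of \<open>s\<close> the quotient is continued by the quotient of the derivatives.\<close>

lemma entire_divide:
  assumes f: "f holomorphic_on UNIV" and s: "s holomorphic_on UNIV"
    and z: "\<And>u. s u = (0::complex) \<Longrightarrow> f u = 0 \<and> deriv s u \<noteq> 0"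
  shows "\<exists>g. g holomorphic_on UNIV \<and> (\<forall>u. f u = g u * s u)"
proof -
  define g where "g u = (if s u = 0 then deriv f u / deriv s u else f u / s u)" for u
  have "g field_differentiable at a" for a
  proof (cases "s a = 0")
    case False
    have cs: "continuous_on UNIV s" by (rule holomorphic_on_imp_continuous_on[OF s])
    have o: "open {u. s u \<noteq> 0}" using cs by (intro open_Collect_neq) auto
    have "g holomorphic_on {u. s u \<noteq> 0}"
      by (rule holomorphic_transform[of "\<lambda>u. f u / s u"])
         (auto simp: g_def intro!: holomorphic_intros holomorphic_on_subset[OF f] holomorphic_on_subset[OF s])
    then show ?thesis using o False by (auto simp: holomorphic_on_open field_differentiable_def)
  next
    case True
    define F S where "F u = (if u = a then deriv f a else (f u - f a) / (u - a))"
      and "S u = (if u = a then deriv s a else (s u - s a) / (u - a))" for u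
    have F: "F holomorphic_on UNIV" and S: "S holomorphic_on UNIV"
      unfolding F_def S_def using pole_lemma[OF f, of a] pole_lemma[OF s, of a] by auto
    have fa: "f a = 0" "S a \<noteq> 0" using z[OF True] by (auto simp: S_def)
    have eq: "s u = (u - a) * S u" "f u = (u - a) * F u" for u using True fa by (auto simp: S_def F_def)
    have cS: "continuous_on UNIV S" by (rule holomorphic_on_imp_continuous_on[OF S])
    have o: "open {u. S u \<noteq> 0}" using cS by (intro open_Collect_neq) auto
    have "g holomorphic_on {u. S u \<noteq> 0}"
    proof (rule holomorphic_transform[of "\<lambda>u. F u / S u"])
      show "F u / S u = g u" if "u \<in> {u. S u \<noteq> 0}" for u
        using that by (cases "u = a") (auto simp: g_def eq True, auto simp: F_def S_def)
    qed (auto intro!: holomorphic_intros holomorphic_on_subset[OF F] holomorphic_on_subset[OF S])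
    then show ?thesis using o fa by (auto simp: holomorphic_on_open field_differentiable_def)
  qed
  then have "g holomorphic_on UNIV" by (auto simp: holomorphic_on_def)
  moreover have "f u = g u * s u" for u using z[of u] by (auto simp: g_def)
  ultimately show ?thesis by blast
qed

context
  fixes \<omega> :: complex assumes om: "Im \<omega> > 0"
begin

lemma quasi_mult: "quasi \<omega> (u - x) * quasi \<omega> (u + x) = (quasi \<omega> u)\<^sup>2"
  unfolding quasi_def[OF om] power2_eq_square exp_add[symmetric] by (rule arg_cong[where f = exp]) (simp add: algebra_simps)

lemma Xi_iff: "f \<in> Xi_space \<omega> (Suc k) \<longleftrightarrow> f holomorphic_on UNIV \<and> (\<forall>u. f (- u) = f u) \<and> (\<forall>u. f (u + of_real pi) = f u)
   \<and> (\<forall>u. f (u + of_real pi * \<omega>) = quasi \<omega> u ^ (2 * k) * f u)"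
  unfolding Xi_space_def quasi_def[OF om] by simp

lemma Xi_mult: "f \<in> Xi_space \<omega> (Suc a) \<Longrightarrow> g \<in> Xi_space \<omega> (Suc b) \<Longrightarrow> (\<lambda>u. f u * g u) \<in> Xi_space \<omega> (Suc (a + b))"
  unfolding Xi_iff by (auto intro!: holomorphic_intros simp: power_add distrib_left)

lemma Xi_const: "(\<lambda>u. c) \<in> Xi_space \<omega> (Suc 0)" unfolding Xi_iff by (auto intro!: holomorphic_intros)

lemma Xi_add: "f \<in> Xi_space \<omega> (Suc a) \<Longrightarrow> g \<in> Xi_space \<omega> (Suc a) \<Longrightarrow> (\<lambda>u. f u + g u) \<in> Xi_space \<omega> (Suc a)"
  unfolding Xi_iff by (auto intro!: holomorphic_intros simp: distrib_left)

lemma Xi_cmult: "f \<in> Xi_space \<omega> (Suc a) \<Longrightarrow> (\<lambda>u. c * f u) \<in> Xi_space \<omega> (Suc a)"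
  using Xi_mult[OF Xi_const] by simp

lemma Xi_diff: "f \<in> Xi_space \<omega> (Suc a) \<Longrightarrow> g \<in> Xi_space \<omega> (Suc a) \<Longrightarrow> (\<lambda>u. f u - g u) \<in> Xi_space \<omega> (Suc a)"
  unfolding Xi_iff by (auto intro!: holomorphic_intros simp: right_diff_distrib)

lemma Xi_sum: "(\<And>i. i \<in> I \<Longrightarrow> f i \<in> Xi_space \<omega> (Suc a)) \<Longrightarrow> (\<lambda>u. \<Sum>i\<in>I. f i u) \<in> Xi_space \<omega> (Suc a)"
proof (induction I rule: infinite_finite_induct)
  case (insert x F) then show ?case by (simp add: Xi_add)
qed (use Xi_cmult[of _ a 0] in \<open>auto simp: Xi_iff intro!: holomorphic_intros\<close>)

lemma Xi_theta_s: "(\<lambda>u. theta_s \<omega> u x) \<in> Xi_space \<omega> (Suc 1)"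
proof -
  have e: "- u - x = - (u + x)" "- u + x = - (u - x)" "u + of_real pi - x = u - x + of_real pi" "u + of_real pi + x = u + x + of_real pi"
     "u + of_real pi * \<omega> - x = u - x + of_real pi * \<omega>" "u + of_real pi * \<omega> + x = u + x + of_real pi * \<omega>" for u by simp_all
  have h: "(\<lambda>u. theta1 \<omega> (u + c)) holomorphic_on UNIV" for c by (rule holomorphic_shift[OF theta1_holomorphic[OF om]])
  show ?thesis unfolding Xi_iff theta_s_def
  proof (intro conjI allI)
    show "(\<lambda>u. theta1 \<omega> (u - x) * theta1 \<omega> (u + x)) holomorphic_on UNIV"
      using h[of x] h[of "- x"] by (auto intro!: holomorphic_intros)
    show "theta1 \<omega> (- u - x) * theta1 \<omega> (- u + x) = theta1 \<omega> (u - x) * theta1 \<omega> (u + x)" for u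
      unfolding e theta1_odd[OF om] by simp
    show "theta1 \<omega> (u + of_real pi - x) * theta1 \<omega> (u + of_real pi + x) = theta1 \<omega> (u - x) * theta1 \<omega> (u + x)" for u
      unfolding e theta_pi[OF om] by simp
    show "theta1 \<omega> (u + of_real pi * \<omega> - x) * theta1 \<omega> (u + of_real pi * \<omega> + x) = quasi \<omega> u ^ (2 * 1) * (theta1 \<omega> (u - x) * theta1 \<omega> (u + x))" for u
      unfolding e theta_pi_tau[OF om] using quasi_mult[of u x] by simp
  qed
qed

lemma theta_s_commute: "theta_s \<omega> x z = - theta_s \<omega> z x"
  using theta1_odd[OF om, of "z - x"] by (simp add: theta_s_def add.commute)

lemma theta_s_self [simp]: "theta_s \<omega> x x = 0"
  by (simp add: theta_s_def om)

lemma theta1_lattice_iff: "theta1 \<omega> t = 0 \<longleftrightarrow> t \<in> period_lattice \<omega>"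
proof
  show "theta1 \<omega> t = 0 \<Longrightarrow> t \<in> period_lattice \<omega>" by (rule theta1_zero_lattice[OF om])
  assume "t \<in> period_lattice \<omega>"
  then obtain m n :: int where t: "t = of_int m * of_real pi + of_int n * (of_real pi * \<omega>)"
    unfolding period_lattice_def by auto
  have "(theta1 \<omega> (u + of_int i * (of_real pi * \<omega>)) = 0) = (theta1 \<omega> u = 0)" for u i
    by (rule periodic_int) (simp add: theta_pi_tau[OF om] quasi_def[OF om])
  moreover have "(theta1 \<omega> (0 + of_int i * of_real pi) = 0) = (theta1 \<omega> 0 = 0)" for i
    by (rule periodic_int) (simp add: theta_pi[OF om])
  ultimately show "theta1 \<omega> t = 0" unfolding t by (simp add: om)
qed

lemma lattice_diff: assumes "a \<in> period_lattice \<omega>" "b \<in> period_lattice \<omega>" shows "a - b \<in> period_lattice \<omega>"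
proof -
  obtain m n m' n' :: int where "a = of_int m * of_real pi + of_int n * (of_real pi * \<omega>)" "b = of_int m' * of_real pi + of_int n' * (of_real pi * \<omega>)"
    using assms unfolding period_lattice_def by auto
  then have "a - b = of_int (m - m') * of_real pi + of_int (n - n') * (of_real pi * \<omega>)" by (simp add: algebra_simps)
  then show ?thesis unfolding period_lattice_def by blast
qed

lemma Xi_lattice_zero:
  assumes f: "f \<in> Xi_space \<omega> (Suc k)" and l: "l \<in> period_lattice \<omega>" and x: "f x = 0"
  shows "f (x + l) = 0"
proof -
  obtain m n :: int where t: "l = of_int m * of_real pi + of_int n * (of_real pi * \<omega>)"
    using l unfolding period_lattice_def by auto
  have q: "quasi \<omega> u \<noteq> 0" for u by (simp add: quasi_def[OF om])
  have "(f (u + of_int i * (of_real pi * \<omega>)) = 0) = (f u = 0)" for u i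
    by (rule periodic_int) (use f q in \<open>simp add: Xi_iff\<close>)
  moreover have "(f (u + of_int i * of_real pi) = 0) = (f u = 0)" for u i
    by (rule periodic_int) (use f in \<open>simp add: Xi_iff\<close>)
  ultimately show ?thesis using x unfolding t by (simp add: add.assoc[symmetric])
qed

lemma theta_s_nontrivial: "\<exists>u. theta_s \<omega> u x \<noteq> 0"
proof (rule ccontr)
  assume "\<not> ?thesis"
  then have 0: "theta1 \<omega> (u + - x) * theta1 \<omega> (u + x) = 0" for u by (simp add: theta_s_def)
  have "(\<forall>u. theta1 \<omega> (u + - x) = 0) \<or> (\<forall>u. theta1 \<omega> (u + x) = 0)"
    by (rule entire_mult_eq_0[OF _ _ 0]) (rule holomorphic_shift[OF theta1_holomorphic[OF om]])+
  then show False using theta1_nontrivial[OF om] by (metis add.assoc add.right_neutral add.left_inverse add.right_inverse)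
qed

text \<open>Removing a pair of zeros \<open>x\<close>, \<open>- x\<close> lowers the order; the assumption on \<open>2 * x\<close> keeps the zeros of \<open>theta_s\<close> simple.\<close>

lemma Xi_divide:
  assumes f: "f \<in> Xi_space \<omega> (Suc (Suc k))" and x: "f x = 0" and x2: "theta1 \<omega> (2 * x) \<noteq> 0"
  shows "\<exists>g \<in> Xi_space \<omega> (Suc k). \<forall>u. f u = g u * theta_s \<omega> u x"
proof -
  let ?s = "\<lambda>u. theta_s \<omega> u x"
  have s: "?s \<in> Xi_space \<omega> (Suc 1)" by (rule Xi_theta_s)
  have sh: "?s holomorphic_on UNIV" and fh: "f holomorphic_on UNIV" using s f by (auto simp: Xi_iff)
  have d: "(theta1 \<omega> has_field_derivative deriv (theta1 \<omega>) u) (at u)" for u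
    using holomorphic_derivI[OF theta1_holomorphic[OF om] open_UNIV] by auto
  have dsh: "((\<lambda>u. theta1 \<omega> (u + a)) has_field_derivative deriv (theta1 \<omega>) (u + a)) (at u)" for a u
    using DERIV_shift[of "theta1 \<omega>" "deriv (theta1 \<omega>) (u + a)" u a] d[of "u + a"] by simp
  have ds: "deriv ?s u = deriv (theta1 \<omega>) (u - x) * theta1 \<omega> (u + x) + deriv (theta1 \<omega>) (u + x) * theta1 \<omega> (u - x)" for u
    using DERIV_imp_deriv[OF DERIV_mult[OF dsh[where a = "- x" and u = u] dsh[where a = x and u = u]]] by (simp add: theta_s_def)
  have "\<exists>g. g holomorphic_on UNIV \<and> (\<forall>u. f u = g u * ?s u)"
  proof (rule entire_divide[OF fh sh])
    fix u assume "?s u = 0"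
    then consider "theta1 \<omega> (u - x) = 0" | "theta1 \<omega> (u + x) = 0" by (auto simp: theta_s_def)
    then show "f u = 0 \<and> deriv ?s u \<noteq> 0"
    proof cases
      case 1
      have "f (x + (u - x)) = 0" using 1 by (intro Xi_lattice_zero[OF f _ x]) (simp add: theta1_lattice_iff)
      moreover have "theta1 \<omega> (u + x) \<noteq> 0"
      proof
        assume "theta1 \<omega> (u + x) = 0"
        then have "u + x \<in> period_lattice \<omega>" "u - x \<in> period_lattice \<omega>" using 1 by (auto simp: theta1_lattice_iff)
        then have "(u + x) - (u - x) \<in> period_lattice \<omega>" by (rule lattice_diff)
        then show False using x2 by (simp add: theta1_lattice_iff)
      qed
      ultimately show ?thesis using 1 theta1_simple_zero[OF om 1] by (simp add: ds)
    next
      case 2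
      have "f (- x) = 0" using f x by (simp add: Xi_iff)
      then have "f (- x + (u + x)) = 0" using 2 by (intro Xi_lattice_zero[OF f]) (auto simp: theta1_lattice_iff)
      moreover have "theta1 \<omega> (u - x) \<noteq> 0"
      proof
        assume "theta1 \<omega> (u - x) = 0"
        then have "u + x \<in> period_lattice \<omega>" "u - x \<in> period_lattice \<omega>" using 2 by (auto simp: theta1_lattice_iff)
        then have "(u + x) - (u - x) \<in> period_lattice \<omega>" by (rule lattice_diff)
        then show False using x2 by (simp add: theta1_lattice_iff)
      qed
      ultimately show ?thesis using 2 theta1_simple_zero[OF om 2] by (simp add: ds)
    qed
  qed
  then obtain g where g: "g holomorphic_on UNIV" "\<And>u. f u = g u * ?s u" by auto
  have cancel: "h u = 0" if h: "h holomorphic_on UNIV" "\<And>u. h u * ?s u = 0" for h u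
    using entire_mult_eq_0[OF h(1) sh h(2)] theta_s_nontrivial[of x] by auto
  have gs: "(\<lambda>u. g (u + c)) holomorphic_on UNIV" for c by (rule holomorphic_shift[OF g(1)])
  have gm: "(\<lambda>u. g (- u)) holomorphic_on UNIV"
    by (rule holomorphic_on_compose_gen[of "\<lambda>u. - u" UNIV g UNIV, unfolded o_def]) (auto intro!: holomorphic_intros g)
  have q: "quasi \<omega> holomorphic_on UNIV" "quasi \<omega> u \<noteq> 0" for u
    by (auto simp: quasi_def[OF om, abs_def] intro!: holomorphic_intros)
  have "g \<in> Xi_space \<omega> (Suc k)"
    unfolding Xi_iff
  proof (intro conjI allI)
    show "g (- u) = g u" for u
    proof -
      have "(g (- v) - g v) * ?s v = 0" for v
        using g(2)[of "- v", symmetric] g(2)[of v, symmetric] f s by (simp add: Xi_iff left_diff_distrib)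
      then show ?thesis using cancel[OF holomorphic_on_diff[OF gm g(1)]] by simp
    qed
    show "g (u + of_real pi) = g u" for u
    proof -
      have "(g (v + of_real pi) - g v) * ?s v = 0" for v
        using g(2)[of "v + of_real pi", symmetric] g(2)[of v, symmetric] f s by (simp add: Xi_iff left_diff_distrib)
      then show ?thesis using cancel[OF holomorphic_on_diff[OF gs g(1)]] by simp
    qed
    show "g (u + of_real pi * \<omega>) = quasi \<omega> u ^ (2 * k) * g u" for u
    proof -
      have "(g (v + of_real pi * \<omega>) - quasi \<omega> v ^ (2 * k) * g v) * ?s v = 0" for v
      proof -
        have "g (v + of_real pi * \<omega>) * (quasi \<omega> v ^ 2 * ?s v) = quasi \<omega> v ^ (2 * Suc k) * (g v * ?s v)"
          using g(2)[of "v + of_real pi * \<omega>", symmetric] g(2)[of v, symmetric] f s by (simp add: Xi_iff)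
        then have "quasi \<omega> v ^ 2 * ((g (v + of_real pi * \<omega>) - quasi \<omega> v ^ (2 * k) * g v) * ?s v) = 0"
          by (simp add: power2_eq_square algebra_simps)
        then show ?thesis using q(2)[of v] by simp
      qed
      moreover have "(\<lambda>u. g (u + of_real pi * \<omega>) - quasi \<omega> u ^ (2 * k) * g u) holomorphic_on UNIV"
        by (intro holomorphic_on_diff gs holomorphic_on_mult holomorphic_on_power q(1) g(1))
      ultimately have "g (u + of_real pi * \<omega>) - quasi \<omega> u ^ (2 * k) * g u = 0" by (rule cancel[rotated])
      then show ?thesis by (rule iffD1[OF right_minus_eq])
    qed
  qed (rule g(1))
  then show ?thesis using g(2) by blast
qed

text \<open>Interpolation nodes in general position: together with their negatives, they are pairwise distinct modulo the periods.\<close>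

definition good_nodes :: "'i set \<Rightarrow> ('i \<Rightarrow> complex) \<Rightarrow> bool" where
  "good_nodes I x \<longleftrightarrow> finite I \<and> (\<forall>i\<in>I. theta1 \<omega> (2 * x i) \<noteq> 0) \<and> (\<forall>i\<in>I. \<forall>j\<in>I. i \<noteq> j \<longrightarrow> theta_s \<omega> (x i) (x j) \<noteq> 0)"

lemma Xi_zero:
  assumes "good_nodes I x" "card I = Suc k" "f \<in> Xi_space \<omega> (Suc k)" "\<And>i. i \<in> I \<Longrightarrow> f (x i) = 0"
  shows "f u = 0"
  using assms
proof (induction k arbitrary: f I u)
  case 0
  then obtain i where i: "I = {i}" using card_1_singletonE by (metis One_nat_def)
  obtain c where c: "\<And>u. f u = c"
    using elliptic_constant[of f \<omega>] 0 om by (auto simp: Xi_iff)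
  then show ?case using 0(4)[of i] i by simp
next
  case (Suc k)
  then obtain i J where I: "I = insert i J" "i \<notin> J" "card J = Suc k" by (metis card_Suc_eq)
  obtain g where g: "g \<in> Xi_space \<omega> (Suc k)" "\<And>u. f u = g u * theta_s \<omega> u (x i)"
    using Xi_divide[of f k "x i"] Suc.prems I by (auto simp: good_nodes_def)
  have "g v = 0" for v
  proof (rule Suc.IH[OF _ I(3) g(1)])
    show "good_nodes J x" using Suc.prems(1) I by (auto simp: good_nodes_def)
    show "g (x j) = 0" if "j \<in> J" for j
      using g(2)[of "x j"] Suc.prems(4)[of j] Suc.prems(1) I that by (auto simp: good_nodes_def)
  qed
  then show ?case using g(2) by simp
qed

text \<open>The elliptic Lagrange polynomials.\<close>

definition lagr :: "'i set \<Rightarrow> ('i \<Rightarrow> complex) \<Rightarrow> 'i \<Rightarrow> complex \<Rightarrow> complex" where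
  "lagr I x i u = (\<Prod>j\<in>I - {i}. theta_s \<omega> u (x j) / theta_s \<omega> (x i) (x j))"

lemma Xi_lagr: assumes "finite I" "i \<in> I" "card I = Suc k" shows "lagr I x i \<in> Xi_space \<omega> (Suc k)"
proof -
  have "(\<lambda>u. \<Prod>j\<in>J. theta_s \<omega> u (x j) / theta_s \<omega> (x i) (x j)) \<in> Xi_space \<omega> (Suc (card J))" if "finite J" for J
    using that
  proof induction
    case empty then show ?case using Xi_const[of 1] by simp
  next
    case (insert j J)
    have "(\<lambda>u. theta_s \<omega> u (x j) / theta_s \<omega> (x i) (x j)) \<in> Xi_space \<omega> (Suc 1)"
      using Xi_cmult[OF Xi_theta_s, of "1 / theta_s \<omega> (x i) (x j)"] by simp
    from Xi_mult[OF this insert.IH] show ?case using insert by simp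
  qed
  from this[of "I - {i}"] assms show ?thesis unfolding lagr_def[abs_def] by simp
qed

lemma lagr_node: assumes "good_nodes I x" "i \<in> I" "j \<in> I" shows "lagr I x i (x j) = (if i = j then 1 else 0)"
proof (cases "i = j")
  case True
  have "theta_s \<omega> (x j) (x l) \<noteq> 0" if "l \<in> I - {j}" for l
    using assms that unfolding good_nodes_def by (metis DiffE insertI1)
  then show ?thesis using True unfolding lagr_def by (auto intro!: prod.neutral)
next
  case False
  then have "j \<in> I - {i}" "finite (I - {i})" using assms by (auto simp: good_nodes_def)
  then show ?thesis unfolding lagr_def using False by (auto simp: prod_zero_iff intro!: bexI[of _ j])
qed

theorem Xi_interpolation:
  assumes x: "good_nodes I x" and I: "card I = Suc k" and f: "f \<in> Xi_space \<omega> (Suc k)"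
  shows "f u = (\<Sum>i\<in>I. f (x i) * lagr I x i u)"
proof -
  have fin: "finite I" using x by (simp add: good_nodes_def)
  have "(\<lambda>u. f u - (\<Sum>i\<in>I. f (x i) * lagr I x i u)) \<in> Xi_space \<omega> (Suc k)"
    by (intro Xi_diff f Xi_sum Xi_cmult Xi_lagr fin I)
  then have "f u - (\<Sum>i\<in>I. f (x i) * lagr I x i u) = 0"
    by (rule Xi_zero[OF x I]) (simp add: lagr_node[OF x] fin if_distrib cong: if_cong)
  then show ?thesis by simp
qed

end

section \<open>Elliptic Vandermonde determinants\<close>

lemma det_replace_row:
  fixes M :: "complex ^ 'n ^ 'n"
  assumes r: "r = (\<Sum>j\<in>UNIV. c j *s M $ j)"
  shows "det (\<chi> k. if k = i then r else M $ k) = c i * det M"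
proof -
  have "det (\<chi> k. if k = i then r else M $ k) = (\<Sum>j\<in>UNIV. det (\<chi> k. if k = i then c j *s M $ j else M $ k))"
    unfolding r by (rule det_linear_row_sum) simp
  also have "\<dots> = (\<Sum>j\<in>UNIV. c j * det (\<chi> k. if k = i then M $ j else M $ k))"
    by (rule sum.cong[OF refl]) (rule det_row_mul)
  also have "\<dots> = (\<Sum>j\<in>UNIV. if j = i then c i * det M else 0)"
  proof (rule sum.cong[OF refl])
    fix j
    show "c j * det (\<chi> k. if k = i then M $ j else M $ k) = (if j = i then c i * det M else 0)"
    proof (cases "j = i")
      case True
      then have "(\<chi> k. if k = i then M $ j else M $ k) = M" by (auto simp: vec_eq_iff)
      then show ?thesis using True by simp
    next
      case False
      then have "det (\<chi> k. if k = i then M $ j else M $ k) = 0"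
        by (intro det_identical_rows[of i j]) (auto simp: row_def vec_eq_iff)
      then show ?thesis using False by simp
    qed
  qed
  also have "\<dots> = c i * det M" by simp
  finally show ?thesis .
qed

text \<open>Expansion of a determinant all of whose rows are sums of two terms.\<close>

lemma det_two_rows:
  fixes a b :: "'n::finite \<Rightarrow> complex ^ 'n"
  shows "det (\<chi> i. p i *s a i + q i *s b i) = (\<Sum>h\<in>UNIV. (\<Prod>i\<in>UNIV. if h i then q i else p i) * det (\<chi> i. if h i then b i else a i))"
proof -
  let ?f = "\<lambda>i t. if t then q i *s b i else p i *s a i"
  have "(\<Prod>i\<in>UNIV. p i * a i $ s i + q i * b i $ s i) = (\<Sum>h\<in>UNIV. \<Prod>i\<in>UNIV. ?f i (h i) $ s i)" for s
  proof -
    have "(\<Prod>i\<in>UNIV. p i * a i $ s i + q i * b i $ s i) = (\<Prod>i\<in>UNIV. \<Sum>t\<in>(UNIV::bool set). ?f i t $ s i)"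
      by (simp add: UNIV_bool add.commute)
    also have "\<dots> = (\<Sum>h\<in>PiE UNIV (\<lambda>_. UNIV). \<Prod>i\<in>UNIV. ?f i (h i) $ s i)" by (rule prod_sum_PiE) auto
    finally show ?thesis by (simp add: PiE_UNIV_domain)
  qed
  then have "det (\<chi> i. p i *s a i + q i *s b i) = (\<Sum>h\<in>UNIV. det (\<chi> i. ?f i (h i)))"
    unfolding det_def by (simp add: sum_distrib_left) (rule sum.swap)
  also have "\<dots> = (\<Sum>h\<in>UNIV. det (\<chi> i. (if h i then q i else p i) *s (if h i then b i else a i)))"
    by (intro sum.cong refl arg_cong[where f = det]) (auto simp: vec_eq_iff)
  finally show ?thesis by (simp add: det_rows_mul)
qed

context
  fixes \<omega> :: complex assumes om: "Im \<omega> > 0"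
begin

lemma ell_vand_replace:
  fixes z :: "'n::{finite,linorder} \<Rightarrow> complex"
  shows "\<exists>c. \<forall>x. ell_vand \<omega> (z(i := x)) = c * (\<Prod>j\<in>UNIV - {i}. theta_s \<omega> x (z j))"
proof -
  let ?f = "\<lambda>\<zeta>. \<lambda>(a, b). theta_s \<omega> (\<zeta> b) (\<zeta> a)"
  let ?A = "(\<lambda>b. (i, b)) ` {b. i < b}" and ?B = "(\<lambda>a. (a, i)) ` {a. a < i}" and ?C = "{(a, b). a < b \<and> a \<noteq> i \<and> b \<noteq> i}"
  have S: "{(a, b). a < b} = (?A \<union> ?B) \<union> ?C" by auto
  have d: "(?A \<union> ?B) \<inter> ?C = {}" "?A \<inter> ?B = {}" by auto
  have U: "prod g {(a, b). a < b} = prod g ?A * prod g ?B * prod g ?C" for g :: "'n \<times> 'n \<Rightarrow> complex"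
    unfolding S by (simp only: prod.union_disjoint d finite)
  have "ell_vand \<omega> (z(i := x)) = ((\<Prod>b\<in>{b. i < b}. - 1) * prod (?f z) ?C) * (\<Prod>j\<in>UNIV - {i}. theta_s \<omega> x (z j))" for x
  proof -
    let ?z = "z(i := x)"
    have 1: "ell_vand \<omega> ?z = prod (?f ?z) ?A * prod (?f ?z) ?B * prod (?f ?z) ?C"
      unfolding ell_vand_def U ..
    have "prod (?f ?z) ?A = (\<Prod>b\<in>{b. i < b}. theta_s \<omega> (z b) x)"
      by (subst prod.reindex) (auto simp: inj_on_def intro!: prod.cong)
    also have "\<dots> = (\<Prod>b\<in>{b. i < b}. - 1 * theta_s \<omega> x (z b))"
      using theta_s_commute[OF om, of "z _" x] by simp
    also have "\<dots> = (\<Prod>b\<in>{b. i < b}. - 1) * (\<Prod>b\<in>{b. i < b}. theta_s \<omega> x (z b))" by (rule prod.distrib)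
    finally have 2: "prod (?f ?z) ?A = (\<Prod>b\<in>{b. i < b}. - 1) * (\<Prod>b\<in>{b. i < b}. theta_s \<omega> x (z b))" .
    have 3: "prod (?f ?z) ?B = (\<Prod>a\<in>{a. a < i}. theta_s \<omega> x (z a))"
      by (subst prod.reindex) (auto simp: inj_on_def intro!: prod.cong)
    have 4: "prod (?f ?z) ?C = prod (?f z) ?C" by (intro prod.cong) auto
    have "UNIV - {i} = {b. i < b} \<union> {a. a < i}" "{b. i < b} \<inter> {a. a < i} = {}" by auto
    then have 5: "(\<Prod>j\<in>UNIV - {i}. theta_s \<omega> x (z j)) = (\<Prod>b\<in>{b. i < b}. theta_s \<omega> x (z b)) * (\<Prod>a\<in>{a. a < i}. theta_s \<omega> x (z a))"
      by (simp only: prod.union_disjoint finite)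
    show ?thesis unfolding 1 2 3 4 5 by (simp only: mult_ac)
  qed
  then show ?thesis by blast
qed

lemma ell_vand_lagr:
  fixes z :: "'n::{finite,linorder} \<Rightarrow> complex"
  assumes z: "good_nodes \<omega> UNIV z"
  shows "ell_vand \<omega> (z(i := x)) = ell_vand \<omega> z * lagr \<omega> UNIV z i x"
proof -
  obtain c where c: "\<And>x. ell_vand \<omega> (z(i := x)) = c * (\<Prod>j\<in>UNIV - {i}. theta_s \<omega> x (z j))"
    using ell_vand_replace[of z i] by auto
  have "(\<Prod>j\<in>UNIV - {i}. theta_s \<omega> (z i) (z j)) \<noteq> 0"
    using z by (auto simp: good_nodes_def[OF om] prod_zero_iff)
  then show ?thesis using c[of x] c[of "z i"] by (simp add: lagr_def[OF om] prod_dividef)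
qed

lemma good_nodes_vand: 
  fixes z :: "'n::{finite,linorder} \<Rightarrow> complex"
  assumes "good_nodes \<omega> UNIV z" shows "ell_vand \<omega> z \<noteq> 0"
  using assms unfolding ell_vand_def good_nodes_def[OF om] by (auto simp: prod_zero_iff)

lemma generic_point:
  assumes "finite F"
  shows "\<exists>u. theta1 \<omega> (2 * u) \<noteq> 0 \<and> (\<forall>a\<in>F. theta_s \<omega> u a \<noteq> 0)"
proof -
  let ?G = "\<lambda>F u. theta1 \<omega> (2 * u) * (\<Prod>a\<in>F. theta_s \<omega> u a)"
  have h: "(\<lambda>u. theta1 \<omega> (2 * u)) holomorphic_on UNIV"
    by (rule holomorphic_on_compose_gen[of "\<lambda>u. 2 * u" UNIV "theta1 \<omega>" UNIV, unfolded o_def])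
       (auto intro!: holomorphic_intros theta1_holomorphic[OF om])
  have s: "(\<lambda>u. theta_s \<omega> u a) holomorphic_on UNIV" for a
    using Xi_theta_s[OF om, of a] unfolding Xi_iff[OF om] by blast
  have "?G F holomorphic_on UNIV \<and> (\<exists>u. ?G F u \<noteq> 0)" using assms
  proof (induction F rule: finite_induct)
    case empty
    obtain u where "theta1 \<omega> u \<noteq> 0" using theta1_nontrivial[OF om] by auto
    then have "theta1 \<omega> (2 * (u / 2)) \<noteq> 0" by simp
    then show ?case using h by (auto intro: exI[of _ "u / 2"])
  next
    case (insert a F)
    have e: "?G (insert a F) u = ?G F u * theta_s \<omega> u a" for u using insert.hyps by (auto simp: mult_ac)
    have "\<exists>u. ?G F u * theta_s \<omega> u a \<noteq> 0"
    proof (rule ccontr)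
      assume "\<not> ?thesis"
      then have "(\<forall>u. ?G F u = 0) \<or> (\<forall>u. theta_s \<omega> u a = 0)"
        using insert.IH by (intro entire_mult_eq_0 s) auto
      then show False using insert.IH theta_s_nontrivial[OF om, of a] by blast
    qed
    moreover have "(\<lambda>u. ?G F u * theta_s \<omega> u a) holomorphic_on UNIV"
      using insert.IH by (intro holomorphic_on_mult[of "?G F"] s) auto
    ultimately show ?case by (simp only: e)
  qed
  then show ?thesis using assms by (auto simp: prod_zero_iff)
qed

lemma generic_nodes:
  assumes "finite F"
  shows "\<exists>y :: 'n::finite \<Rightarrow> complex. good_nodes \<omega> UNIV y \<and> (\<forall>i. \<forall>a\<in>F. theta_s \<omega> (y i) a \<noteq> 0)"
proof -
  have "\<exists>y :: 'n \<Rightarrow> complex. good_nodes \<omega> S y \<and> (\<forall>i\<in>S. \<forall>a\<in>F. theta_s \<omega> (y i) a \<noteq> 0)" if "finite S" for S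
    using that
  proof induction
    case empty then show ?case by (auto simp: good_nodes_def[OF om])
  next
    case (insert k S)
    then obtain y where y: "good_nodes \<omega> S y" "\<And>i a. i \<in> S \<Longrightarrow> a \<in> F \<Longrightarrow> theta_s \<omega> (y i) a \<noteq> 0" by auto
    obtain u where u: "theta1 \<omega> (2 * u) \<noteq> 0" "\<And>a. a \<in> F \<union> y ` S \<Longrightarrow> theta_s \<omega> u a \<noteq> 0"
      using generic_point[of "F \<union> y ` S"] assms insert by auto
    have u': "theta_s \<omega> (y j) u \<noteq> 0" if "j \<in> S" for j
      using u(2)[of "y j"] that theta_s_commute[OF om, of "y j" u] by auto
    have "good_nodes \<omega> (insert k S) (y(k := u))"
      using y(1) u u' insert unfolding good_nodes_def[OF om] by auto
    moreover have "\<forall>i\<in>insert k S. \<forall>a\<in>F. theta_s \<omega> ((y(k := u)) i) a \<noteq> 0" using y(2) u(2) by auto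
    ultimately show ?case by blast
  qed
  from this[of UNIV] show ?thesis by auto
qed

text \<open>
  Changing a single node multiplies both sides by the same Lagrange polynomial, by interpolation; for \<open>x = \<xi>\<close> the
  identity is trivial. As the intermediate configurations have to be in general position, the nodes are first
  moved from \<open>\<xi>\<close> to a generic configuration \<open>y\<close> and from there to \<open>x\<close>.
\<close>

lemma lagr_det:
  fixes \<xi> x :: "'n::{finite,linorder} \<Rightarrow> complex"
  assumes \<xi>: "good_nodes \<omega> UNIV \<xi>" and x: "good_nodes \<omega> UNIV x"
  shows "det (\<chi> i k. lagr \<omega> UNIV \<xi> k (x i)) * ell_vand \<omega> \<xi> = ell_vand \<omega> x"
proof -
  let ?M = "\<lambda>z. \<chi> i k. lagr \<omega> UNIV \<xi> k (z i)"
  define P where "P z \<longleftrightarrow> det (?M z) * ell_vand \<omega> \<xi> = ell_vand \<omega> z" for z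
  obtain N where N: "CARD('n) = Suc N" using zero_less_card_finite[where 'a = 'n] by (metis Suc_pred)
  have step: "P (z(i := u))" if z: "good_nodes \<omega> UNIV z" "P z" for z i u
  proof -
    have "?M (z(i := u)) = (\<chi> k. if k = i then (\<chi> l. lagr \<omega> UNIV \<xi> l u) else ?M z $ k)" by (auto simp: vec_eq_iff)
    moreover have "lagr \<omega> UNIV \<xi> l u = (\<Sum>j\<in>UNIV. lagr \<omega> UNIV \<xi> l (z j) * lagr \<omega> UNIV z j u)" for l
      by (rule Xi_interpolation[OF om z(1) N Xi_lagr[OF om _ _ N]]) auto
    then have "(\<chi> l. lagr \<omega> UNIV \<xi> l u) = (\<Sum>j\<in>UNIV. lagr \<omega> UNIV z j u *s ?M z $ j)"
      by (simp add: vec_eq_iff mult.commute)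
    ultimately have "det (?M (z(i := u))) = lagr \<omega> UNIV z i u * det (?M z)"
      using det_replace_row[of "\<chi> l. lagr \<omega> UNIV \<xi> l u" "\<lambda>j. lagr \<omega> UNIV z j u" "?M z" i] by simp
    then show ?thesis using z(2) unfolding P_def ell_vand_lagr[OF z(1)] by (simp add: mult_ac)
  qed
  have hop: "P w" if P: "P z" and g: "\<And>S. good_nodes \<omega> UNIV (\<lambda>i. if i \<in> S then w i else z i)" for z w
  proof -
    have "P (\<lambda>i. if i \<in> S then w i else z i)" if "finite S" for S using that
    proof induction
      case empty then show ?case using P by simp
    next
      case (insert k S)
      have "(\<lambda>i. if i \<in> insert k S then w i else z i) = (\<lambda>i. if i \<in> S then w i else z i)(k := w k)" by auto
      then show ?case using step[OF g[of S] insert.IH, of k "w k"] by simp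
    qed
    from this[of UNIV] show ?thesis by simp
  qed
  have P0: "P \<xi>"
  proof -
    have "?M \<xi> = mat 1" using lagr_node[OF om \<xi>] by (auto simp: vec_eq_iff mat_def)
    then show ?thesis by (simp add: P_def)
  qed
  have "\<exists>y :: 'n \<Rightarrow> complex. good_nodes \<omega> UNIV y \<and> (\<forall>i. \<forall>a\<in>range \<xi> \<union> range x. theta_s \<omega> (y i) a \<noteq> 0)"
    by (rule generic_nodes) simp
  then obtain y :: "'n \<Rightarrow> complex" where y: "good_nodes \<omega> UNIV y" "\<forall>i. \<forall>a\<in>range \<xi> \<union> range x. theta_s \<omega> (y i) a \<noteq> 0"
    by blast
  have mix: "good_nodes \<omega> UNIV (\<lambda>i. if i \<in> S then a i else b i)"
    if "good_nodes \<omega> UNIV a" "good_nodes \<omega> UNIV b" "\<And>i j. theta_s \<omega> (a i) (b j) \<noteq> 0" for a b :: "'n \<Rightarrow> complex" and S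
    using that theta_s_commute[OF om, of "b _" "a _"] unfolding good_nodes_def[OF om] by auto
  have "P y" by (rule hop[OF P0]) (intro mix y \<xi>, use y(2) in auto)
  then have "P x"
  proof (rule hop)
    have "theta_s \<omega> (x i) (y j) \<noteq> 0" for i j using y(2) theta_s_commute[OF om, of "x i" "y j"] by auto
    then show "good_nodes \<omega> UNIV (\<lambda>i. if i \<in> S then x i else y i)" for S by (intro mix x y(1))
  qed
  then show ?thesis by (simp add: P_def)
qed

theorem Xi_basis_det:
  fixes \<xi> :: "'n::{finite,linorder} \<Rightarrow> complex" and \<Theta> :: "'n \<Rightarrow> complex \<Rightarrow> complex"
  assumes \<xi>: "good_nodes \<omega> UNIV \<xi>" and \<Theta>: "Xi_basis \<omega> \<Theta>"
  shows "det (\<chi> i j. \<Theta> j (\<xi> i)) \<noteq> 0"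
    and "good_nodes \<omega> UNIV x \<Longrightarrow> det (\<chi> i j. \<Theta> j (x i)) * ell_vand \<omega> \<xi> = ell_vand \<omega> x * det (\<chi> i j. \<Theta> j (\<xi> i))"
proof -
  obtain N where N: "CARD('n) = Suc N" using zero_less_card_finite[where 'a = 'n] by (metis Suc_pred)
  have X: "\<Theta> j \<in> Xi_space \<omega> (Suc N)" for j
    using \<Theta> cfun.span_base[of "\<Theta> j" "range \<Theta>"] unfolding Xi_basis_def N by auto
  show "det (\<chi> i j. \<Theta> j (\<xi> i)) \<noteq> 0"
  proof -
    have "\<exists>c. \<forall>u. lagr \<omega> UNIV \<xi> k u = (\<Sum>j\<in>UNIV. c j * \<Theta> j u)" for k
    proof -
      have "lagr \<omega> UNIV \<xi> k \<in> cfun.span (range \<Theta>)"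
        using Xi_lagr[OF om _ _ N, of k \<xi>] \<Theta> unfolding Xi_basis_def N by auto
      then obtain u where u: "lagr \<omega> UNIV \<xi> k = (\<Sum>v\<in>range \<Theta>. (\<lambda>t. u v * v t))"
        unfolding cfun.span_finite[OF finite_imageI[OF finite]] by auto
      have inj: "inj \<Theta>" using \<Theta> by (simp add: Xi_basis_def)
      have "lagr \<omega> UNIV \<xi> k = (\<Sum>j\<in>UNIV. (\<lambda>t. u (\<Theta> j) * \<Theta> j t))" unfolding u by (simp add: sum.reindex[OF inj])
      moreover have "(\<Sum>j\<in>S. (\<lambda>t. u (\<Theta> j) * \<Theta> j t)) t = (\<Sum>j\<in>S. u (\<Theta> j) * \<Theta> j t)" for S t
        by (induction S rule: infinite_finite_induct) auto
      ultimately show ?thesis by (intro exI[of _ "\<lambda>j. u (\<Theta> j)"]) auto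
    qed
    then obtain c where c: "lagr \<omega> UNIV \<xi> k u = (\<Sum>j\<in>UNIV. c k j * \<Theta> j u)" for k u by metis
    have "(\<chi> i j. \<Theta> j (\<xi> i)) ** (\<chi> j k. c k j) = mat 1"
      using lagr_node[OF om \<xi>] c by (auto simp: vec_eq_iff matrix_matrix_mult_def mat_def mult.commute)
    then have "det (\<chi> i j. \<Theta> j (\<xi> i)) * det (\<chi> j k. c k j) = 1" by (metis det_I det_mul)
    then show ?thesis by auto
  qed
  assume x: "good_nodes \<omega> UNIV x"
  have "\<Theta> j (x i) = (\<Sum>k\<in>UNIV. \<Theta> j (\<xi> k) * lagr \<omega> UNIV \<xi> k (x i))" for i j
    by (rule Xi_interpolation[OF om \<xi> N X])
  then have "(\<chi> i j. \<Theta> j (x i)) = (\<chi> i k. lagr \<omega> UNIV \<xi> k (x i)) ** (\<chi> k j. \<Theta> j (\<xi> k))"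
    by (simp add: vec_eq_iff matrix_matrix_mult_def mult.commute)
  then have "det (\<chi> i j. \<Theta> j (x i)) = det (\<chi> i k. lagr \<omega> UNIV \<xi> k (x i)) * det (\<chi> k j. \<Theta> j (\<xi> k))" by (simp add: det_mul)
  then show "det (\<chi> i j. \<Theta> j (x i)) * ell_vand \<omega> \<xi> = ell_vand \<omega> x * det (\<chi> i j. \<Theta> j (\<xi> i))"
    using lagr_det[OF \<xi> x] by (simp add: mult_ac)
qed

end

section \<open>Orthogonality of separated states\<close>

lemma scale_mat_simps:
  "scale_mat c A ** B = scale_mat c (A ** B)" "A ** scale_mat c B = scale_mat c (A ** B)"
  "scale_mat c (scale_mat d A) = scale_mat (c * d) A" "scale_mat 1 A = A"
  "x v* scale_mat c A = c *s (x v* A)"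
  by (auto simp: scale_mat_def vec_eq_iff matrix_matrix_mult_def vector_matrix_mult_def sum_distrib_left mult_ac
      intro!: sum.cong)

lemma vector_matrix_linear:
  fixes x x' :: "complex ^ 'k::finite" and A B :: "complex ^ 'k ^ 'k"
  shows "(x + x') v* A = x v* A + x' v* A" "(c *s x) v* A = c *s (x v* A)" "x v* (A + B) = x v* A + x v* B"
    "(\<Sum>i\<in>I. f i) v* A = (\<Sum>i\<in>I. f i v* A)"
proof -
  show 1: "(x + x') v* A = x v* A + x' v* A" for x x' :: "complex ^ 'k"
    by (simp add: vector_matrix_mult_def vec_eq_iff distrib_right distrib_left sum.distrib)
  show "(\<Sum>i\<in>I. f i) v* A = (\<Sum>i\<in>I. f i v* A)"
    by (induction I rule: infinite_finite_induct) (auto simp: 1)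
qed (simp_all add: vector_matrix_mult_def vec_eq_iff distrib_right distrib_left sum.distrib sum_distrib_left mult_ac)

lemma vector_matrix_sum: "x v* (\<Sum>i\<in>I. A i) = (\<Sum>i\<in>I. x v* A i)" for x :: "complex ^ 'k::finite"
  by (induction I rule: infinite_finite_induct) (auto simp: vector_matrix_mult_def vec_eq_iff distrib_left sum.distrib)

lemma pairing_matrix: "pairing x (A *v z) = pairing (x v* A) z"
  unfolding pairing_def matrix_vector_mult_def vector_matrix_mult_def
  by (simp add: sum_distrib_left sum_distrib_right mult_ac) (rule sum.swap)

lemma pairing_linear: "pairing (x + x') z = pairing x z + pairing x' z" "pairing (c *s x) z = c * pairing x z"
  "pairing (\<Sum>i\<in>I. f i) z = (\<Sum>i\<in>I. pairing (f i) z)"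
  "pairing x (c *s z) = c * pairing x z" "pairing x (\<Sum>i\<in>I. f' i) = (\<Sum>i\<in>I. pairing x (f' i))"
proof -
  show "pairing (\<Sum>i\<in>I. f i) z = (\<Sum>i\<in>I. pairing (f i) z)" 
    unfolding pairing_def by (simp add: sum_distrib_right) (rule sum.swap)
  show "pairing x (\<Sum>i\<in>I. f' i) = (\<Sum>i\<in>I. pairing x (f' i))"
    unfolding pairing_def by (simp add: sum_distrib_left) (rule sum.swap)
qed (simp_all add: pairing_def distrib_right distrib_left sum.distrib sum_distrib_left mult_ac)

lemma list_prod_simps [simp]: "list_prod [] = mat 1" "list_prod (A # As) = A ** list_prod As"
  by (simp_all add: list_prod_def)

text \<open>A factor that commutes with all others can be moved to any place of an ordered product.\<close>

lemma list_prod_insert: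
  assumes "distinct L" "n \<in> set L" "\<And>m. m \<in> set L \<Longrightarrow> m \<noteq> n \<Longrightarrow> f m ** M = M ** f m"
  shows "list_prod (map f L) ** M = list_prod (map (f(n := f n ** M)) L)"
  using assms
proof (induction L)
  case (Cons a L)
  show ?case
  proof (cases "a = n")
    case True
    then have "n \<notin> set L" using Cons.prems by auto
    have "list_prod (map f L') ** M = M ** list_prod (map f L')" if "set L' \<subseteq> set L" for L'
      using that
    proof (induction L')
      case (Cons b L')
      then have "f b ** M = M ** f b" using Cons.prems \<open>n \<notin> set L\<close> \<open>\<And>m. m \<in> set (a # L) \<Longrightarrow> m \<noteq> n \<Longrightarrow> f m ** M = M ** f m\<close> by auto
      then show ?case using Cons by (simp add: matrix_mul_assoc[symmetric]) (simp add: matrix_mul_assoc)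
    qed simp
    from this[of L] show ?thesis using True \<open>n \<notin> set L\<close>
      by (simp add: matrix_mul_assoc[symmetric] map_fun_upd del: fun_upd_apply) (simp add: fun_upd_same matrix_mul_assoc)
  next
    case False
    then show ?thesis using Cons by (simp add: matrix_mul_assoc[symmetric])
  qed
qed simp

lemma distinct_sites: "distinct (sites :: 'n::{finite,linorder} list)" and set_sites: "set (sites :: 'n::{finite,linorder} list) = UNIV"
  by (simp_all add: sites_def)

text \<open>
  The orthogonality of the left states \<open>g h\<close> to the right states, for two families \<open>Tm\<close> and \<open>Tp\<close> of operators, one of each
  for every site. Acting on the covector \<open>g h\<close>, \<open>Tm n\<close> turns a label \<open>h n = True\<close> into \<open>False\<close>, and \<open>Tp n\<close> turns a label
  \<open>h n = False\<close> into \<open>True\<close> because \<open>Tm n ** Tp n\<close> is a scalar. If \<open>h n = True\<close>, the relation \<open>interp\<close> expands \<open>Tp n\<close>; all terms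
  except the one with \<open>Tm n\<close> keep that label, so that they do not contribute to the pairing.
\<close>

lemma sov_orthogonality:
  fixes Tp Tm :: "'n::{finite,linorder} \<Rightarrow> 'n chain_op" and A b :: "'n \<Rightarrow> complex" and S R :: "'n chain_vec"
    and q :: "('n \<Rightarrow> bool) \<Rightarrow> 'n \<Rightarrow> complex" and N :: "('n \<Rightarrow> bool) \<Rightarrow> complex"
  defines "g h \<equiv> S v* list_prod (map (\<lambda>n. if h n then mat 1 else scale_mat (1 / A n) (Tm n)) sites)"
  assumes mm: "\<And>m n. Tm m ** Tm n = Tm n ** Tm m" and mp: "\<And>m n. Tm m ** Tp n = Tp n ** Tm m"
    and inv: "\<And>n. \<exists>s. Tm n ** Tp n = scale_mat s (mat 1)"
    and interp: "\<And>h n. h n \<Longrightarrow> \<exists>L s. Tp n = (\<Sum>a\<in>UNIV. scale_mat (L a) (if h a then Tm a else Tp a)) + scale_mat s (mat 1) \<and> L n = q h n"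
    and A: "\<And>n. A n \<noteq> 0"
    and N: "\<And>h n. h n \<Longrightarrow> b n * (q h n * A n) * N (h(n := False)) = N h"
    and R: "\<And>h. pairing (g h) R = (if h = (\<lambda>_. False) then N h else 0)"
  shows "pairing (g h) (list_prod (map (\<lambda>n. if k n then scale_mat (b n) (Tp n) else mat 1) sites) *v R)
    = (if h = k then N h else 0)"
proof -
  let ?f = "\<lambda>h n. if h n then mat 1 else scale_mat (1 / A n) (Tm n)"
  have upd: "g h v* M = S v* list_prod (map ((?f h)(n := ?f h n ** M)) sites)"
    if "\<And>m. Tm m ** M = M ** Tm m" for h n M
  proof -
    have "list_prod (map (?f h) sites) ** M = list_prod (map ((?f h)(n := ?f h n ** M)) sites)"
      by (rule list_prod_insert) (auto simp: distinct_sites set_sites that scale_mat_simps)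
    then show ?thesis by (simp only: g_def vector_matrix_mul_assoc)
  qed
  have sc: "S v* list_prod (map ((?f h)(n := scale_mat c (?f h n))) sites) = c *s g h" for h n c
    using upd[of "scale_mat c (mat 1)" h n] by (simp add: scale_mat_simps)
  \<comment> \<open>The action of \<open>Tp n\<close> and \<open>Tm n\<close> on the label of \<open>n\<close>.\<close>
  have a: "\<exists>c. g h v* Tp n = c *s g (h(n := True))" if "\<not> h n" for h n
  proof -
    obtain s where s: "Tm n ** Tp n = scale_mat s (mat 1)" using inv by blast
    have "(?f h)(n := ?f h n ** Tp n) = (?f (h(n := True)))(n := scale_mat (s / A n) (?f (h(n := True)) n))"
      using that by (auto simp: fun_eq_iff scale_mat_simps s)
    then show ?thesis using upd[of "Tp n" h n] mp sc[of "h(n := True)" n "s / A n"] by metis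
  qed
  have b: "g h v* Tm n = A n *s g (h(n := False))" if "h n" for h n
  proof -
    have "(?f h)(n := ?f h n ** Tm n) = (?f (h(n := False)))(n := scale_mat (A n) (?f (h(n := False)) n))"
      using that A[of n] by (auto simp: fun_eq_iff scale_mat_simps)
    then show ?thesis using upd[of "Tm n" h n] mm sc[of "h(n := False)" n "A n"] by metis
  qed
  \<comment> \<open>The operators \<open>Tp n\<close> of the right state act on the left state one after the other.\<close>
  have main: "(\<Prod>n\<leftarrow>l. b n) * pairing (g h v* list_prod (map Tp l)) R = (if h = (\<lambda>n. n \<in> set l) then N h else 0)"
    if "distinct l" for h l
    using that
  proof (induction l arbitrary: h)
    case Nil then show ?case using R by simp
  next
    case (Cons n l)
    let ?F = "\<lambda>h. pairing (g h v* list_prod (map Tp l)) R" and ?B = "\<Prod>n\<leftarrow>l. b n"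
    have n: "n \<notin> set l" using Cons.prems by auto
    have IH: "?B * ?F h = (if h = (\<lambda>n. n \<in> set l) then N h else 0)" for h using Cons by auto
    have IH0: "?B * ?F h = 0" if "h n" for h using that n IH[of h] by auto
    have e: "g h v* list_prod (map Tp (n # l)) = (g h v* Tp n) v* list_prod (map Tp l)" by (simp add: vector_matrix_mul_assoc)
    show ?case
    proof (cases "h n")
      case False
      then obtain c where "g h v* Tp n = c *s g (h(n := True))" using a by blast
      then have "(\<Prod>n\<leftarrow>n # l. b n) * pairing (g h v* list_prod (map Tp (n # l))) R = b n * c * (?B * ?F (h(n := True)))"
        unfolding e by (simp add: pairing_linear vector_matrix_linear)
      also have "\<dots> = 0" using IH0[of "h(n := True)"] by simp
      finally show ?thesis using False by auto
    next
      case True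
      obtain L s where L: "Tp n = (\<Sum>a\<in>UNIV. scale_mat (L a) (if h a then Tm a else Tp a)) + scale_mat s (mat 1)" "L n = q h n"
        using interp[of h n] True by blast
      have d: "\<exists>c h'. g h v* (if h a then Tm a else Tp a) = c *s g h' \<and> h' n" if an: "a \<noteq> n" for a
      proof (cases "h a")
        case True then show ?thesis using b[of h a] an \<open>h n\<close> by (intro exI[of _ "A a"] exI[of _ "h(a := False)"]) auto
      next
        case False
        moreover obtain c where "g h v* Tp a = c *s g (h(a := True))" using a[of h a] False by blast
        ultimately show ?thesis using an \<open>h n\<close> by (intro exI[of _ c] exI[of _ "h(a := True)"]) simp
      qed
      have dz: "?B * pairing ((g h v* (if h a then Tm a else Tp a)) v* list_prod (map Tp l)) R = 0" if an: "a \<noteq> n" for a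
      proof -
        obtain c h' where "g h v* (if h a then Tm a else Tp a) = c *s g h'" "h' n" using d[of a] an by blast
        then show ?thesis using IH0[of h'] by (auto simp: pairing_linear vector_matrix_linear)
      qed
      have "g h v* Tp n = (\<Sum>a\<in>UNIV. L a *s (g h v* (if h a then Tm a else Tp a))) + s *s g h"
        unfolding L(1) by (simp add: vector_matrix_linear vector_matrix_sum scale_mat_simps)
      then have "pairing (g h v* list_prod (map Tp (n # l))) R
          = (\<Sum>a\<in>UNIV. L a * pairing ((g h v* (if h a then Tm a else Tp a)) v* list_prod (map Tp l)) R) + s * ?F h"
        unfolding e by (simp add: vector_matrix_linear pairing_linear)
      then have "?B * pairing (g h v* list_prod (map Tp (n # l))) R
          = (\<Sum>a\<in>UNIV. L a * (?B * pairing ((g h v* (if h a then Tm a else Tp a)) v* list_prod (map Tp l)) R)) + s * (?B * ?F h)"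
        by (simp add: distrib_left sum_distrib_left mult_ac)
      also have "\<dots> = (\<Sum>a\<in>UNIV. if a = n then L n * (?B * pairing ((g h v* Tm n) v* list_prod (map Tp l)) R) else 0)"
        proof -
        have "L a * (?B * pairing ((g h v* (if h a then Tm a else Tp a)) v* list_prod (map Tp l)) R)
            = (if a = n then L n * (?B * pairing ((g h v* Tm n) v* list_prod (map Tp l)) R) else 0)" for a
          by (cases "a = n") (use True dz[of a] in simp_all)
        then show ?thesis by (simp only: IH0[of h, OF True] mult_zero_right add_0_right)
      qed
      also have "\<dots> = q h n * A n * (?B * ?F (h(n := False)))"
        by (simp add: b[of h n, OF True] L(2) vector_matrix_linear pairing_linear)
      finally have "(\<Prod>n\<leftarrow>n # l. b n) * pairing (g h v* list_prod (map Tp (n # l))) R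
          = b n * (q h n * A n) * (if h(n := False) = (\<lambda>n. n \<in> set l) then N (h(n := False)) else 0)"
        unfolding IH by simp
      also have "\<dots> = (if h(n := False) = (\<lambda>n. n \<in> set l) then N h else 0)" by (simp only: N[of h n, OF True] mult_zero_right if_distrib[of "\<lambda>x. b n * (q h n * A n) * x"])
      also have "h(n := False) = (\<lambda>n. n \<in> set l) \<longleftrightarrow> h = (\<lambda>m. m \<in> set (n # l))"
        using n True by (auto simp: fun_eq_iff)
      finally show ?thesis .
    qed
  qed
  have k: "list_prod (map (\<lambda>n. if k n then scale_mat (b n) (Tp n) else mat 1) L)
      = scale_mat (\<Prod>n\<leftarrow>filter k L. b n) (list_prod (map Tp (filter k L)))" for L
    by (induction L) (auto simp: scale_mat_simps mult.commute)
  have "pairing (g h) (list_prod (map (\<lambda>n. if k n then scale_mat (b n) (Tp n) else mat 1) sites) *v R)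
      = (\<Prod>n\<leftarrow>filter k sites. b n) * pairing (g h v* list_prod (map Tp (filter k sites))) R"
    unfolding pairing_matrix k by (simp add: scale_mat_simps pairing_linear)
  also have "\<dots> = (if h = (\<lambda>n. n \<in> set (filter k sites)) then N h else 0)"
    by (rule main) (simp add: distinct_sites)
  also have "(\<lambda>n. n \<in> set (filter k sites)) = k" by (auto simp: set_sites)
  finally show ?thesis .
qed

section \<open>Operators on a spin chain as a ring\<close>

text \<open>The square matrices indexed by the configurations of a set of sites, made into a type so that they form a ring.\<close>

typedef 'i op = "UNIV :: (complex ^ ('i::finite \<Rightarrow> bool) ^ ('i \<Rightarrow> bool)) set"
  morphisms mat_of Op by simp

text \<open>Matrix entries.\<close>

definition ent :: "'i::finite op \<Rightarrow> ('i \<Rightarrow> bool) \<Rightarrow> ('i \<Rightarrow> bool) \<Rightarrow> complex" where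
  "ent a s t = mat_of a $ s $ t"

lemma op_eqI: "(\<And>s t. ent a s t = ent b s t) \<Longrightarrow> a = b"
  by (simp add: ent_def mat_of_inject[symmetric] vec_eq_iff)

lemma ent_Op [simp]: "ent (Op M) s t = M $ s $ t" by (simp add: ent_def Op_inverse)

instantiation op :: (finite) ring_1
begin
definition "0 = Op 0"
definition "1 = Op (mat 1)"
definition "a + b = Op (mat_of a + mat_of b)" for a b :: "'a op"
definition "a - b = Op (mat_of a - mat_of b)" for a b :: "'a op"
definition "- a = Op (- mat_of a)" for a :: "'a op"
definition "a * b = Op (mat_of a ** mat_of b)" for a b :: "'a op"
lemmas op_defs = zero_op_def one_op_def plus_op_def minus_op_def uminus_op_def times_op_def
instance
proof
  fix a b c :: "'a op"
  obtain M1 M2 M3 where "a = Op M1" "b = Op M2" "c = Op M3" by (metis mat_of_inverse)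
  then show "a * b * c = a * (b * c)" "(a + b) * c = a * c + b * c" "a * (b + c) = a * b + a * c"
    "1 * a = a" "a * 1 = a" "a + b + c = a + (b + c)" "a + b = b + a" "0 + a = a" "- a + a = 0" "a - b = a + - b"
    by (simp_all add: op_defs Op_inverse Op_inject matrix_mul_assoc matrix_add_ldistrib add.assoc)
      (simp_all add: matrix_matrix_mult_def vec_eq_iff distrib_right sum.distrib add.commute)
  have "Op 0 \<noteq> (Op (mat 1) :: 'a op)"
    by (auto simp: Op_inject vec_eq_iff mat_def)
  then show "(0 :: 'a op) \<noteq> 1" by (simp add: op_defs)
qed
end

lemma ent_simps:
  "ent 0 s t = 0" "ent 1 s t = (if s = t then 1 else 0)" "ent (a + b) s t = ent a s t + ent b s t"
  "ent (a - b) s t = ent a s t - ent b s t" "ent (- a) s t = - ent a s t"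
  by (simp_all add: op_defs mat_def) (simp_all add: ent_def)

lemma ent_mult: "ent (a * b) s t = (\<Sum>r\<in>UNIV. ent a s r * ent b r t)"
  by (simp add: times_op_def matrix_matrix_mult_def) (simp add: ent_def)

text \<open>Reversal of the spin at one site.\<close>

definition flip :: "'i \<Rightarrow> ('i \<Rightarrow> bool) \<Rightarrow> 'i \<Rightarrow> bool" where "flip i s = s(i := \<not> s i)"

lemma flip_simps [simp]: "flip i (flip i s) = s" "flip i s i = (\<not> s i)" "j \<noteq> i \<Longrightarrow> flip i s j = s j"
  by (simp_all add: flip_def fun_eq_iff)

lemma flip_commute: "flip i (flip j s) = flip j (flip i s)"
  by (cases "i = j") (auto simp: flip_def fun_upd_twist)

lemma flip_eq: "flip i s = t \<longleftrightarrow> s = flip i t" by auto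

text \<open>Scalars and Pauli operators. The label \<open>True\<close> is the second standard basis vector, where \<open>op_z\<close> has the entry \<open>- 1\<close>.\<close>

definition op_sc :: "complex \<Rightarrow> 'i::finite op" where "op_sc c = Op (\<chi> s t. if s = t then c else 0)"
definition op_x :: "'i \<Rightarrow> 'i::finite op" where "op_x i = Op (\<chi> s t. if t = flip i s then 1 else 0)"
definition op_z :: "'i \<Rightarrow> 'i::finite op" where "op_z i = Op (\<chi> s t. if s = t then if s i then - 1 else 1 else 0)"

lemma sum_delta_mult:
  "(\<Sum>r\<in>UNIV. (if s = r then c else 0) * f r) = c * f s" "(\<Sum>r\<in>UNIV. (if r = s then c else 0) * f r) = c * f s"
  "(\<Sum>r\<in>UNIV. f r * (if r = s then c else 0)) = f s * c" "(\<Sum>r\<in>UNIV. f r * (if s = r then c else 0)) = f s * c"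
  for c :: complex and s :: "'a::finite"
  using sum.delta[of UNIV s "\<lambda>r. c * f r"] sum.delta'[of UNIV s "\<lambda>r. c * f r"]
  by (simp_all add: if_distrib[of "\<lambda>x. x * _"] if_distrib[of "\<lambda>x. _ * x"] mult.commute cong: if_cong)

lemma ent_pauli:
  "ent (op_sc c) s t = (if s = t then c else 0)"
  "ent (op_x i) s t = (if t = flip i s then 1 else 0)"
  "ent (op_z i) s t = (if s = t then if s i then - 1 else 1 else 0)"
  "ent (op_sc c * a) s t = c * ent a s t"
  "ent (a * op_sc c) s t = ent a s t * c"
  "ent (op_x i * a) s t = ent a (flip i s) t"
  "ent (a * op_x i) s t = ent a s (flip i t)"
  "ent (op_z i * a) s t = (if s i then - ent a s t else ent a s t)"
  "ent (a * op_z i) s t = (if t i then - ent a s t else ent a s t)"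
proof -
  show 1: "ent (op_sc c) s t = (if s = t then c else 0)" "ent (op_x i) s t = (if t = flip i s then 1 else 0)"
    "ent (op_z i) s t = (if s = t then if s i then - 1 else 1 else 0)" for s t i
    by (simp_all add: op_sc_def op_x_def op_z_def)
  have 2: "ent (op_x i) s t = (if s = flip i t then 1 else 0)" for s t by (auto simp: 1)
  have 3: "ent (op_z i) s t = (if s = t then if t i then - 1 else 1 else 0)" for s t by (auto simp: 1)
  show "ent (op_sc c * a) s t = c * ent a s t" "ent (a * op_sc c) s t = ent a s t * c"
    "ent (op_z i * a) s t = (if s i then - ent a s t else ent a s t)"
    "ent (op_x i * a) s t = ent a (flip i s) t"
    unfolding ent_mult 1 sum_delta_mult by auto
  show "ent (a * op_x i) s t = ent a s (flip i t)" unfolding ent_mult 2 sum_delta_mult by simp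
  show "ent (a * op_z i) s t = (if t i then - ent a s t else ent a s t)"
    unfolding ent_mult 3 sum_delta_mult by simp
qed

lemma pauli_op: "pauli op_sc op_x op_z"
  by unfold_locales (auto intro!: op_eqI simp: ent_simps ent_pauli flip_commute flip_eq)

text \<open>
  When the configurations are identified with pairs \<open>(f s, g s)\<close>, a matrix \<open>A\<close> indexed by the first components acts
  on the first tensor factor as \<open>A \<otimes> 1\<close>.
\<close>

definition amplify :: "(('i \<Rightarrow> bool) \<Rightarrow> 'c) \<Rightarrow> (('i \<Rightarrow> bool) \<Rightarrow> 'k) \<Rightarrow> complex ^ 'c ^ 'c \<Rightarrow> 'i::finite op" where
  "amplify f g A = Op (\<chi> s t. if g s = g t then A $ f s $ f t else 0)"

lemma ent_amplify: "ent (amplify f g A) s t = (if g s = g t then A $ f s $ f t else 0)"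
  by (simp add: amplify_def)

lemma amplify_mult:
  fixes f :: "('i::finite \<Rightarrow> bool) \<Rightarrow> 'c::finite" and g :: "('i \<Rightarrow> bool) \<Rightarrow> 'k"
  assumes "bij (\<lambda>s. (f s, g s))"
  shows "amplify f g (A ** B) = amplify f g A * amplify f g B"
proof (rule op_eqI)
  fix s t
  have inj: "inj_on f {r. g r = g s}" using assms by (auto simp: bij_def inj_on_def)
  have im: "f ` {r. g r = g s} = UNIV"
  proof -
    have "c \<in> f ` {r. g r = g s}" for c
    proof -
      have "(c, g s) \<in> range (\<lambda>s. (f s, g s))" using assms by (simp add: bij_def)
      then show ?thesis by auto
    qed
    then show ?thesis by blast
  qed
  have "ent (amplify f g A * amplify f g B) s t
      = (\<Sum>r\<in>UNIV. if g r = g s then if g s = g t then A $ f s $ f r * B $ f r $ f t else 0 else 0)"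
    unfolding ent_mult ent_amplify by (rule sum.cong) auto
  also have "\<dots> = (\<Sum>r | g r = g s. if g s = g t then A $ f s $ f r * B $ f r $ f t else 0)"
    by (simp add: sum.If_cases)
  also have "\<dots> = (\<Sum>c\<in>UNIV. if g s = g t then A $ f s $ c * B $ c $ f t else 0)"
    unfolding im[symmetric] by (simp add: sum.reindex[OF inj])
  also have "\<dots> = ent (amplify f g (A ** B)) s t"
    by (simp add: ent_amplify matrix_matrix_mult_def)
  finally show "ent (amplify f g (A ** B)) s t = ent (amplify f g A * amplify f g B) s t" by simp
qed

lemma amplify_linear:
  "amplify f g (A + B) = amplify f g A + amplify f g B" "amplify f g (scale_mat c A) = op_sc c * amplify f g A"
  by (auto intro!: op_eqI simp: ent_simps ent_pauli ent_amplify scale_mat_def)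

lemma amplify_one: "bij (\<lambda>s. (f s, g s)) \<Longrightarrow> amplify f g (mat 1) = 1"
  by (auto intro!: op_eqI simp: ent_simps ent_amplify mat_def bij_def inj_def)

lemma amplify_inj:
  fixes f :: "('i::finite \<Rightarrow> bool) \<Rightarrow> 'c::finite" and g :: "('i \<Rightarrow> bool) \<Rightarrow> 'k"
  assumes "bij (\<lambda>s. (f s, g s))" "amplify f g A = amplify f g B"
  shows "A = B"
proof -
  have "A $ c $ d = B $ c $ d" for c d
  proof -
    obtain k :: 'k where True by simp
    have "(c, k) \<in> range (\<lambda>s. (f s, g s))" "(d, k) \<in> range (\<lambda>s. (f s, g s))" using assms by (simp_all add: bij_def)
    then obtain s t where "f s = c" "g s = k" "f t = d" "g t = k" by auto
    then show ?thesis using arg_cong[OF assms(2), of "\<lambda>a. ent a s t"] by (simp add: ent_amplify)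
  qed
  then show ?thesis by (simp add: vec_eq_iff)
qed

lemma amplify_list_prod:
  fixes f :: "('i::finite \<Rightarrow> bool) \<Rightarrow> 'c::finite"
  assumes "bij (\<lambda>s. (f s, g s))"
  shows "amplify f g (list_prod As) = prod_list (map (amplify f g) As)"
  by (induction As) (simp_all add: amplify_one[OF assms] amplify_mult[OF assms])

text \<open>
  The sites are those of the chain, tagged by \<open>Inr\<close>, the auxiliary site \<open>aux\<close> of the transfer matrix, and a second auxiliary
  site \<open>spare\<close>, which the proof of commutativity needs.
\<close>

abbreviation aux :: "bool + 'n" where "aux \<equiv> Inl False"
abbreviation spare :: "bool + 'n" where "spare \<equiv> Inl True"

text \<open>Operators on the auxiliary site and the chain, and operators on the chain, as elements of the ring.\<close>

definition emb_ext :: "'n::finite ext_op \<Rightarrow> (bool + 'n) op" where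
  "emb_ext = amplify (\<lambda>s. (s aux, s \<circ> Inr)) (\<lambda>s. s spare)"
definition emb_chain :: "'n::finite chain_op \<Rightarrow> (bool + 'n) op" where
  "emb_chain = amplify (\<lambda>s. s \<circ> Inr) (\<lambda>s. (s aux, s spare))"

lemma config_eq: "s = t \<longleftrightarrow> s aux = t aux \<and> s spare = t spare \<and> s \<circ> Inr = t \<circ> Inr"
  for s t :: "bool + 'n \<Rightarrow> bool"
proof
  assume a: "s aux = t aux \<and> s spare = t spare \<and> s \<circ> Inr = t \<circ> Inr"
  have "s x = t x" for x
  proof (cases x)
    case (Inl b) then show ?thesis using a by (cases b) auto
  next
    case (Inr n) then show ?thesis using a by (simp add: fun_eq_iff)
  qed
  then show "s = t" by blast
qed simp

lemma bij_config:
  "bij (\<lambda>s :: bool + 'n \<Rightarrow> bool. ((s aux, s \<circ> Inr), s spare))"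
  "bij (\<lambda>s :: bool + 'n \<Rightarrow> bool. (s \<circ> Inr, (s aux, s spare)))"
proof -
  have "\<exists>s :: bool + 'n \<Rightarrow> bool. s aux = a \<and> s \<circ> Inr = q \<and> s spare = b" for a b q
    by (rule exI[of _ "case_sum (\<lambda>c. if c then b else a) q"]) (auto simp: fun_eq_iff)
  note ex = this
  show "bij (\<lambda>s :: bool + 'n \<Rightarrow> bool. ((s aux, s \<circ> Inr), s spare))"
  proof (rule bijI)
    show "inj (\<lambda>s :: bool + 'n \<Rightarrow> bool. ((s aux, s \<circ> Inr), s spare))"
      by (rule injI, rule config_eq[THEN iffD2]) simp
    show "surj (\<lambda>s :: bool + 'n \<Rightarrow> bool. ((s aux, s \<circ> Inr), s spare))"
      unfolding surj_def split_paired_All using ex by metis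
  qed
  show "bij (\<lambda>s :: bool + 'n \<Rightarrow> bool. (s \<circ> Inr, (s aux, s spare)))"
  proof (rule bijI)
    show "inj (\<lambda>s :: bool + 'n \<Rightarrow> bool. (s \<circ> Inr, (s aux, s spare)))"
      by (rule injI, rule config_eq[THEN iffD2]) simp
    show "surj (\<lambda>s :: bool + 'n \<Rightarrow> bool. (s \<circ> Inr, (s aux, s spare)))"
      unfolding surj_def split_paired_All using ex by metis
  qed
qed

lemmas emb_ext_mult = amplify_mult[OF bij_config(1), folded emb_ext_def]
  and emb_ext_list_prod = amplify_list_prod[OF bij_config(1), folded emb_ext_def]
  and emb_chain_mult = amplify_mult[OF bij_config(2), folded emb_chain_def]
  and emb_chain_one = amplify_one[OF bij_config(2), folded emb_chain_def]
  and emb_chain_inj = amplify_inj[OF bij_config(2), folded emb_chain_def]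
  and emb_chain_linear = amplify_linear[of "\<lambda>s. s \<circ> Inr" "\<lambda>s. (s aux, s spare)", folded emb_chain_def]

interpretation op: pauli op_sc "op_x :: 'i \<Rightarrow> 'i::finite op" op_z by (rule pauli_op)

lemma ent_y: "ent (op.Y i * a) s t = (if s i then - ent a (flip i s) t else ent a (flip i s) t)"
  "ent (op.Y i) s t = (if t = flip i s then if s i then - 1 else 1 else 0)"
  "ent (a * op.Y i) s t = (if t i then ent a s (flip i t) else - ent a s (flip i t))"
  by (auto simp: op.Y_def ent_pauli mult.assoc) (auto simp: mult.assoc[symmetric] ent_pauli)

lemma ent_ptr: "ent (op.ptr i a) s t = (if s i = t i then ent a s t + ent a (flip i s) (flip i t) else 0)"
  by (auto simp: op.ptr_def ent_pauli ent_simps ent_y)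

lemma ent_pair: assumes ij: "i \<noteq> j"
  shows "ent (op.pair a b c d i j) s t =
   (if s = t then if s i = s j then a + d else a - d
    else if t = flip i (flip j s) then if s i = s j then b + c else b - c else 0)"
proof -
  have f: "flip i (flip j s) \<noteq> s" using ij by (metis flip_simps(2,3))
  have g: "flip j t = flip i s \<longleftrightarrow> t = flip i (flip j s)" using flip_commute flip_simps(1) by metis
  have p: "ent (op_x i * op_x j) s t = (if t = flip i (flip j s) then 1 else 0)"
    "ent (op.Y i * op.Y j) s t = (if t = flip i (flip j s) then if s i = s j then 1 else - 1 else 0)"
    "ent (op_z i * op_z j) s t = (if s = t then if s i = s j then 1 else - 1 else 0)"
    using ij by (auto simp: ent_pauli ent_y g flip_commute[of j i])
  show ?thesis
    unfolding op.pair_def ent_simps ent_pauli(1,4) p using f by auto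
qed

lemma ent_single: "ent (op.single a b c d i) s t =
   (if s = t then if s i then a - d else a + d
    else if t = flip i s then if s i then b - c else b + c else 0)"
proof -
  have "flip i s \<noteq> s" by (metis flip_simps(2))
  then show ?thesis
    unfolding op.single_def ent_simps ent_pauli(1,2,3,4) ent_y(2) by auto
qed

lemma ptr_emb_ext: "op.ptr aux (emb_ext A) = emb_chain (trace_aux A)"
proof (rule op_eqI)
  fix s t :: "bool + 'a \<Rightarrow> bool"
  have "flip aux r \<circ> Inr = r \<circ> Inr" "flip aux r spare = r spare" for r :: "bool + 'a \<Rightarrow> bool" by (auto simp: flip_def)
  then show "ent (op.ptr aux (emb_ext A)) s t = ent (emb_chain (trace_aux A)) s t"
    by (cases "t aux") (auto simp: ent_ptr emb_ext_def emb_chain_def ent_amplify trace_aux_def UNIV_bool)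
qed

text \<open>The R-matrix of an auxiliary and a chain site, and the boundary matrices, as elements of the ring.\<close>

lemma emb_ext_site:
  assumes "\<And>p q. M $ p $ q = (if p = q then (if fst p = snd p then a + d else a - d)
     else if fst p \<noteq> fst q \<and> snd p \<noteq> snd q then (if fst p = snd p then b + c else b - c) else 0)"
  shows "emb_ext (on_aux_site n M) = op.pair a b c d aux (Inr n)"
proof (rule op_eqI)
  fix s t :: "bool + 'a \<Rightarrow> bool"
  have t: "t = flip aux (flip (Inr n) s) \<longleftrightarrow> t aux \<noteq> s aux \<and> t spare = s spare \<and> t (Inr n) \<noteq> s (Inr n)
    \<and> (\<forall>m. m \<noteq> n \<longrightarrow> s (Inr m) = t (Inr m))"
    unfolding config_eq by (auto simp: flip_def fun_eq_iff)
  have e: "s = t \<longleftrightarrow> s aux = t aux \<and> s spare = t spare \<and> s (Inr n) = t (Inr n) \<and> (\<forall>m. m \<noteq> n \<longrightarrow> s (Inr m) = t (Inr m))"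
    unfolding config_eq by (auto simp: fun_eq_iff)
  have L: "ent (emb_ext (on_aux_site n M)) s t = (if s spare = t spare \<and> (\<forall>m. m \<noteq> n \<longrightarrow> s (Inr m) = t (Inr m))
      then M $ (s aux, s (Inr n)) $ (t aux, t (Inr n)) else 0)"
    unfolding emb_ext_def ent_amplify on_aux_site_def by auto
  have ne: "aux \<noteq> Inr n" by simp
  define E where "E \<longleftrightarrow> s spare = t spare \<and> (\<forall>m. m \<noteq> n \<longrightarrow> s (Inr m) = t (Inr m))"
  have t': "t = flip aux (flip (Inr n) s) \<longleftrightarrow> t aux \<noteq> s aux \<and> t (Inr n) \<noteq> s (Inr n) \<and> E"
    and e': "s = t \<longleftrightarrow> s aux = t aux \<and> s (Inr n) = t (Inr n) \<and> E"
    unfolding t e E_def by auto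
  show "ent (emb_ext (on_aux_site n M)) s t = ent (op.pair a b c d aux (Inr n)) s t"
    unfolding L[folded E_def] ent_pair[OF ne] t' e' assms prod.inject fst_conv snd_conv
    by (cases "s aux"; cases "t aux"; cases "s (Inr n)"; cases "t (Inr n)"; simp)
qed

lemma emb_ext_aux:
  assumes "\<And>p q. M $ p $ q = (if p = q then if p then a - d else a + d else if p then b - c else b + c)"
  shows "emb_ext (on_aux M) = op.single a b c d aux"
proof (rule op_eqI)
  fix s t :: "bool + 'a \<Rightarrow> bool"
  have t: "t = flip aux s \<longleftrightarrow> t aux \<noteq> s aux \<and> t spare = s spare \<and> s \<circ> Inr = t \<circ> Inr"
    unfolding config_eq by (auto simp: flip_def fun_eq_iff)
  show "ent (emb_ext (on_aux M)) s t = ent (op.single a b c d aux) s t"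
    unfolding ent_single t config_eq[of s t]
    by (auto simp: emb_ext_def ent_amplify on_aux_def assms)
qed

section \<open>The transfer matrix of the open chain\<close>

text \<open>The open XYZ chain with inhomogeneities \<open>\<zeta>\<close>, represented in the ring of operators on its extended set of sites.\<close>

locale xyz_model =
  fixes \<omega> \<eta> :: complex and \<alpha> :: "side \<Rightarrow> 3 \<Rightarrow> complex" and \<zeta> :: "'n::{finite,linorder} \<Rightarrow> complex"
  assumes om: "Im \<omega> > 0"
begin

text \<open>The inverse of the normalisation \<open>ic\<close> of the weights.\<close>

definition theta_const :: complex where "theta_const = theta2 \<omega> 0 * (theta4 (2 * \<omega>) 0)\<^sup>2"

lemma theta_const: "theta_const \<noteq> 0" by (simp add: theta_const_def theta_const_nonzero[OF om])

end

sublocale xyz_model \<subseteq> open_chain op_sc "op_x :: bool + 'n \<Rightarrow> (bool + 'n) op" op_z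
  "theta1 \<omega>" "theta2 \<omega>" "theta3 \<omega>" "theta4 \<omega>" "theta1 (2 * \<omega>)" "theta4 (2 * \<omega>)" "\<eta> / 2" "1 / theta_const"
  "case_sum (\<lambda>_. 0) \<zeta>"
  "(c_x \<omega> (\<alpha> PlusSide), c_y \<omega> (\<alpha> PlusSide), c_z \<omega> (\<alpha> PlusSide))"
  "(c_x \<omega> (\<alpha> MinusSide), c_y \<omega> (\<alpha> MinusSide), c_z \<omega> (\<alpha> MinusSide))"
  using theta1_odd[OF two_tau[OF om]] theta4_even[OF two_tau[OF om]]
  by (intro open_chain.intro xyz_chain.intro pauli_op xyz_weights.intro theta_products.intro
      theta12_prod[OF om] theta34_prod[OF om] theta1_odd[OF om] theta2_even[OF om] theta3_even[OF om] theta4_even[OF om])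

context xyz_model
begin

lemma double: "theta1 \<omega> (2 * v) = 2 * (theta1 \<omega> v * theta2 \<omega> v * theta3 \<omega> v * theta4 \<omega> v) / theta_const"
  unfolding eq_divide_eq using theta1_double[OF om, of v, folded theta_const_def] theta_const by simp

lemma weights:
  "weight_a \<omega> \<eta> u = wo u + wz u" "weight_b \<omega> \<eta> u = wo u - wz u"
  "weight_c \<omega> \<eta> u = wx u - wy u" "weight_d \<omega> \<eta> u = wx u + wy u"
proof -
  let ?A = "theta1 (2 * \<omega>)" and ?B = "theta4 (2 * \<omega>)"
  have nz: "?B 0 \<noteq> 0" "theta2 \<omega> 0 \<noteq> 0" by (simp_all add: theta_const_nonzero[OF om])
  have y: "theta3 \<omega> (\<eta>/2) * theta4 \<omega> (\<eta>/2) = ?B \<eta> * ?B 0" "theta1 \<omega> (\<eta>/2) * theta2 \<omega> (\<eta>/2) = ?A \<eta> * ?B 0"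
    using p34[of "\<eta>/2" "\<eta>/2"] p12[of "\<eta>/2" "\<eta>/2"] by simp_all
  have e: "u + \<eta>/2 + \<eta>/2 = u + \<eta>" "u + \<eta>/2 - \<eta>/2 = u" by simp_all
  note q = q12[OF refl refl, of "u + \<eta>/2" "\<eta>/2"] q21[OF refl refl, of "u + \<eta>/2" "\<eta>/2"]
    q34[OF refl refl, of "u + \<eta>/2" "\<eta>/2"] q43[OF refl refl, of "u + \<eta>/2" "\<eta>/2"]
  note q' = q[unfolded e]
  have "wo u = (theta1 \<omega> (u + \<eta>/2) * theta2 \<omega> (\<eta>/2)) * (theta3 \<omega> (\<eta>/2) * theta4 \<omega> (\<eta>/2)) / theta_const"
    "wz u = (theta2 \<omega> (u + \<eta>/2) * theta1 \<omega> (\<eta>/2)) * (theta3 \<omega> (\<eta>/2) * theta4 \<omega> (\<eta>/2)) / theta_const"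
    "wx u = (theta4 \<omega> (u + \<eta>/2) * theta3 \<omega> (\<eta>/2)) * (theta1 \<omega> (\<eta>/2) * theta2 \<omega> (\<eta>/2)) / theta_const"
    "wy u = - ((theta3 \<omega> (u + \<eta>/2) * theta4 \<omega> (\<eta>/2)) * (theta1 \<omega> (\<eta>/2) * theta2 \<omega> (\<eta>/2)) / theta_const)"
    by (simp_all add: w_defs mult_ac)
  note w = this[unfolded y q']
  show "weight_a \<omega> \<eta> u = wo u + wz u" "weight_b \<omega> \<eta> u = wo u - wz u"
    "weight_c \<omega> \<eta> u = wx u - wy u" "weight_d \<omega> \<eta> u = wx u + wy u"
    unfolding w weight_a_def weight_b_def weight_c_def weight_d_def unfolding theta_const_def
    using nz by (simp_all add: divide_simps power2_eq_square) (simp_all add: algebra_simps)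
qed

lemma emb_R: "emb_ext (on_aux_site n (R_mat \<omega> \<eta> u)) = R u aux (Inr n)"
  unfolding R_def by (rule emb_ext_site) (simp add: R_mat_def weights)

lemma emb_K:
  assumes "theta1 \<omega> (2 * u) \<noteq> 0"
  shows "emb_ext (on_aux (K_mat \<omega> \<beta> u)) = K (c_x \<omega> \<beta>) (c_y \<omega> \<beta>) (c_z \<omega> \<beta>) u aux"
  unfolding K_def
proof (rule emb_ext_aux)
  have nz: "theta1 \<omega> u \<noteq> 0" "theta2 \<omega> u \<noteq> 0" "theta3 \<omega> u \<noteq> 0" "theta4 \<omega> u \<noteq> 0"
    using assms unfolding double by auto
  have p: "theta1 \<omega> (2 * u) / (2 * theta1 \<omega> u) = theta2 \<omega> u * theta3 \<omega> u * theta4 \<omega> u / theta_const"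
    unfolding double using nz by (simp add: field_simps)
  show "K_mat \<omega> \<beta> u $ p $ q = (if p = q then if p then ko u - c_z \<omega> \<beta> * kz u else ko u + c_z \<omega> \<beta> * kz u
     else if p then c_x \<omega> \<beta> * kx u - c_y \<omega> \<beta> * ky u else c_x \<omega> \<beta> * kx u + c_y \<omega> \<beta> * ky u)" for p q
    unfolding K_mat_def p
    by (cases p; cases q) (use nz theta_const in \<open>simp_all add: scale_mat_def mat_def sigma_x_def sigma_y_def sigma_z_def k_defs field_simps\<close>)
qed

lemma dress_prod: "dress L v i a = prod_list (map (\<lambda>n. R (v - case_sum (\<lambda>_. 0) \<zeta> n) i n) L) * a
    * prod_list (map (\<lambda>n. R (v + case_sum (\<lambda>_. 0) \<zeta> n) i n) (rev L))"
  by (induction L) (simp_all add: mult.assoc)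

text \<open>The transfer matrix in the ring. It continues \<open>transfer\<close> analytically to the points where the formula for the boundary
  matrices divides by zero. Its argument is the spectral parameter minus \<open>\<eta>/2\<close>.\<close>

definition T :: "complex \<Rightarrow> (bool + 'n) op" where "T v = tm (map Inr sites) v aux"

lemma chain_sites: "distinct (map Inr (sites :: 'n list) :: (bool + 'n) list)"
  "aux \<notin> set (map Inr (sites :: 'n list))" "spare \<notin> set (map Inr (sites :: 'n list))"
  by (auto simp: distinct_map distinct_sites)

lemma emb_transfer:
  assumes "theta1 \<omega> (2 * v) \<noteq> 0" "theta1 \<omega> (2 * (v + \<eta>)) \<noteq> 0"
  shows "emb_chain (transfer \<omega> \<eta> \<alpha> \<zeta> (v + \<eta>/2)) = T v"
proof -
  have e: "v + \<eta>/2 - \<zeta> n - \<eta>/2 = v - \<zeta> n" "v + \<eta>/2 + \<zeta> n - \<eta>/2 = v + \<zeta> n" "v + \<eta>/2 + \<eta>/2 = v + 2 * (\<eta>/2)" for n by simp_all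
  have "theta1 \<omega> (2 * (v + 2 * (\<eta>/2))) \<noteq> 0" using assms(2) by simp
  note k = emb_K[OF this] emb_K[OF assms(1)]
  show ?thesis
    unfolding transfer_def ptr_emb_ext[symmetric] emb_ext_mult K_plus_def K_minus_def monodromy_def monodromy_hat_def
      emb_ext_list_prod T_def tm_def U_def dress_prod e k
    by (simp add: k emb_R Kp_def Km_def o_def rev_map mult.assoc)
qed

lemma sg_eq: "sg u = - 2 * (theta1 \<omega> (\<eta>/2 - u/2) * theta2 \<omega> (\<eta>/2 + u/2) * theta3 \<omega> (\<eta>/2 + u/2) * theta4 \<omega> (\<eta>/2 + u/2)) / theta_const"
proof -
  have "sg u = - riem 1 1 1 (- (u + \<eta>/2)) (\<eta>/2) (\<eta>/2) (\<eta>/2) / theta_const"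
    unfolding sg_def w_defs riem_def t1_odd t2_even t3_even t4_even
    by (simp add: diff_divide_distrib add_divide_distrib mult_ac)
  also have "riem 1 1 1 (- (u + \<eta>/2)) (\<eta>/2) (\<eta>/2) (\<eta>/2)
      = 2 * (theta1 \<omega> (\<eta>/2 - u/2) * theta2 \<omega> (- (\<eta>/2 + u/2)) * theta4 \<omega> (- (\<eta>/2 + u/2)) * theta3 \<omega> (- (\<eta>/2 + u/2)))"
    by (rule riem_ppp) (simp_all add: field_simps)
  finally show ?thesis unfolding t2_even t3_even t4_even by (simp add: mult_ac)
qed

lemma rho_eq: "rho u = theta1 \<omega> (\<eta> - u) * theta1 \<omega> (\<eta> + u)"
proof -
  have e: "theta1 \<omega> (\<eta> - u) = theta1 \<omega> (2 * (\<eta>/2 - u/2))" "theta1 \<omega> (\<eta> + u) = theta1 \<omega> (2 * (\<eta>/2 + u/2))"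
    by (simp_all add: right_diff_distrib distrib_left)
  have m: "\<eta>/2 - (- u)/2 = \<eta>/2 + u/2" "\<eta>/2 + (- u)/2 = \<eta>/2 - u/2" by simp_all
  show ?thesis unfolding rho_def sg_eq m e double by (simp add: mult_ac)
qed

text \<open>Operator-valued functions with entire entries.\<close>

definition hol :: "(complex \<Rightarrow> (bool + 'n) op) \<Rightarrow> bool" where
  "hol f \<longleftrightarrow> (\<forall>s t. (\<lambda>v. ent (f v) s t) holomorphic_on UNIV)"

lemma hol_const: "hol (\<lambda>v. a)"
  and hol_add: "hol f \<Longrightarrow> hol g \<Longrightarrow> hol (\<lambda>v. f v + g v)"
  and hol_diff: "hol f \<Longrightarrow> hol g \<Longrightarrow> hol (\<lambda>v. f v - g v)"
  and hol_mult: "hol f \<Longrightarrow> hol g \<Longrightarrow> hol (\<lambda>v. f v * g v)"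
  unfolding hol_def by (auto simp: ent_simps ent_mult intro!: holomorphic_intros)

lemma hol_sc: assumes "h holomorphic_on UNIV" shows "hol (\<lambda>v. op_sc (h v))"
proof -
  have "(\<lambda>v. if s = t then h v else 0) holomorphic_on UNIV" for s t :: "bool + 'n \<Rightarrow> bool"
    using assms by (cases "s = t") auto
  then show ?thesis by (simp add: hol_def ent_pauli)
qed

lemma theta_comp:
  assumes "f holomorphic_on UNIV"
  shows "(\<lambda>v. theta1 \<omega> (f v)) holomorphic_on UNIV" "(\<lambda>v. theta2 \<omega> (f v)) holomorphic_on UNIV"
    "(\<lambda>v. theta3 \<omega> (f v)) holomorphic_on UNIV" "(\<lambda>v. theta4 \<omega> (f v)) holomorphic_on UNIV"
  using holomorphic_on_compose_gen[OF assms, of _ UNIV] theta1_holomorphic[OF om] theta2_holomorphic[OF om]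
    theta3_holomorphic[OF om] theta4_holomorphic[OF om] by (auto simp: o_def)

lemma hol_R: "f holomorphic_on UNIV \<Longrightarrow> hol (\<lambda>v. R (f v) i j)"
  unfolding R_def pair_def w_defs by (intro hol_add hol_mult hol_sc hol_const holomorphic_intros theta_comp) auto

lemma hol_K: "f holomorphic_on UNIV \<Longrightarrow> hol (\<lambda>v. K p q r (f v) i)"
  unfolding K_def single_def k_defs by (intro hol_add hol_mult hol_sc hol_const holomorphic_intros theta_comp) auto

lemma hol_T: "f holomorphic_on UNIV \<Longrightarrow> hol (\<lambda>v. T (f v))"
proof -
  assume f: "f holomorphic_on UNIV"
  have "hol (\<lambda>v. dress L (f v) aux (Km (f v) aux))" for L
    using f by (induction L) (auto simp: Km_def intro!: hol_mult hol_R hol_K holomorphic_intros)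
  then show ?thesis
    unfolding T_def tm_def U_def ptr_def Kp_def using f
    by (intro hol_add hol_diff hol_mult hol_const hol_K holomorphic_intros) auto
qed

lemma hol_cancel:
  assumes "hol f" "h holomorphic_on UNIV" "h u0 \<noteq> 0" "\<And>u. op_sc (h u) * f u = 0"
  shows "f u = 0"
proof (rule op_eqI)
  fix s t
  have "h u * ent (f u) s t = 0" for u using arg_cong[OF assms(4)[of u], of "\<lambda>a. ent a s t"] by (simp add: ent_pauli ent_simps)
  then show "ent (f u) s t = ent 0 s t"
    using entire_mult_eq_0[OF assms(2), of "\<lambda>u. ent (f u) s t"] assms(1,3) by (auto simp: hol_def ent_simps)
qed

lemma nontrivial_mult:
  assumes "f holomorphic_on UNIV" "g holomorphic_on UNIV" "\<exists>u. f u \<noteq> (0::complex)" "\<exists>u. g u \<noteq> 0"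
  shows "\<exists>u. f u * g u \<noteq> 0"
  using entire_mult_eq_0[OF assms(1,2)] assms(3,4) by blast

lemma T_commute: "T u * T v = T v * T u"
proof -
  let ?h = "\<lambda>u. rho (u - v) * rho (u + v + 2 * (\<eta>/2))"
  have nt: "\<exists>u. theta1 \<omega> (a + u) \<noteq> 0" "\<exists>u. theta1 \<omega> (a - u) \<noteq> 0" for a
  proof -
    obtain w where "theta1 \<omega> w \<noteq> 0" using theta1_nontrivial[OF om] by blast
    then show "\<exists>u. theta1 \<omega> (a + u) \<noteq> 0" "\<exists>u. theta1 \<omega> (a - u) \<noteq> 0"
      by (auto intro: exI[of _ "w - a"] exI[of _ "a - w"])
  qed
  have "\<exists>u. (theta1 \<omega> ((\<eta> + v) - u) * theta1 \<omega> ((\<eta> - v) + u)) * (theta1 \<omega> (- v - u) * theta1 \<omega> ((2 * \<eta> + v) + u)) \<noteq> 0"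
    by (intro nontrivial_mult nt holomorphic_intros theta_comp)
  moreover have e: "?h u = (theta1 \<omega> ((\<eta> + v) - u) * theta1 \<omega> ((\<eta> - v) + u)) * (theta1 \<omega> (- v - u) * theta1 \<omega> ((2 * \<eta> + v) + u))" for u
  proof -
    have "\<eta> - (u - v) = (\<eta> + v) - u" "\<eta> + (u - v) = (\<eta> - v) + u" "\<eta> - (u + v + 2 * (\<eta>/2)) = - v - u"
      "\<eta> + (u + v + 2 * (\<eta>/2)) = (2 * \<eta> + v) + u" by simp_all
    then show ?thesis unfolding rho_eq by (simp only: mult.assoc)
  qed
  ultimately obtain u0 where "?h u0 \<noteq> 0" unfolding e[symmetric] by blast
  moreover have "?h holomorphic_on UNIV" unfolding e by (intro holomorphic_intros theta_comp)
  moreover have "op_sc (?h u) * (T u * T v - T v * T u) = 0" for u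
    unfolding T_def by (rule tm_commute[of aux spare]) (use chain_sites in auto)
  ultimately have "T u * T v - T v * T u = 0"
    using hol_cancel[of "\<lambda>u. T u * T v - T v * T u" ?h u0 u]
    by (simp add: hol_diff hol_mult hol_T hol_const)
  then show ?thesis by simp
qed

lemma T_even: "T (- v - \<eta>) = T v"
proof -
  have h: "bnorm holomorphic_on UNIV" unfolding bnorm_def by (intro holomorphic_intros theta_comp)
  have e: "bnorm v = - theta1 \<omega> (2 * v) / 2" for v unfolding bnorm_def double by simp
  obtain w where "theta1 \<omega> w \<noteq> 0" using theta1_nontrivial[OF om] by blast
  then have "bnorm (w/2) \<noteq> 0" by (simp add: e)
  moreover have "op_sc (bnorm u) * (T (- u - \<eta>) - T u) = 0" for u
    unfolding T_def using tm_even[OF chain_sites(1,2), of u] by simp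
  ultimately have "T (- v - \<eta>) - T v = 0"
    using hol_cancel[of "\<lambda>u. T (- u - \<eta>) - T u" bnorm "w/2" v] h
    by (simp add: hol_diff hol_T holomorphic_intros)
  then show ?thesis by simp
qed

lemma conj_pair: assumes "i \<noteq> j"
  shows "op_z i * pair a b c d i j * op_z i = pair a (- b) (- c) d i j"
    "op_x i * pair a b c d i j * op_x i = pair a b (- c) (- d) i j"
  by (simp_all add: pair_def pauli_simps swap[OF assms] sc_minus)

lemma conj_single:
  "op_z i * single a b c d i * op_z i = single a (- b) (- c) d i"
  "op_x i * single a b c d i * op_x i = single a b (- c) (- d) i"
  by (simp_all add: single_def pauli_simps sc_minus)

lemma theta_periods:
  "theta1 \<omega> (u + of_real pi) = - theta1 \<omega> u" "theta2 \<omega> (u + of_real pi) = - theta2 \<omega> u"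
  "theta3 \<omega> (u + of_real pi) = theta3 \<omega> u" "theta4 \<omega> (u + of_real pi) = theta4 \<omega> u"
  "theta1 \<omega> (u + of_real pi * \<omega>) = - quasi \<omega> u * theta1 \<omega> u" "theta2 \<omega> (u + of_real pi * \<omega>) = quasi \<omega> u * theta2 \<omega> u"
  "theta3 \<omega> (u + of_real pi * \<omega>) = quasi \<omega> u * theta3 \<omega> u" "theta4 \<omega> (u + of_real pi * \<omega>) = - quasi \<omega> u * theta4 \<omega> u"
  using theta_pi[OF om] theta2_pi[OF om] theta3_pi[OF om] theta_pi_tau[OF om] theta2_pi_tau[OF om] theta3_pi_tau[OF om] by auto

lemma R_pi: assumes "i \<noteq> j" shows "R (u + of_real pi) i j = op_sc (- 1) * (op_z i * R u i j * op_z i)"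
proof -
  have e: "u + of_real pi + \<eta>/2 = (u + \<eta>/2) + of_real pi" by simp
  show ?thesis unfolding R_def conj_pair[OF assms] sc_pair w_defs e theta_periods by simp
qed

lemma R_pi_om: assumes "i \<noteq> j" shows "R (u + of_real pi * \<omega>) i j = op_sc (- quasi \<omega> (u + \<eta>/2)) * (op_x i * R u i j * op_x i)"
proof -
  have e: "u + of_real pi * \<omega> + \<eta>/2 = (u + \<eta>/2) + of_real pi * \<omega>" by simp
  show ?thesis unfolding R_def conj_pair[OF assms] sc_pair w_defs e theta_periods
    by (rule pair_cong) (simp_all add: mult_ac)
qed

lemma K_pi: "K p q r (u + of_real pi) i = op_sc (- 1) * (op_z i * K p q r u i * op_z i)"
  unfolding K_def conj_single sc_single k_defs theta_periods by simp

lemma K_pi_om: "K p q r (u + of_real pi * \<omega>) i = op_sc (- (quasi \<omega> u ^ 3)) * (op_x i * K p q r u i * op_x i)"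
  unfolding K_def conj_single sc_single k_defs theta_periods
  by (simp add: power3_eq_cube mult_ac)

lemma T_pi: "T (v + of_real pi) = T v"
proof -
  have "T (v + of_real pi) = op_sc ((- 1) * (- 1) * (\<Prod>n\<leftarrow>(map Inr sites :: (bool + 'n) list). (- 1) * (- 1))) * T v"
    unfolding T_def
    by (rule tm_shift[where S = "op_z aux" and c = "\<lambda>_. - 1" and d = "\<lambda>_. - 1"]) (use R_pi in \<open>auto simp: K_pi mult.assoc ptr_cyclic(3)[of aux]\<close>)
  also have "(\<Prod>n\<leftarrow>(map Inr sites :: (bool + 'n) list). (- 1) * (- 1)) = (1 :: complex)" by (simp add: map_replicate_const prod_list_replicate)
  finally show ?thesis by simp
qed

lemma T_pi_om: "T (v + of_real pi * \<omega>) = op_sc (quasi \<omega> (v + \<eta>/2) ^ (2 * (CARD('n) + 3))) * T v"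
proof -
  let ?q = "quasi \<omega>" and ?xi = "case_sum (\<lambda>_. 0) \<zeta>"
  have "T (v + of_real pi * \<omega>) = op_sc ((- (?q v ^ 3)) * (- (?q (v + 2 * (\<eta>/2)) ^ 3))
      * (\<Prod>n\<leftarrow>(map Inr sites :: (bool + 'n) list). (- ?q (v - ?xi n + \<eta>/2)) * (- ?q (v + ?xi n + \<eta>/2)))) * T v"
    unfolding T_def
    by (rule tm_shift[where S = "op_x aux" and c = "\<lambda>u. - ?q (u + \<eta>/2)" and d = "\<lambda>u. - (?q u ^ 3)"]) (use R_pi_om in \<open>auto simp: K_pi_om mult.assoc ptr_cyclic(1)[of aux]\<close>)
  also have "?q (v - x + \<eta>/2) * ?q (v + x + \<eta>/2) = ?q (v + \<eta>/2) ^ 2" for x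
    using quasi_mult[OF om, of "v + \<eta>/2" x] by (simp add: algebra_simps)
  then have "(\<Prod>n\<leftarrow>(map Inr sites :: (bool + 'n) list). (- ?q (v - ?xi n + \<eta>/2)) * (- ?q (v + ?xi n + \<eta>/2))) = (?q (v + \<eta>/2) ^ 2) ^ CARD('n)"
    by (simp add: map_replicate_const prod_list_replicate sites_def o_def)
  also have "?q v * ?q (v + 2 * (\<eta>/2)) = ?q (v + \<eta>/2) ^ 2"
    using quasi_mult[OF om, of "v + \<eta>/2" "\<eta>/2"] by (simp add: algebra_simps)
  then have "(- (?q v ^ 3)) * (- (?q (v + 2 * (\<eta>/2)) ^ 3)) = (?q (v + \<eta>/2) ^ 2) ^ 3"
    by (simp add: power_mult_distrib[symmetric])
  finally show ?thesis by (simp add: power_mult[symmetric] power_add[symmetric] algebra_simps)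
qed

text \<open>Every site contributes two factors of \<open>quasi\<close> and the two boundary matrices contribute six, so that the multiplier has the exponent
  \<open>2 * (CARD('n) + 3)\<close>.\<close>

lemma T_Xi: "(\<lambda>u. ent (T (u - \<eta>/2)) s t) \<in> Xi_space \<omega> (CARD('n) + 4)"
proof -
  have "hol (\<lambda>u. T (u - \<eta>/2))" by (intro hol_T holomorphic_intros)
  moreover have "T (- u - \<eta>/2) = T (u - \<eta>/2)" for u using T_even[of "u - \<eta>/2"] by (simp add: algebra_simps)
  moreover have "T (u + of_real pi - \<eta>/2) = T (u - \<eta>/2)" for u using T_pi[of "u - \<eta>/2"] by (simp add: algebra_simps)
  moreover have "T (u + of_real pi * \<omega> - \<eta>/2) = op_sc (quasi \<omega> u ^ (2 * (CARD('n) + 3))) * T (u - \<eta>/2)" for u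
    using T_pi_om[of "u - \<eta>/2"] by (simp add: algebra_simps)
  ultimately have "(\<lambda>u. ent (T (u - \<eta>/2)) s t) \<in> Xi_space \<omega> (Suc (CARD('n) + 3))"
    unfolding Xi_iff[OF om] by (simp add: hol_def ent_pauli)
  then show ?thesis by (simp add: eval_nat_numeral)
qed

text \<open>At each of the four half periods three of the four coefficients of the boundary matrix vanish.\<close>

lemma theta_half_zero: "theta2 \<omega> (of_real pi / 2) = 0" "theta4 \<omega> (of_real pi * \<omega> / 2) = 0"
  "theta3 \<omega> ((of_real pi + of_real pi * \<omega>) / 2) = 0"
proof -
  show 1: "theta2 \<omega> (of_real pi / 2) = 0" using theta1_eq'[OF om, of 0] by simp
  show 3: "theta3 \<omega> ((of_real pi + of_real pi * \<omega>) / 2) = 0"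
    using theta3_half[OF om, of "of_real pi / 2"] 1 by (simp add: add_divide_distrib)
  show "theta4 \<omega> (of_real pi * \<omega> / 2) = 0"
    using 3 by (simp add: theta4_eq add_divide_distrib add.commute)
qed

lemma R_conj: fixes S a b :: "(bool + 'n) op" assumes "S * S = 1" "a = op_sc c * (S * b * S)" shows "S * a = op_sc c * (b * S)"
proof -
  have "S * a = op_sc c * ((S * S) * b * S)" unfolding assms(2) by (simp only: sc_left'[of S] mult.assoc)
  then show ?thesis unfolding assms(1) by simp
qed

lemma T_special: assumes "j \<le> 3" shows "\<exists>s. T (xi_special \<omega> \<eta> j - \<eta>/2) = op_sc s"
proof -
  let ?p = "complex_of_real pi"
  consider "j = 0" | "j = 1" | "j = 2" | "j = 3" using assms by linarith
  then show ?thesis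
  proof cases
    case 1
    have "\<exists>s. tm (map Inr sites) 0 aux = op_sc s"
      by (rule tm_central[where S = 1 and k = "ko 0" and c = "\<lambda>_. 1"])
         (auto simp: Km_def K_def single_def k_defs)
    then show ?thesis using 1 by (simp add: T_def xi_special_def)
  next
    case 2
    have "\<exists>s. tm (map Inr sites) (?p / 2) aux = op_sc s"
    proof (rule tm_central[where S = "op_z aux" and c = "\<lambda>_. - 1"])
      show "Km (?p / 2) aux = op_sc (c_z \<omega> (\<alpha> MinusSide) * kz (?p / 2)) * op_z aux"
        unfolding Km_def K_def single_def k_defs theta_half_zero by simp
      show "op_z aux * R (u + 2 * (?p / 2)) aux n = op_sc (- 1) * (R u aux n * op_z aux)" if "n \<in> set (map Inr sites)" for u n
        by (rule R_conj) (use that R_pi in auto)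
    qed auto
    then show ?thesis using 2 by (simp add: T_def xi_special_def)
  next
    case 3
    have "\<exists>s. tm (map Inr sites) (?p * \<omega> / 2) aux = op_sc s"
    proof (rule tm_central[where S = "op_x aux"])
      show "Km (?p * \<omega> / 2) aux = op_sc (c_x \<omega> (\<alpha> MinusSide) * kx (?p * \<omega> / 2)) * op_x aux"
        unfolding Km_def K_def single_def k_defs theta_half_zero by simp
      show "op_x aux * R (u + 2 * (?p * \<omega> / 2)) aux n = op_sc (- quasi \<omega> (u + \<eta>/2)) * (R u aux n * op_x aux)"
        if "n \<in> set (map Inr sites)" for u n
        by (rule R_conj) (use that R_pi_om in auto)
    qed auto
    then show ?thesis using 3 by (simp add: T_def xi_special_def)
  next
    case 4
    have "\<exists>s. tm (map Inr sites) ((?p + ?p * \<omega>) / 2) aux = op_sc s"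
    proof (rule tm_central[where S = "Y aux"])
      show "Km ((?p + ?p * \<omega>) / 2) aux = op_sc (c_y \<omega> (\<alpha> MinusSide) * ky ((?p + ?p * \<omega>) / 2)) * Y aux"
        unfolding Km_def K_def single_def k_defs theta_half_zero by simp
      show "Y aux * R (u + 2 * ((?p + ?p * \<omega>) / 2)) aux n = op_sc (quasi \<omega> (u + ?p + \<eta>/2)) * (R u aux n * Y aux)"
        if n: "n \<in> set (map Inr sites)" for u n
      proof -
        have ne: "aux \<noteq> n" using n by auto
        have e: "u + 2 * ((?p + ?p * \<omega>) / 2) = (u + ?p) + ?p * \<omega>" by simp
        have "op_x aux * R (u + 2 * ((?p + ?p * \<omega>) / 2)) aux n = op_sc (- quasi \<omega> (u + ?p + \<eta>/2)) * (R (u + ?p) aux n * op_x aux)"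
          unfolding e by (rule R_conj[OF xx R_pi_om[OF ne]])
        moreover have "op_z aux * R (u + ?p) aux n = op_sc (- 1) * (R u aux n * op_z aux)"
          by (rule R_conj[OF zz R_pi[OF ne]])
        ultimately show ?thesis
          unfolding Y_def mult.assoc[of "op_z aux"]
          by (simp add: sc_left'[of "op_z aux"] mult.assoc[symmetric, of "op_z aux" "R _ _ _"])
            (simp add: mult.assoc sc_minus)
      qed
    qed auto
    then show ?thesis using 4 by (simp add: T_def xi_special_def)
  qed
qed

lemma T_inversion:
  assumes "\<And>m. m \<noteq> n \<Longrightarrow> theta1 \<omega> (\<eta> - (\<zeta> n - \<zeta> m)) * theta1 \<omega> (\<eta> + (\<zeta> n - \<zeta> m)) \<noteq> 0"
  shows "\<exists>s. T (\<zeta> n - \<eta>) * T (\<zeta> n) = op_sc s"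
proof -
  obtain L1 L2 where L: "sites = L1 @ n # L2" using set_sites split_list by (metis UNIV_I)
  then have n: "n \<notin> set L1" using distinct_sites[where 'n = 'n] unfolding L by simp
  have L': "map Inr sites = (map Inr L1 :: (bool + 'n) list) @ Inr n # map Inr L2" by (simp add: L)
  have "\<exists>s. T (- \<zeta> n) * T (\<zeta> n) = op_sc s"
  proof -
    have "\<exists>s. tm (map Inr L1 @ Inr n # map Inr L2) (- case_sum (\<lambda>_. 0) \<zeta> (Inr n :: bool + 'n)) aux
        * tm (map Inr L1 @ Inr n # map Inr L2) (case_sum (\<lambda>_. 0) \<zeta> (Inr n :: bool + 'n)) aux = op_sc s"
    proof (rule tm_inversion)
      show "rho (case_sum (\<lambda>_. 0) \<zeta> (Inr n :: bool + 'n) - case_sum (\<lambda>_. 0) \<zeta> m) \<noteq> 0" if m: "m \<in> set (map Inr L1)" for m :: "bool + 'n"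
      proof -
        obtain m' where "m = Inr m'" "m' \<noteq> n" using m n by auto
        then show ?thesis using assms[of m'] by (simp add: rho_eq)
      qed
    qed (rule chain_sites(1,2)[unfolded L'])+
    then show ?thesis unfolding T_def L' by simp
  qed
  then show ?thesis using T_even[of "- \<zeta> n"] by simp
qed

end

section \<open>The bases of separated states\<close>

text \<open>The four special points contribute to the Lagrange polynomials a factor that is computed here from the values of
  \<open>theta1\<close> at points shifted by half periods.\<close>

context
  fixes \<omega> :: complex assumes om: "Im \<omega> > 0"
begin

text \<open>In the order of the points \<open>xi_special\<close>.\<close>

definition half_periods :: "complex list" where
  "half_periods = [0, of_real pi / 2, of_real pi * \<omega> / 2, (of_real pi + of_real pi * \<omega>) / 2]"

lemma theta1_half_shift:
  defines "e \<equiv> \<lambda>x. exp (- (\<i> * of_real pi * \<omega> / 4) - \<i> * x)"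
  shows "theta1 \<omega> (x + of_real pi / 2) = theta2 \<omega> x"
    "theta1 \<omega> (x + of_real pi * \<omega> / 2) = e (x - of_real pi / 2) * theta4 \<omega> x"
    "theta1 \<omega> (x + (of_real pi + of_real pi * \<omega>) / 2) = e x * theta3 \<omega> x"
proof -
  show 1: "theta1 \<omega> (x + of_real pi / 2) = theta2 \<omega> x" for x by (simp add: theta1_eq)
  have t2: "theta2 \<omega> (x + of_real pi * \<omega> / 2) = e x * theta3 \<omega> x" for x
  proof -
    have x: "x + of_real pi * \<omega> / 2 + of_real pi * \<omega> / 2 = x + of_real pi * \<omega>" by simp
    have "e (x + of_real pi * \<omega> / 2) * theta2 \<omega> (x + of_real pi * \<omega> / 2) = quasi \<omega> x * theta3 \<omega> x"
      using theta3_half[OF om, of "x + of_real pi * \<omega> / 2"] unfolding x theta3_pi_tau[OF om] e_def by simp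
    also have "quasi \<omega> x = e (x + of_real pi * \<omega> / 2) * e x"
      unfolding quasi_def[OF om] e_def exp_add[symmetric] by (rule arg_cong[of _ _ exp]) (simp add: field_simps)
    finally show ?thesis by (simp add: e_def)
  qed
  have a: "x + (of_real pi + of_real pi * \<omega>) / 2 = (x + of_real pi * \<omega> / 2) + of_real pi / 2" by (simp add: field_simps)
  show "theta1 \<omega> (x + (of_real pi + of_real pi * \<omega>) / 2) = e x * theta3 \<omega> x" unfolding a 1 t2 ..
  have b: "x + of_real pi * \<omega> / 2 = (x - of_real pi / 2 + of_real pi * \<omega> / 2) + of_real pi / 2" by simp
  have c: "theta3 \<omega> (x - of_real pi / 2) = theta4 \<omega> x"
    using theta3_pi[OF om, of "x - of_real pi / 2"] by (simp add: theta4_eq add.commute)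
  show "theta1 \<omega> (x + of_real pi * \<omega> / 2) = e (x - of_real pi / 2) * theta4 \<omega> x"
    unfolding b 1 t2 c ..
qed

lemma theta1_half_prod:
  "\<exists>C. C \<noteq> 0 \<and> (\<forall>x. (\<Prod>j\<le>3. theta1 \<omega> (x + half_periods ! j)) = C * exp (- 2 * \<i> * x) * theta1 \<omega> (2 * x))"
proof -
  let ?c = "theta2 \<omega> 0 * (theta4 (2 * \<omega>) 0)\<^sup>2" and ?G = "exp (- (\<i> * of_real pi * \<omega> / 2) + \<i> * of_real pi / 2)"
  let ?e = "\<lambda>x. exp (- (\<i> * of_real pi * \<omega> / 4) - \<i> * x)"
  have "(\<Prod>j\<le>3. theta1 \<omega> (x + half_periods ! j)) = (?G * ?c / 2) * exp (- 2 * \<i> * x) * theta1 \<omega> (2 * x)" for x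
  proof -
    have "(\<Prod>j\<le>3. theta1 \<omega> (x + half_periods ! j))
        = theta1 \<omega> x * theta2 \<omega> x * (?e (x - of_real pi / 2) * theta4 \<omega> x) * (?e x * theta3 \<omega> x)"
      by (simp add: half_periods_def eval_nat_numeral theta1_half_shift)
    also have "\<dots> = (?e (x - of_real pi / 2) * ?e x) * (theta1 \<omega> x * theta2 \<omega> x * theta3 \<omega> x * theta4 \<omega> x)" by (simp only: mult_ac)
    also have "?e (x - of_real pi / 2) * ?e x = ?G * exp (- 2 * \<i> * x)"
      unfolding exp_add[symmetric] by (rule arg_cong[of _ _ exp]) (simp add: field_simps)
    also have "theta1 \<omega> x * theta2 \<omega> x * theta3 \<omega> x * theta4 \<omega> x = theta1 \<omega> (2 * x) * ?c / 2"
      using theta1_double[OF om, of x] by simp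
    finally show ?thesis by (simp add: mult_ac)
  qed
  moreover have "?G * ?c / 2 \<noteq> 0" by (simp add: theta_const_nonzero[OF om])
  ultimately show ?thesis by blast
qed

lemma theta1_double_nonzero:
  assumes "\<And>j. j \<le> 3 \<Longrightarrow> theta1 \<omega> (x + half_periods ! j) \<noteq> 0"
  shows "theta1 \<omega> (2 * x) \<noteq> 0"
proof -
  obtain C where "(\<Prod>j\<le>3. theta1 \<omega> (x + half_periods ! j)) = C * exp (- 2 * \<i> * x) * theta1 \<omega> (2 * x)"
    using theta1_half_prod by blast
  moreover have "(\<Prod>j\<le>3. theta1 \<omega> (x + half_periods ! j)) \<noteq> 0" using assms by simp
  ultimately show ?thesis by (metis mult_zero_right)
qed

lemma special_prod:
  "\<exists>D. D \<noteq> 0 \<and> (\<forall>u. (\<Prod>j\<le>3. theta_s \<omega> u (xi_special \<omega> \<eta> j)) = D * theta1 \<omega> (2 * u - \<eta>) * theta1 \<omega> (2 * u + \<eta>))"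
proof -
  obtain C where C: "C \<noteq> 0" "\<And>x. (\<Prod>j\<le>3. theta1 \<omega> (x + half_periods ! j)) = C * exp (- 2 * \<i> * x) * theta1 \<omega> (2 * x)"
    using theta1_half_prod by auto
  have "(\<Prod>j\<le>3. theta_s \<omega> u (xi_special \<omega> \<eta> j)) = (- (C ^ 2 * exp (- 2 * \<i> * \<eta>))) * theta1 \<omega> (2 * u - \<eta>) * theta1 \<omega> (2 * u + \<eta>)" for u
  proof -
    have o: "theta1 \<omega> (u - (\<eta>/2 + p)) = - theta1 \<omega> ((\<eta>/2 - u) + p)" for p
      using theta1_odd[OF om, of "\<eta>/2 - u + p"] by (simp add: algebra_simps)
    have "(\<Prod>j\<le>3. theta_s \<omega> u (xi_special \<omega> \<eta> j))
        = (\<Prod>j\<le>3. theta1 \<omega> ((\<eta>/2 - u) + half_periods ! j)) * (\<Prod>j\<le>3. theta1 \<omega> ((u + \<eta>/2) + half_periods ! j))"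
      unfolding prod.distrib[symmetric] theta_s_def xi_special_def half_periods_def[symmetric] o
      by (simp add: eval_nat_numeral add.assoc)
    also have "\<dots> = C ^ 2 * (exp (- 2 * \<i> * (\<eta>/2 - u)) * exp (- 2 * \<i> * (u + \<eta>/2))) * (theta1 \<omega> (2 * (\<eta>/2 - u)) * theta1 \<omega> (2 * (u + \<eta>/2)))"
      unfolding C by (simp add: power2_eq_square mult_ac)
    also have "exp (- 2 * \<i> * (\<eta>/2 - u)) * exp (- 2 * \<i> * (u + \<eta>/2)) = exp (- 2 * \<i> * \<eta>)"
      unfolding exp_add[symmetric] by (rule arg_cong[of _ _ exp]) (simp add: field_simps)
    also have "2 * (\<eta>/2 - u) = - (2 * u - \<eta>)" by simp
    also have "2 * (u + \<eta>/2) = 2 * u + \<eta>" by (simp add: distrib_left)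
    also have "theta1 \<omega> (- (2 * u - \<eta>)) = - theta1 \<omega> (2 * u - \<eta>)" by (rule theta1_odd[OF om])
    finally show ?thesis by simp
  qed
  moreover have "- (C ^ 2 * exp (- 2 * \<i> * \<eta>)) \<noteq> 0" using C(1) by simp
  ultimately show ?thesis by blast
qed

lemma good_nodes_of_vand:
  fixes z :: "'n::{finite,linorder} \<Rightarrow> complex"
  assumes "\<And>i. theta1 \<omega> (2 * z i) \<noteq> 0" "ell_vand \<omega> z \<noteq> 0"
  shows "good_nodes \<omega> UNIV z"
proof -
  have 1: "theta_s \<omega> (z j) (z i) \<noteq> 0" if "i < j" for i j
    using assms(2) that unfolding ell_vand_def by (auto simp: prod_zero_iff)
  then have "theta_s \<omega> (z i) (z j) \<noteq> 0" if "i \<noteq> j" for i j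
    using 1[of i j] 1[of j i] that theta_s_commute[OF om, of "z i" "z j"] by (cases "i < j") auto
  then show ?thesis using assms(1) by (auto simp: good_nodes_def[OF om])
qed

end

text \<open>The chain with generic inhomogeneities.\<close>

locale generic_model = xyz_model \<omega> \<eta> \<alpha> \<zeta>
  for \<omega> \<eta> :: complex and \<alpha> :: "side \<Rightarrow> 3 \<Rightarrow> complex" and \<zeta> :: "'n::{finite,linorder} \<Rightarrow> complex" +
  assumes gen: "generic_inhom \<omega> \<eta> \<zeta>"
begin

abbreviation "nd \<equiv> node \<omega> \<eta> \<zeta>"
abbreviation "labels \<equiv> (UNIV :: ('n \<times> bool) set) <+> {..3 :: nat}"

lemma gen_theta:
  assumes "k \<in> labels" "l \<in> labels"
  shows "theta1 \<omega> (nd k + nd l) \<noteq> 0" "k \<noteq> l \<Longrightarrow> theta1 \<omega> (nd k - nd l) \<noteq> 0"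
proof -
  have g: "theta1 \<omega> (s * nd k - t * nd l) \<noteq> 0" if "s \<in> {1, -1}" "t \<in> {1, -1}" "(s, k) \<noteq> (t, l)" for s t
  proof -
    have "\<not> eq_mod \<omega> (s * nd k) (t * nd l)" using gen assms that unfolding generic_inhom_def by blast
    then show ?thesis unfolding eq_mod_def theta1_lattice_iff[OF om] .
  qed
  show "theta1 \<omega> (nd k + nd l) \<noteq> 0" using g[of 1 "- 1"] by simp
  show "k \<noteq> l \<Longrightarrow> theta1 \<omega> (nd k - nd l) \<noteq> 0" using g[of 1 1] by simp
qed

lemma good_labels: assumes "I \<subseteq> labels" shows "good_nodes \<omega> I nd"
  unfolding good_nodes_def[OF om]
proof (intro conjI ballI impI)
  show "finite I" using finite_subset[OF assms] by simp
  fix i assume "i \<in> I"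
  then have i: "i \<in> labels" using assms by blast
  show "theta1 \<omega> (2 * nd i) \<noteq> 0" using gen_theta(1)[OF i i] by (simp only: mult_2 not_False_eq_True)
  fix j assume "j \<in> I" and ij: "i \<noteq> j"
  then have j: "j \<in> labels" using assms by blast
  show "theta_s \<omega> (nd i) (nd j) \<noteq> 0"
    unfolding theta_s_def using gen_theta(1)[OF i j] gen_theta(2)[OF i j ij] by (rule no_zero_divisors[rotated])
qed

lemma in_labels [simp]: "Inl (n, h) \<in> labels" "j \<le> 3 \<Longrightarrow> Inr j \<in> labels" by auto

lemma arg_nonzero:
  "theta1 \<omega> (2 * \<zeta> n) \<noteq> 0" "theta1 \<omega> (2 * (\<zeta> n + \<eta>)) \<noteq> 0" "theta1 \<omega> (2 * (\<zeta> n - \<eta>)) \<noteq> 0"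
proof -
  show "theta1 \<omega> (2 * \<zeta> n) \<noteq> 0" using gen_theta(1)[of "Inl (n, False)" "Inl (n, True)"] by (simp add: xi_shift_def)
  show "theta1 \<omega> (2 * (\<zeta> n + \<eta>)) \<noteq> 0"
  proof (rule theta1_double_nonzero[OF om])
    fix j :: nat assume "j \<le> 3"
    then show "theta1 \<omega> (\<zeta> n + \<eta> + half_periods \<omega> ! j) \<noteq> 0"
      using gen_theta(1)[of "Inl (n, False)" "Inr j"]
      by (simp add: xi_shift_def xi_special_def half_periods_def[OF om] algebra_simps)
  qed
  have "theta1 \<omega> (2 * (\<eta> - \<zeta> n)) \<noteq> 0"
  proof (rule theta1_double_nonzero[OF om])
    fix j :: nat assume "j \<le> 3"
    then show "theta1 \<omega> (\<eta> - \<zeta> n + half_periods \<omega> ! j) \<noteq> 0"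
      using gen_theta(2)[of "Inr j" "Inl (n, True)"]
      by (simp add: xi_shift_def xi_special_def half_periods_def[OF om] algebra_simps)
  qed
  then show "theta1 \<omega> (2 * (\<zeta> n - \<eta>)) \<noteq> 0" using t1_odd[of "2 * (\<eta> - \<zeta> n)"] by (simp add: right_diff_distrib)
qed

text \<open>The shifted inhomogeneities selected by a labelling \<open>h\<close> of the sites.\<close>

definition pts :: "('n \<Rightarrow> bool) \<Rightarrow> 'n \<Rightarrow> complex" where "pts h n = xi_shift \<eta> \<zeta> n (h n)"

lemma good_pts: "good_nodes \<omega> UNIV (pts h)"
proof -
  have "good_nodes \<omega> (range (\<lambda>n. Inl (n, h n))) nd" by (rule good_labels) auto
  then show ?thesis unfolding good_nodes_def[OF om] pts_def by auto
qed

text \<open>The labels of these points and of the four special points: \<open>N + 4\<close> interpolation nodes.\<close>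

definition node_set :: "('n \<Rightarrow> bool) \<Rightarrow> (('n \<times> bool) + nat) set" where
  "node_set h = range (\<lambda>n. Inl (n, h n)) \<union> Inr ` {..3}"

lemma card_node_set: "card (node_set h) = Suc (CARD('n) + 3)"
proof -
  have "card (range (\<lambda>n. Inl (n, h n) :: ('n \<times> bool) + nat)) = CARD('n)" by (rule card_image) (auto simp: inj_on_def)
  moreover have "card (Inr ` {..3} :: (('n \<times> bool) + nat) set) = 4" by (subst card_image) auto
  moreover have "card (node_set h) = card (range (\<lambda>n. Inl (n, h n) :: ('n \<times> bool) + nat)) + card (Inr ` {..3} :: (('n \<times> bool) + nat) set)"
    unfolding node_set_def by (rule card_Un_disjoint) auto
  ultimately show ?thesis by simp
qed

lemma T_interpolation:
  "\<exists>s. T (u - \<eta>/2) = (\<Sum>a\<in>UNIV. op_sc (lagr \<omega> (node_set h) nd (Inl (a, h a)) u) * T (pts h a - \<eta>/2)) + op_sc s"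
proof -
  let ?L = "\<lambda>i. lagr \<omega> (node_set h) nd i u"
  have "\<forall>j. \<exists>s. j \<le> 3 \<longrightarrow> T (nd (Inr j) - \<eta>/2) = op_sc s" using T_special by auto
  then obtain sp where sp: "\<And>j. j \<le> 3 \<Longrightarrow> T (nd (Inr j) - \<eta>/2) = op_sc (sp j)" by metis
  have g: "good_nodes \<omega> (node_set h) nd" by (rule good_labels) (auto simp: node_set_def)
  have X: "ent (T (u - \<eta>/2)) s t = (\<Sum>i\<in>node_set h. ent (T (nd i - \<eta>/2)) s t * ?L i)" for s t
    by (rule Xi_interpolation[OF om g card_node_set]) (use T_Xi[of s t] in \<open>simp add: eval_nat_numeral\<close>)
  have split: "(\<Sum>i\<in>node_set h. F i) = (\<Sum>a\<in>UNIV. F (Inl (a, h a))) + (\<Sum>j\<le>3. F (Inr j))" for F :: "_ \<Rightarrow> complex"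
    unfolding node_set_def
    by (subst sum.union_disjoint) (auto simp: sum.reindex inj_on_def o_def)
  have es: "ent (\<Sum>a\<in>A. f a) s t = (\<Sum>a\<in>A. ent (f a) s t)" for A :: "'n set" and f s t
    by (induction A rule: infinite_finite_induct) (auto simp: ent_simps)
  have "T (u - \<eta>/2) = (\<Sum>a\<in>UNIV. op_sc (?L (Inl (a, h a))) * T (pts h a - \<eta>/2)) + op_sc (\<Sum>j\<le>3. sp j * ?L (Inr j))"
  proof (rule op_eqI)
    fix s t
    have "(\<Sum>j\<le>3. ent (T (nd (Inr j) - \<eta>/2)) s t * ?L (Inr j)) = (if s = t then \<Sum>j\<le>3. sp j * ?L (Inr j) else 0)"
      using sp by (auto simp: ent_pauli intro!: sum.cong sum.neutral)
    then show "ent (T (u - \<eta>/2)) s t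
        = ent ((\<Sum>a\<in>UNIV. op_sc (?L (Inl (a, h a))) * T (pts h a - \<eta>/2)) + op_sc (\<Sum>j\<le>3. sp j * ?L (Inr j))) s t"
      unfolding X split by (simp add: ent_simps es ent_pauli pts_def mult.commute)
  qed
  then show ?thesis by blast
qed

text \<open>The coefficient of the value at \<open>\<xi>\<^sub>n - \<eta>/2\<close> in the interpolation of the value at \<open>\<xi>\<^sub>n + \<eta>/2\<close>.\<close>

lemma lagr_coefficient:
  assumes "h n"
  shows "lagr \<omega> (node_set h) nd (Inl (n, h n)) (pts (h(n := False)) n)
    = ell_vand \<omega> (pts (h(n := False))) / ell_vand \<omega> (pts h) * (theta1 \<omega> (2 * \<zeta> n + 2 * \<eta>) / theta1 \<omega> (2 * \<zeta> n - 2 * \<eta>))"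
proof -
  obtain D where D: "D \<noteq> 0" "\<And>u. (\<Prod>j\<le>3. theta_s \<omega> u (xi_special \<omega> \<eta> j)) = D * theta1 \<omega> (2 * u - \<eta>) * theta1 \<omega> (2 * u + \<eta>)"
    using special_prod[OF om, of \<eta>] by blast
  let ?u = "\<zeta> n + \<eta>/2" and ?x = "\<zeta> n - \<eta>/2"
  let ?f = "\<lambda>i. theta_s \<omega> ?u (nd i) / theta_s \<omega> ?x (nd i)"
  have u: "pts (h(n := False)) n = ?u" and x: "nd (Inl (n, h n)) = ?x" "pts h n = ?x"
    using assms by (simp_all add: pts_def xi_shift_def)
  have s: "node_set h - {Inl (n, h n)} = (\<lambda>m. Inl (m, h m)) ` (UNIV - {n}) \<union> Inr ` {..3}"
    unfolding node_set_def by auto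
  have "lagr \<omega> (node_set h) nd (Inl (n, h n)) ?u = (\<Prod>i\<in>node_set h - {Inl (n, h n)}. ?f i)"
    unfolding lagr_def[OF om] x ..
  also have "\<dots> = (\<Prod>m\<in>UNIV - {n}. ?f (Inl (m, h m))) * (\<Prod>j\<le>3. ?f (Inr j))"
    unfolding s by (subst prod.union_disjoint) (auto simp: prod.reindex inj_on_def o_def)
  also have "(\<Prod>m\<in>UNIV - {n}. ?f (Inl (m, h m))) = lagr \<omega> UNIV (pts h) n ?u"
    unfolding lagr_def[OF om] x by (simp add: pts_def)
  also have "\<dots> = ell_vand \<omega> (pts (h(n := False))) / ell_vand \<omega> (pts h)"
  proof -
    have "(pts h)(n := ?u) = pts (h(n := False))" by (auto simp: pts_def xi_shift_def)
    then show ?thesis using ell_vand_lagr[OF om good_pts, of h n ?u] good_nodes_vand[OF om good_pts, of h] by simp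
  qed
  also have "(\<Prod>j\<le>3. ?f (Inr j)) = theta1 \<omega> (2 * \<zeta> n + 2 * \<eta>) / theta1 \<omega> (2 * \<zeta> n - 2 * \<eta>)"
  proof -
    have a: "2 * ?u - \<eta> = 2 * \<zeta> n" "2 * ?u + \<eta> = 2 * \<zeta> n + 2 * \<eta>" "2 * ?x - \<eta> = 2 * \<zeta> n - 2 * \<eta>" "2 * ?x + \<eta> = 2 * \<zeta> n"
      by (simp_all add: field_simps)
    have "(\<Prod>j\<le>3. ?f (Inr j)) = (D * theta1 \<omega> (2 * ?u - \<eta>) * theta1 \<omega> (2 * ?u + \<eta>)) / (D * theta1 \<omega> (2 * ?x - \<eta>) * theta1 \<omega> (2 * ?x + \<eta>))"
      unfolding prod_dividef node.simps D(2) ..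
    then show ?thesis unfolding a using D(1) arg_nonzero[of n] by simp
  qed
  finally show ?thesis unfolding u .
qed

text \<open>The values of the transfer matrix that create the right and the left states.\<close>

definition Tp :: "'n \<Rightarrow> 'n chain_op" where "Tp n = transfer \<omega> \<eta> \<alpha> \<zeta> (\<zeta> n + \<eta>/2)"
definition Tm :: "'n \<Rightarrow> 'n chain_op" where "Tm n = transfer \<omega> \<eta> \<alpha> \<zeta> (\<zeta> n - \<eta>/2)"

lemma emb_Tp: "emb_chain (Tp n) = T (\<zeta> n)"
  unfolding Tp_def by (rule emb_transfer[OF arg_nonzero(1,2)])

lemma emb_Tm: "emb_chain (Tm n) = T (\<zeta> n - \<eta>)"
proof -
  have "emb_chain (transfer \<omega> \<eta> \<alpha> \<zeta> (\<zeta> n - \<eta> + \<eta>/2)) = T (\<zeta> n - \<eta>)"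
    by (rule emb_transfer) (use arg_nonzero[of n] in simp_all)
  then show ?thesis by (simp add: Tm_def)
qed

lemma emb_sum: "emb_chain (\<Sum>a\<in>A. f a) = (\<Sum>a\<in>A. emb_chain (f a))" for f :: "'b \<Rightarrow> 'n chain_op"
proof -
  have "emb_chain (0 :: 'n chain_op) = 0" using emb_chain_linear(1)[of 0 "0 :: 'n chain_op"] by simp
  then show ?thesis by (induction A rule: infinite_finite_induct) (auto simp: emb_chain_linear)
qed

lemma chain_commute: "Tm m ** Tm n = Tm n ** Tm m" "Tm m ** Tp n = Tp n ** Tm m"
  by (rule emb_chain_inj; simp add: emb_chain_mult emb_Tp emb_Tm T_commute)+

lemma chain_inverse: "\<exists>s. Tm n ** Tp n = scale_mat s (mat 1)"
proof -
  have "theta1 \<omega> (\<eta> - (\<zeta> n - \<zeta> m)) * theta1 \<omega> (\<eta> + (\<zeta> n - \<zeta> m)) \<noteq> 0" if "m \<noteq> n" for m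
    using gen_theta(2)[of "Inl (m, False)" "Inl (n, True)"] gen_theta(2)[of "Inl (n, False)" "Inl (m, True)"] that
    by (simp add: xi_shift_def algebra_simps)
  then obtain s where "T (\<zeta> n - \<eta>) * T (\<zeta> n) = op_sc s" using T_inversion by blast
  then have "emb_chain (Tm n ** Tp n) = emb_chain (scale_mat s (mat 1))"
    by (simp add: emb_chain_mult emb_Tp emb_Tm emb_chain_linear emb_chain_one)
  then show ?thesis using emb_chain_inj by blast
qed

lemma chain_interpolation:
  assumes "h n"
  shows "\<exists>L s. Tp n = (\<Sum>a\<in>UNIV. scale_mat (L a) (if h a then Tm a else Tp a)) + scale_mat s (mat 1)
    \<and> L n = ell_vand \<omega> (pts (h(n := False))) / ell_vand \<omega> (pts h) * (theta1 \<omega> (2 * \<zeta> n + 2 * \<eta>) / theta1 \<omega> (2 * \<zeta> n - 2 * \<eta>))"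
proof -
  let ?u = "pts (h(n := False)) n"
  let ?L = "\<lambda>a. lagr \<omega> (node_set h) nd (Inl (a, h a)) ?u"
  obtain s where s: "T (?u - \<eta>/2) = (\<Sum>a\<in>UNIV. op_sc (?L a) * T (pts h a - \<eta>/2)) + op_sc s"
    using T_interpolation by blast
  have "T (pts h a - \<eta>/2) = emb_chain (if h a then Tm a else Tp a)" for a
    by (simp add: emb_Tm emb_Tp pts_def xi_shift_def algebra_simps)
  then have "emb_chain (Tp n) = emb_chain ((\<Sum>a\<in>UNIV. scale_mat (?L a) (if h a then Tm a else Tp a)) + scale_mat s (mat 1))"
    using s by (simp add: emb_chain_linear emb_chain_one emb_sum emb_Tp pts_def xi_shift_def)
  then have "Tp n = (\<Sum>a\<in>UNIV. scale_mat (?L a) (if h a then Tm a else Tp a)) + scale_mat s (mat 1)" by (rule emb_chain_inj)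
  then show ?thesis using lagr_coefficient[of h n, OF assms] by (intro exI[of _ ?L] exI[of _ s] conjI)
qed

lemma orthogonality:
  fixes S v :: "'n chain_vec"
  assumes A: "\<And>n. fun_A \<omega> \<eta> \<alpha> \<zeta> \<epsilon> (\<eta>/2 - \<zeta> n) \<noteq> 0" and A': "\<And>n. fun_A \<omega> \<eta> \<alpha> \<zeta> \<epsilon>' (\<eta>/2 - \<zeta> n) \<noteq> 0"
    and V: "ell_vand \<omega> \<zeta> \<noteq> 0"
    and v: "\<And>h. pairing (left_state \<omega> \<eta> \<alpha> \<zeta> \<epsilon> S h) v =
           (if h = (\<lambda>_. False) then N0 / (ell_vand \<omega> (\<lambda>n. xi_shift \<eta> \<zeta> n False) * ell_vand \<omega> \<zeta>) else 0)"
  shows "pairing (left_state \<omega> \<eta> \<alpha> \<zeta> \<epsilon> S h) (right_state \<omega> \<eta> \<alpha> \<zeta> \<epsilon>' v k) =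
    (if h = k then (\<Prod>n\<in>UNIV. if h n then bdry_a \<omega> \<eta> \<alpha> \<epsilon> (\<eta>/2 - \<zeta> n) / bdry_a \<omega> \<eta> \<alpha> \<epsilon>' (\<eta>/2 - \<zeta> n) else 1)
       * N0 / (ell_vand \<omega> (pts h) * ell_vand \<omega> \<zeta>) else 0)"
proof -
  let ?A = "\<lambda>n. fun_A \<omega> \<eta> \<alpha> \<zeta> \<epsilon> (\<eta>/2 - \<zeta> n)" and ?A' = "\<lambda>n. fun_A \<omega> \<eta> \<alpha> \<zeta> \<epsilon>' (\<eta>/2 - \<zeta> n)"
  let ?r = "\<lambda>n. bdry_a \<omega> \<eta> \<alpha> \<epsilon> (\<eta>/2 - \<zeta> n) / bdry_a \<omega> \<eta> \<alpha> \<epsilon>' (\<eta>/2 - \<zeta> n)"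
  let ?N = "\<lambda>h. (\<Prod>n\<in>UNIV. if h n then ?r n else 1) * N0 / (ell_vand \<omega> (pts h) * ell_vand \<omega> \<zeta>)"
  let ?q = "\<lambda>h n. ell_vand \<omega> (pts (h(n := False))) / ell_vand \<omega> (pts h) * (theta1 \<omega> (2 * \<zeta> n + 2 * \<eta>) / theta1 \<omega> (2 * \<zeta> n - 2 * \<eta>))"
  let ?b = "\<lambda>n. theta1 \<omega> (2 * \<zeta> n - 2 * \<eta>) / theta1 \<omega> (2 * \<zeta> n + 2 * \<eta>) / ?A' n"
  have r: "?r n = ?A n / ?A' n" for n
    using A'[of n] unfolding fun_A_def by (simp add: field_simps)
  have rec: "?b n * (?q h n * ?A n) * ?N (h(n := False)) = ?N h" if "h n" for h n
  proof -
    have "(\<Prod>m\<in>UNIV. if h m then ?r m else 1) = ?r n * (\<Prod>m\<in>UNIV - {n}. if h m then ?r m else 1)"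
      using that by (subst prod.remove[of _ n]) auto
    moreover have "(\<Prod>m\<in>UNIV. if (h(n := False)) m then ?r m else 1) = (\<Prod>m\<in>UNIV - {n}. if h m then ?r m else 1)"
      by (subst prod.remove[of _ n]) (auto intro!: prod.cong)
    ultimately have p: "(\<Prod>m\<in>UNIV. if h m then ?r m else 1) = ?r n * (\<Prod>m\<in>UNIV. if (h(n := False)) m then ?r m else 1)" by simp
    have nz: "ell_vand \<omega> (pts h) \<noteq> 0" "ell_vand \<omega> (pts (h(n := False))) \<noteq> 0"
      "theta1 \<omega> (2 * \<zeta> n + 2 * \<eta>) \<noteq> 0" "theta1 \<omega> (2 * \<zeta> n - 2 * \<eta>) \<noteq> 0"
      using good_nodes_vand[OF om good_pts] arg_nonzero[of n] by (simp_all add: distrib_left right_diff_distrib)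
    show ?thesis unfolding p unfolding r using nz A'[of n] V by (simp add: field_simps)
  qed
  have pF: "pts (\<lambda>_. False) = (\<lambda>n. xi_shift \<eta> \<zeta> n False)" by (simp add: pts_def fun_eq_iff)
  have "pairing (S v* list_prod (map (\<lambda>n. if h n then mat 1 else scale_mat (1 / ?A n) (Tm n)) sites))
      (list_prod (map (\<lambda>n. if k n then scale_mat (?b n) (Tp n) else mat 1) sites) *v v) = (if h = k then ?N h else 0)"
  proof (rule sov_orthogonality[where q = ?q])
    show "\<exists>L s. Tp n = (\<Sum>a\<in>UNIV. scale_mat (L a) (if h a then Tm a else Tp a)) + scale_mat s (mat 1) \<and> L n = ?q h n"
      if "h n" for h n using chain_interpolation[of h n, OF that] .
    show "pairing (S v* list_prod (map (\<lambda>n. if h n then mat 1 else scale_mat (1 / ?A n) (Tm n)) sites)) v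
        = (if h = (\<lambda>_. False) then ?N h else 0)" for h
      using v[of h] unfolding left_state_def Tm_def by (simp add: pF)
  qed (rule chain_commute chain_inverse A rec; assumption?)+
  then show ?thesis unfolding left_state_def right_state_def Tm_def Tp_def .
qed

end

section \<open>Scalar products of separate states\<close>

theorem proposition4p1:
  fixes \<omega> \<eta> :: complex
    and \<alpha> :: "side \<Rightarrow> 3 \<Rightarrow> complex"
    and \<xi> :: "'n::{finite,linorder} \<Rightarrow> complex"
    and \<epsilon> \<epsilon>' :: "side \<Rightarrow> 3 \<Rightarrow> int"
    and S R :: "'n chain_vec"
    and N0 :: complex
    and P Q :: "complex \<Rightarrow> complex"
  assumes "Im \<omega> > 0"
    and "generic_crossing \<omega> \<eta>"
    and "sign_vector \<epsilon>" and "sign_vector \<epsilon>'"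
    and "generic_inhom \<omega> \<eta> \<xi>"
    and "ell_vand \<omega> \<xi> \<noteq> 0"
    and "\<And>\<sigma> i. theta1 \<omega> (\<alpha> \<sigma> i) \<noteq> 0"
    and "\<And>n. fun_A \<omega> \<eta> \<alpha> \<xi> \<epsilon> (\<eta>/2 - \<xi> n) \<noteq> 0"
    and "\<And>n. fun_A \<omega> \<eta> \<alpha> \<xi> \<epsilon>' (\<eta>/2 - \<xi> n) \<noteq> 0"
    and "\<not> ((\<forall>u. \<exists>c. K_plus \<omega> \<eta> \<alpha> u = scale_mat c (mat 1)) \<and>
              (\<forall>u. \<exists>c. K_minus \<omega> \<eta> \<alpha> u = scale_mat c (mat 1)))"
    and "covector_basis (left_state \<omega> \<eta> \<alpha> \<xi> \<epsilon> S)"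
    and "N0 \<noteq> 0"
    and "\<And>h. pairing (left_state \<omega> \<eta> \<alpha> \<xi> \<epsilon> S h) R =
           (if h = (\<lambda>_. False)
            then N0 / (ell_vand \<omega> (\<lambda>n. xi_shift \<eta> \<xi> n False) * ell_vand \<omega> \<xi>) else 0)"
  shows "let num = (\<lambda>\<Theta> :: 'n \<Rightarrow> complex \<Rightarrow> complex.
               det (\<chi> i j.
                 P (xi_shift \<eta> \<xi> i False) * Q (xi_shift \<eta> \<xi> i False) * \<Theta> j (xi_shift \<eta> \<xi> i True)
                 - bdry_a \<omega> \<eta> \<alpha> \<epsilon> (\<eta>/2 + \<xi> i) / bdry_a \<omega> \<eta> \<alpha> \<epsilon>' (\<eta>/2 - \<xi> i)
                   * P (xi_shift \<eta> \<xi> i True) * Q (xi_shift \<eta> \<xi> i True)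
                   * \<Theta> j (xi_shift \<eta> \<xi> i False)));
             den = (\<lambda>\<Theta> :: 'n \<Rightarrow> complex \<Rightarrow> complex. det (\<chi> i j. \<Theta> j (\<xi> i)))
         in (\<forall>\<Theta>. Xi_basis \<omega> \<Theta> \<longrightarrow>
               den \<Theta> \<noteq> 0 \<and>
               pairing (separate_bra \<omega> \<eta> \<alpha> \<xi> \<epsilon> S N0 P) (separate_ket \<omega> \<eta> \<alpha> \<xi> \<epsilon>' R Q)
                 = num \<Theta> / den \<Theta>) \<and>
            (\<forall>\<Theta> \<Theta>'. Xi_basis \<omega> \<Theta> \<and> Xi_basis \<omega> \<Theta>' \<longrightarrow>
               num \<Theta> / den \<Theta> = num \<Theta>' / den \<Theta>')"
proof -
  note om = assms(1) and gen = assms(5) and V = assms(6) and A = assms(8) and A' = assms(9) and N0 = assms(12) and v = assms(13)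
  interpret generic_model \<omega> \<eta> \<alpha> \<xi> by unfold_locales (rule om gen)+
  let ?a = "\<lambda>n. bdry_a \<omega> \<eta> \<alpha> \<epsilon> (\<eta>/2 - \<xi> n)" and ?a' = "\<lambda>n. bdry_a \<omega> \<eta> \<alpha> \<epsilon>' (\<eta>/2 - \<xi> n)"
    and ?c = "\<lambda>n. bdry_a \<omega> \<eta> \<alpha> \<epsilon> (\<eta>/2 + \<xi> n)"
  let ?V = "\<lambda>h. ell_vand \<omega> (pts h)" and ?W = "ell_vand \<omega> \<xi>"
  define p where "p n = P (xi_shift \<eta> \<xi> n False) * Q (xi_shift \<eta> \<xi> n False)" for n
  define q where "q n = - (?c n / ?a' n * P (xi_shift \<eta> \<xi> n True) * Q (xi_shift \<eta> \<xi> n True))" for n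
  let ?bra = "separate_bra \<omega> \<eta> \<alpha> \<xi> \<epsilon> S N0 P" and ?ket = "separate_ket \<omega> \<eta> \<alpha> \<xi> \<epsilon>' R Q"
  define num den where "num = (\<lambda>\<Theta> :: 'n \<Rightarrow> complex \<Rightarrow> complex.
               det (\<chi> i j.
                 P (xi_shift \<eta> \<xi> i False) * Q (xi_shift \<eta> \<xi> i False) * \<Theta> j (xi_shift \<eta> \<xi> i True)
                 - bdry_a \<omega> \<eta> \<alpha> \<epsilon> (\<eta>/2 + \<xi> i) / bdry_a \<omega> \<eta> \<alpha> \<epsilon>' (\<eta>/2 - \<xi> i)
                   * P (xi_shift \<eta> \<xi> i True) * Q (xi_shift \<eta> \<xi> i True)
                   * \<Theta> j (xi_shift \<eta> \<xi> i False)))"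
    and "den = (\<lambda>\<Theta> :: 'n \<Rightarrow> complex \<Rightarrow> complex. det (\<chi> i j. \<Theta> j (\<xi> i)))"
  have a0: "?a n \<noteq> 0" for n using A[of n] unfolding fun_A_def by auto
  have neg: "(\<lambda>n. xi_shift \<eta> \<xi> n (\<not> h n)) = pts (\<lambda>n. \<not> h n)" for h by (simp add: pts_def fun_eq_iff)
  have pos: "(\<lambda>n. xi_shift \<eta> \<xi> n (h n)) = pts h" for h by (simp add: pts_def fun_eq_iff)
  \<comment> \<open>Orthogonality leaves a single sum over \<open>h\<close>.\<close>
  have expand: "pairing ?bra ?ket = (\<Sum>h\<in>UNIV. (\<Prod>n\<in>UNIV. if h n then q n else p n) * ?V (\<lambda>n. \<not> h n) / ?W)"
  proof -
    let ?f = "\<lambda>h. (\<Prod>n\<in>UNIV. (- ?c n / ?a n) ^ (of_bool (h n)) * P (xi_shift \<eta> \<xi> n (h n))) * ?V (\<lambda>n. \<not> h n)"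
    let ?g = "\<lambda>h. (\<Prod>n\<in>UNIV. Q (xi_shift \<eta> \<xi> n (h n))) * ?V h"
    let ?r = "\<lambda>h. \<Prod>n\<in>UNIV. if h n then ?a n / ?a' n else 1"
    have "pairing ?bra ?ket = 1 / N0 * (\<Sum>h\<in>UNIV. ?f h * (\<Sum>k\<in>UNIV. ?g k *
        pairing (left_state \<omega> \<eta> \<alpha> \<xi> \<epsilon> S h) (right_state \<omega> \<eta> \<alpha> \<xi> \<epsilon>' R k)))"
      unfolding separate_bra_def pairing_linear(2,3) unfolding separate_ket_def pairing_linear(4,5) neg pos ..
    also have "\<dots> = 1 / N0 * (\<Sum>h\<in>UNIV. ?f h * (?g h * (?r h * N0 / (?V h * ?W))))"
      unfolding orthogonality[OF A A' V v]
      by (simp add: if_distrib[of "\<lambda>x. _ * x"] cong: if_cong)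
    also have "\<dots> = (\<Sum>h\<in>UNIV. (\<Prod>n\<in>UNIV. if h n then q n else p n) * ?V (\<lambda>n. \<not> h n) / ?W)"
      unfolding sum_distrib_left
    proof (rule sum.cong[OF refl])
      fix h :: "'n \<Rightarrow> bool"
      have e: "(\<Prod>n\<in>UNIV. (- ?c n / ?a n) ^ (of_bool (h n)) * P (xi_shift \<eta> \<xi> n (h n)))
          * (\<Prod>n\<in>UNIV. Q (xi_shift \<eta> \<xi> n (h n))) * ?r h = (\<Prod>n\<in>UNIV. if h n then q n else p n)"
        unfolding prod.distrib[symmetric]
        by (rule prod.cong) (use a0 in \<open>auto simp: p_def q_def\<close>)
      show "1 / N0 * (?f h * (?g h * (?r h * N0 / (?V h * ?W)))) = (\<Prod>n\<in>UNIV. if h n then q n else p n) * ?V (\<lambda>n. \<not> h n) / ?W"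
        unfolding e[symmetric] using N0 V good_nodes_vand[OF om good_pts[of h]] by simp
    qed
    finally show ?thesis .
  qed
  \<comment> \<open>The same sum is the expansion of the determinant in the numerator by its rows, because the Vandermonde determinants
     are ratios of determinants of the basis functions.\<close>
  have expand': "(\<Sum>h\<in>UNIV. (\<Prod>n\<in>UNIV. if h n then q n else p n) * ?V (\<lambda>n. \<not> h n) / ?W) = num \<Theta> / den \<Theta>"
    and den: "den \<Theta> \<noteq> 0" if \<Theta>: "Xi_basis \<omega> \<Theta>" for \<Theta>
  proof -
    have \<xi>: "good_nodes \<omega> UNIV \<xi>" by (rule good_nodes_of_vand[OF om arg_nonzero(1) V])
    show den: "den \<Theta> \<noteq> 0" unfolding den_def by (rule Xi_basis_det(1)[OF om \<xi> \<Theta>])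
    have d: "det (\<chi> i j. \<Theta> j (pts h i)) = ?V h * den \<Theta> / ?W" for h
      using Xi_basis_det(2)[OF om \<xi> \<Theta> good_pts] V unfolding den_def by (simp add: eq_divide_eq)
    have "num \<Theta> = det (\<chi> i. p i *s (\<chi> j. \<Theta> j (xi_shift \<eta> \<xi> i True)) + q i *s (\<chi> j. \<Theta> j (xi_shift \<eta> \<xi> i False)))"
      unfolding num_def by (rule arg_cong[of _ _ det]) (simp add: vec_eq_iff p_def q_def)
    also have "\<dots> = (\<Sum>h\<in>UNIV. (\<Prod>i\<in>UNIV. if h i then q i else p i) * det (\<chi> i j. \<Theta> j (pts (\<lambda>n. \<not> h n) i)))"
      unfolding det_two_rows
      by (rule sum.cong[OF refl], rule arg_cong2[of _ _ _ _ "(*)", OF refl], rule arg_cong[of _ _ det]) (simp add: vec_eq_iff pts_def)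
    also have "\<dots> / den \<Theta> = (\<Sum>h\<in>UNIV. (\<Prod>n\<in>UNIV. if h n then q n else p n) * ?V (\<lambda>n. \<not> h n) / ?W)"
      unfolding d sum_divide_distrib using den by simp
    finally show "(\<Sum>h\<in>UNIV. (\<Prod>n\<in>UNIV. if h n then q n else p n) * ?V (\<lambda>n. \<not> h n) / ?W) = num \<Theta> / den \<Theta>" ..
  qed
  show ?thesis
    unfolding Let_def num_def[symmetric] den_def[symmetric] using expand expand' den by metis
qed

end
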